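(* Let $\mathcal{W}$ be a cocomplete monoidal category whose monoidal product preserves colimits in each variable, and let $H:\square\to\mathcal{W}$ be a strong monoidal functor. Then the nerve $N^H:\mathcal{W}\mathrm{Cat}\to\mathrm{SSet}$ is necklicial with associated diagram given by the composite $$\mathcal{N}ec\xrightarrow{\dim}\square\xrightarrow{H}\mathcal{W},$$ i.e. $N^H\simeq N^{\Phi(H\circ\dim)}$.
   Context: Cubes. $\square$ is the subcategory of $\mathrm{Cat}$ with objects the posets $[1]^n$, $n\ge0$, generated by $\delta^\epsilon_i:[1]^{n-1}\to[1]^n$ (insert $\epsilon\in\{0,1\}$ in position $i$), $\sigma_i:[1]^{n+1}\to[1]^n$ (delete the $i$-th coordinate) and $\gamma_i:[1]^{n+1}\to[1]^n$ (replace coordinates $\epsilon_i,\epsilon_{i+1}$ by $\max(\epsilon_i,\epsilon_{i+1})$); it is monoidal with $[1]^m\otimes[1]^n=[1]^{m+n}$. $\mathrm{CSet}=\mathrm{Set}^{\square^{op}}$ with Day convolution, $\square^n=\square(-,[1]^n)$; $\mathrm{Cat}_\square$ is the category of small $\mathrm{CSet}$-enriched categories. Enriched compositions are written $\mathcal{C}(A,B)\otimes\mathcal{C}(B,C)\to\mathcal{C}(A,C)$; $\mathcal{W}\mathrm{Cat}$ is the category of small $\mathcal{W}$-categories. Cubical nerve. Let $\mathbf{\Delta}$ be the simplex category. $N^{cub}:\mathrm{Cat}_\square\to\mathrm{SSet}$ is $N^{cub}(\mathcal{C})_n=\mathrm{Cat}_\square(W_c^n,\mathcal{C})$, where $W_c^n$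 has object set $[n]$ and $W^n_c(i,j)=\square^{j-i-1}$ if $i<j$, $\square^0$ if $i=j$, $\emptyset$ if $i>j$; the composition for $i<j<k$ is $\square^{j-i-1}\otimes\square^{k-j-1}\simeq\square^{k-i-2}\xrightarrow{\delta^1_{j-i}}\square^{k-i-1}$. Maps of $\mathbf{\Delta}$ act on objects in the evident way, and for $i<j$: $W_c(\delta_k)_{i,j}=\delta^0_{k-i}$ if $i<k\le j$ and the identity otherwise; $W_c(\sigma_k)_{i,j}=\sigma_1$ if $k=i<j-1$, $\gamma_{k-i}$ if $i<k<j-1$, $\sigma_{j-i-1}$ if $i<k=j-1$, and the identity otherwise. The nerve $N^H$. $H$ induces by left Kan extension along the Yoneda embedding a strong monoidal left adjoint $\mathrm{CSet}\to\mathcal{W}$ with lax monoidal right adjoint $R^H(W)_n=\mathcal{W}(H([1]^n),W)$. Applying $R^H$ to hom-objects gives $R^H:\mathcal{W}\mathrm{Cat}\to\mathrm{Cat}_\square$, and $N^H=N^{cub}\circ R^H$. Necklaces. A necklace is a pair $(T,p)$ with $\{0,p\}\subseteq T\subseteq[p]$, corresponding to the bipointed simplicial set $\Delta^{n_1}\vee\dots\vee\Delta^{n_k}$ (simplices glued end to end) with $n_i$ the successive differences of elements of $T$; $\Delta^n=(\{0,n\},n)$. A map $(T,p)\to(U,q)$ is an order-preserving $f:[p]\to[q]$ with $f(0)=0$, $f(p)=q$, $U\subseteq f(T)$. These form the category $\mathcal{N}ec$, monoidal under $(T,p)\vee(U,q)=(T\cup(p+U),p+q)$. Put $\dim(T)=|[p]\setminus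 T|$. The strong monoidal functor $\dim:\mathcal{N}ec\to\square$, $T\mapsto[1]^{\dim T}$, is obtained by identifying $[1]^{\dim T}$ with the poset $\{V\mid T\subseteq V\subseteq[p]\}$ ordered by inclusion (the $j$-th coordinate of $V$ is $1$ iff the $j$-th element of $[p]\setminus T$ lies in $V$) and letting $f:(T,p)\to(U,q)$ act by $V\mapsto f(V)$. Necklicial nerves. For $D:\mathcal{N}ec\to\mathcal{W}$ strong monoidal, $\Phi(D):\mathbf{\Delta}\to\mathcal{W}\mathrm{Cat}$ sends $[n]$ to the $\mathcal{W}$-category with object set $[n]$ and homs $\Phi(D)^n(i,j)=D(\Delta^{j-i})$ if $i\le j$ and initial if $i>j$, composition $D(\Delta^{k-i})\otimes D(\Delta^{j-k})\simeq D(\Delta^{k-i}\vee\Delta^{j-k})\to D(\Delta^{j-i})$ (induced by the necklace map with underlying map the identity), identities $I\simeq D(\Delta^0)$; $f:[m]\to[n]$ acts as $f$ on objects and by $D(f_{i,j})$ on homs, $f_{i,j}(k)=f(k+i)-f(i)$. For $\mathbb{D}:\mathbf{\Delta}\to\mathcal{W}\mathrm{Cat}$, $N^{\mathbb{D}}(\mathcal{C})_n=\mathcal{W}\mathrm{Cat}(\mathbb{D}^n,\mathcal{C})$; a functor $\mathcal{W}\mathrm{Cat}\to\mathrm{SSet}$ is necklicial with associated diagram $D$ if it is isomorphic to $N^{\Phi(D)}$ with $D$ strong monoidal. *)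

theory Defs
  imports "HOL-Library.FuncSet"
begin

section \<open>Categories, functors, colimits\<close>

text \<open>Hom-sets are indexed by source and target and need not be disjoint, so composition and
  the arrow part of a functor take the objects as arguments.
  \<open>Comp C X Y Z g f\<close> is \<open>g \<circ> f : X \<rightarrow> Y \<rightarrow> Z\<close>.\<close>

record ('o, 'a) cat =
  Ob :: "'o set"
  Hom :: "'o \<Rightarrow> 'o \<Rightarrow> 'a set"
  Comp :: "'o \<Rightarrow> 'o \<Rightarrow> 'o \<Rightarrow> 'a \<Rightarrow> 'a \<Rightarrow> 'a"
  Idn :: "'o \<Rightarrow> 'a"

definition category :: "('o, 'a, 'z) cat_scheme \<Rightarrow> bool" where
  "category C \<longleftrightarrow>
    (\<forall>X\<in>Ob C. Idn C X \<in> Hom C X X) \<and>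
    (\<forall>X\<in>Ob C. \<forall>Y\<in>Ob C. \<forall>Z\<in>Ob C. \<forall>f\<in>Hom C X Y. \<forall>g\<in>Hom C Y Z.
      Comp C X Y Z g f \<in> Hom C X Z) \<and>
    (\<forall>X\<in>Ob C. \<forall>Y\<in>Ob C. \<forall>f\<in>Hom C X Y.
      Comp C X X Y f (Idn C X) = f \<and> Comp C X Y Y (Idn C Y) f = f) \<and>
    (\<forall>X\<in>Ob C. \<forall>Y\<in>Ob C. \<forall>Z\<in>Ob C. \<forall>T\<in>Ob C.
      \<forall>f\<in>Hom C X Y. \<forall>g\<in>Hom C Y Z. \<forall>h\<in>Hom C Z T.
      Comp C X Z T h (Comp C X Y Z g f) = Comp C X Y T (Comp C Y Z T h g) f)"

definition inverse_arrows :: "('o, 'a, 'z) cat_scheme \<Rightarrow> 'o \<Rightarrow> 'o \<Rightarrow> 'a \<Rightarrow> 'a \<Rightarrow> bool" where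
  "inverse_arrows C X Y f g \<longleftrightarrow> f \<in> Hom C X Y \<and> g \<in> Hom C Y X \<and>
    Comp C X Y X g f = Idn C X \<and> Comp C Y X Y f g = Idn C Y"

definition iso_arrow :: "('o, 'a, 'z) cat_scheme \<Rightarrow> 'o \<Rightarrow> 'o \<Rightarrow> 'a \<Rightarrow> bool" where
  "iso_arrow C X Y f \<longleftrightarrow> (\<exists>g. inverse_arrows C X Y f g)"

definition inv_arrow :: "('o, 'a, 'z) cat_scheme \<Rightarrow> 'o \<Rightarrow> 'o \<Rightarrow> 'a \<Rightarrow> 'a" where
  "inv_arrow C X Y f = (THE g. inverse_arrows C X Y f g)"

definition is_initial :: "('o, 'a, 'z) cat_scheme \<Rightarrow> 'o \<Rightarrow> bool" where
  "is_initial C X \<longleftrightarrow> X \<in> Ob C \<and> (\<forall>Y\<in>Ob C. \<exists>!f. f \<in> Hom C X Y)"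

definition initial_ob :: "('o, 'a, 'z) cat_scheme \<Rightarrow> 'o" where
  "initial_ob C = (SOME X. is_initial C X)"

definition the_arrow :: "('o, 'a, 'z) cat_scheme \<Rightarrow> 'o \<Rightarrow> 'o \<Rightarrow> 'a" where
  "the_arrow C X Y = (THE f. f \<in> Hom C X Y)"

record ('o, 'a, 'p, 'b) functr =
  Fo :: "'o \<Rightarrow> 'p"
  Fa :: "'o \<Rightarrow> 'o \<Rightarrow> 'a \<Rightarrow> 'b"

definition is_functor ::
  "('o, 'a, 'z) cat_scheme \<Rightarrow> ('p, 'b, 'y) cat_scheme \<Rightarrow> ('o, 'a, 'p, 'b, 'x) functr_scheme \<Rightarrow> bool"
where
  "is_functor C D F \<longleftrightarrow>
    (\<forall>X\<in>Ob C. Fo F X \<in> Ob D) \<and>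
    (\<forall>X\<in>Ob C. \<forall>Y\<in>Ob C. \<forall>f\<in>Hom C X Y. Fa F X Y f \<in> Hom D (Fo F X) (Fo F Y)) \<and>
    (\<forall>X\<in>Ob C. Fa F X X (Idn C X) = Idn D (Fo F X)) \<and>
    (\<forall>X\<in>Ob C. \<forall>Y\<in>Ob C. \<forall>Z\<in>Ob C. \<forall>f\<in>Hom C X Y. \<forall>g\<in>Hom C Y Z.
      Fa F X Z (Comp C X Y Z g f) =
      Comp D (Fo F X) (Fo F Y) (Fo F Z) (Fa F Y Z g) (Fa F X Y f))"

definition functor_comp ::
  "('p, 'b, 'q, 'c) functr \<Rightarrow> ('o, 'a, 'p, 'b) functr \<Rightarrow> ('o, 'a, 'q, 'c) functr" where
  "functor_comp G F =
    \<lparr>Fo = (\<lambda>X. Fo G (Fo F X)), Fa = (\<lambda>X Y f. Fa G (Fo F X) (Fo F Y) (Fa F X Y f))\<rparr>"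

definition cocone ::
  "('j, 'k, 'y) cat_scheme \<Rightarrow> ('o, 'a, 'z) cat_scheme \<Rightarrow> ('j, 'k, 'o, 'a) functr \<Rightarrow>
    'o \<Rightarrow> ('j \<Rightarrow> 'a) \<Rightarrow> bool" where
  "cocone J C F X \<iota> \<longleftrightarrow> X \<in> Ob C \<and> (\<forall>j\<in>Ob J. \<iota> j \<in> Hom C (Fo F j) X) \<and>
    (\<forall>i\<in>Ob J. \<forall>j\<in>Ob J. \<forall>u\<in>Hom J i j. Comp C (Fo F i) (Fo F j) X (\<iota> j) (Fa F i j u) = \<iota> i)"

definition colimit ::
  "('j, 'k, 'y) cat_scheme \<Rightarrow> ('o, 'a, 'z) cat_scheme \<Rightarrow> ('j, 'k, 'o, 'a) functr \<Rightarrow>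
    'o \<Rightarrow> ('j \<Rightarrow> 'a) \<Rightarrow> bool" where
  "colimit J C F X \<iota> \<longleftrightarrow> cocone J C F X \<iota> \<and>
    (\<forall>Y \<kappa>. cocone J C F Y \<kappa> \<longrightarrow>
      (\<exists>!h. h \<in> Hom C X Y \<and> (\<forall>j\<in>Ob J. Comp C (Fo F j) X Y h (\<iota> j) = \<kappa> j)))"

text \<open>The type \<open>'u\<close> plays the role of the universe of small sets: a small category is one whose
  objects and arrows are elements of \<open>'u\<close>. (Quantifying over diagrams with arrows in the arrow
  type of \<open>C\<close> itself would, by Freyd's theorem, leave only preorders.)\<close>

definition cocomplete :: "'u itself \<Rightarrow> ('o, 'a, 'z) cat_scheme \<Rightarrow> bool" where
  "cocomplete u C \<longleftrightarrow>
    (\<forall>(J :: ('u, 'u) cat) F. category J \<and> is_functor J C F \<longrightarrow> (\<exists>X \<iota>. colimit J C F X \<iota>))"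

definition preserves_colimits ::
  "'u itself \<Rightarrow> ('o, 'a, 'z) cat_scheme \<Rightarrow> ('p, 'b, 'y) cat_scheme \<Rightarrow> ('o, 'a, 'p, 'b) functr \<Rightarrow> bool"
where
  "preserves_colimits u C D G \<longleftrightarrow>
    (\<forall>(J :: ('u, 'u) cat) F X \<iota>. category J \<and> is_functor J C F \<and> colimit J C F X \<iota> \<longrightarrow>
      colimit J D (functor_comp G F) (Fo G X) (\<lambda>j. Fa G (Fo F j) X (\<iota> j)))"


section \<open>Monoidal categories and monoidal functors\<close>

text \<open>\<open>TA C X X' Y Y' f g\<close> is \<open>f \<otimes> g : X \<otimes> Y \<rightarrow> X' \<otimes> Y'\<close> for \<open>f : X \<rightarrow> X'\<close>, \<open>g : Y \<rightarrow> Y'\<close>; the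
  associator is \<open>(X \<otimes> Y) \<otimes> Z \<rightarrow> X \<otimes> (Y \<otimes> Z)\<close>, the unitors are \<open>I \<otimes> X \<rightarrow> X\<close> and \<open>X \<otimes> I \<rightarrow> X\<close>.\<close>

record ('o, 'a) moncat = "('o, 'a) cat" +
  TO :: "'o \<Rightarrow> 'o \<Rightarrow> 'o"
  TA :: "'o \<Rightarrow> 'o \<Rightarrow> 'o \<Rightarrow> 'o \<Rightarrow> 'a \<Rightarrow> 'a \<Rightarrow> 'a"
  Unit :: "'o"
  Assoc :: "'o \<Rightarrow> 'o \<Rightarrow> 'o \<Rightarrow> 'a"
  LUnit :: "'o \<Rightarrow> 'a"
  RUnit :: "'o \<Rightarrow> 'a"

definition monoidal_category :: "('o, 'a) moncat \<Rightarrow> bool" where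
  "monoidal_category C \<longleftrightarrow> category C \<and>
    Unit C \<in> Ob C \<and> (\<forall>X\<in>Ob C. \<forall>Y\<in>Ob C. TO C X Y \<in> Ob C) \<and>
    (\<forall>X\<in>Ob C. \<forall>X'\<in>Ob C. \<forall>Y\<in>Ob C. \<forall>Y'\<in>Ob C. \<forall>f\<in>Hom C X X'. \<forall>g\<in>Hom C Y Y'.
      TA C X X' Y Y' f g \<in> Hom C (TO C X Y) (TO C X' Y')) \<and>
    (\<forall>X\<in>Ob C. \<forall>Y\<in>Ob C. TA C X X Y Y (Idn C X) (Idn C Y) = Idn C (TO C X Y)) \<and>
    (\<forall>X\<in>Ob C. \<forall>X'\<in>Ob C. \<forall>X''\<in>Ob C. \<forall>Y\<in>Ob C. \<forall>Y'\<in>Ob C. \<forall>Y''\<in>Ob C.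
      \<forall>f\<in>Hom C X X'. \<forall>f'\<in>Hom C X' X''. \<forall>g\<in>Hom C Y Y'. \<forall>g'\<in>Hom C Y' Y''.
      TA C X X'' Y Y'' (Comp C X X' X'' f' f) (Comp C Y Y' Y'' g' g) =
      Comp C (TO C X Y) (TO C X' Y') (TO C X'' Y'')
        (TA C X' X'' Y' Y'' f' g') (TA C X X' Y Y' f g)) \<and>
    (\<forall>X\<in>Ob C. \<forall>Y\<in>Ob C. \<forall>Z\<in>Ob C.
      iso_arrow C (TO C (TO C X Y) Z) (TO C X (TO C Y Z)) (Assoc C X Y Z)) \<and>
    (\<forall>X\<in>Ob C. \<forall>X'\<in>Ob C. \<forall>Y\<in>Ob C. \<forall>Y'\<in>Ob C. \<forall>Z\<in>Ob C. \<forall>Z'\<in>Ob C.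
      \<forall>f\<in>Hom C X X'. \<forall>g\<in>Hom C Y Y'. \<forall>h\<in>Hom C Z Z'.
      Comp C (TO C (TO C X Y) Z) (TO C (TO C X' Y') Z') (TO C X' (TO C Y' Z'))
        (Assoc C X' Y' Z') (TA C (TO C X Y) (TO C X' Y') Z Z' (TA C X X' Y Y' f g) h) =
      Comp C (TO C (TO C X Y) Z) (TO C X (TO C Y Z)) (TO C X' (TO C Y' Z'))
        (TA C X X' (TO C Y Z) (TO C Y' Z') f (TA C Y Y' Z Z' g h)) (Assoc C X Y Z)) \<and>
    (\<forall>X\<in>Ob C. iso_arrow C (TO C (Unit C) X) X (LUnit C X) \<and>
              iso_arrow C (TO C X (Unit C)) X (RUnit C X)) \<and>
    (\<forall>X\<in>Ob C. \<forall>Y\<in>Ob C. \<forall>f\<in>Hom C X Y.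
      Comp C (TO C (Unit C) X) (TO C (Unit C) Y) Y
        (LUnit C Y) (TA C (Unit C) (Unit C) X Y (Idn C (Unit C)) f) =
      Comp C (TO C (Unit C) X) X Y f (LUnit C X) \<and>
      Comp C (TO C X (Unit C)) (TO C Y (Unit C)) Y
        (RUnit C Y) (TA C X Y (Unit C) (Unit C) f (Idn C (Unit C))) =
      Comp C (TO C X (Unit C)) X Y f (RUnit C X)) \<and>
    (\<forall>X\<in>Ob C. \<forall>Y\<in>Ob C. \<forall>Z\<in>Ob C. \<forall>T\<in>Ob C.
      Comp C (TO C (TO C (TO C X Y) Z) T) (TO C (TO C X Y) (TO C Z T)) (TO C X (TO C Y (TO C Z T)))
        (Assoc C X Y (TO C Z T)) (Assoc C (TO C X Y) Z T) =
      Comp C (TO C (TO C (TO C X Y) Z) T) (TO C X (TO C (TO C Y Z) T)) (TO C X (TO C Y (TO C Z T)))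
        (TA C X X (TO C (TO C Y Z) T) (TO C Y (TO C Z T)) (Idn C X) (Assoc C Y Z T))
        (Comp C (TO C (TO C (TO C X Y) Z) T) (TO C (TO C X (TO C Y Z)) T)
            (TO C X (TO C (TO C Y Z) T))
          (Assoc C X (TO C Y Z) T)
          (TA C (TO C (TO C X Y) Z) (TO C X (TO C Y Z)) T T (Assoc C X Y Z) (Idn C T)))) \<and>
    (\<forall>X\<in>Ob C. \<forall>Y\<in>Ob C.
      Comp C (TO C (TO C X (Unit C)) Y) (TO C X (TO C (Unit C) Y)) (TO C X Y)
        (TA C X X (TO C (Unit C) Y) Y (Idn C X) (LUnit C Y)) (Assoc C X (Unit C) Y) =
      TA C (TO C X (Unit C)) X Y Y (RUnit C X) (Idn C Y))"

definition tensor_left :: "('o, 'a) moncat \<Rightarrow> 'o \<Rightarrow> ('o, 'a, 'o, 'a) functr" where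
  "tensor_left C X = \<lparr>Fo = TO C X, Fa = (\<lambda>Y Y'. TA C X X Y Y' (Idn C X))\<rparr>"

definition tensor_right :: "('o, 'a) moncat \<Rightarrow> 'o \<Rightarrow> ('o, 'a, 'o, 'a) functr" where
  "tensor_right C Y = \<lparr>Fo = (\<lambda>X. TO C X Y), Fa = (\<lambda>X X' f. TA C X X' Y Y f (Idn C Y))\<rparr>"

definition tensor_preserves_colimits :: "'u itself \<Rightarrow> ('o, 'a) moncat \<Rightarrow> bool" where
  "tensor_preserves_colimits u C \<longleftrightarrow>
    (\<forall>X\<in>Ob C. preserves_colimits u C C (tensor_left C X) \<and>
              preserves_colimits u C C (tensor_right C X))"

text \<open>\<open>Mu F X Y : F X \<otimes> F Y \<rightarrow> F (X \<otimes> Y)\<close> and \<open>Eps F : I \<rightarrow> F I\<close>.\<close>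

record ('o, 'a, 'p, 'b) mfunctr = "('o, 'a, 'p, 'b) functr" +
  Mu :: "'o \<Rightarrow> 'o \<Rightarrow> 'b"
  Eps :: 'b

definition strong_monoidal_functor ::
  "('o, 'a) moncat \<Rightarrow> ('p, 'b) moncat \<Rightarrow> ('o, 'a, 'p, 'b) mfunctr \<Rightarrow> bool" where
  "strong_monoidal_functor C D F \<longleftrightarrow> is_functor C D F \<and>
    iso_arrow D (Unit D) (Fo F (Unit C)) (Eps F) \<and>
    (\<forall>X\<in>Ob C. \<forall>Y\<in>Ob C. iso_arrow D (TO D (Fo F X) (Fo F Y)) (Fo F (TO C X Y)) (Mu F X Y)) \<and>
    (\<forall>X\<in>Ob C. \<forall>X'\<in>Ob C. \<forall>Y\<in>Ob C. \<forall>Y'\<in>Ob C. \<forall>f\<in>Hom C X X'. \<forall>g\<in>Hom C Y Y'.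
      Comp D (TO D (Fo F X) (Fo F Y)) (TO D (Fo F X') (Fo F Y')) (Fo F (TO C X' Y'))
        (Mu F X' Y')
        (TA D (Fo F X) (Fo F X') (Fo F Y) (Fo F Y') (Fa F X X' f) (Fa F Y Y' g)) =
      Comp D (TO D (Fo F X) (Fo F Y)) (Fo F (TO C X Y)) (Fo F (TO C X' Y'))
        (Fa F (TO C X Y) (TO C X' Y') (TA C X X' Y Y' f g)) (Mu F X Y)) \<and>
    (\<forall>X\<in>Ob C. \<forall>Y\<in>Ob C. \<forall>Z\<in>Ob C.
      Comp D (TO D (TO D (Fo F X) (Fo F Y)) (Fo F Z)) (Fo F (TO C (TO C X Y) Z))
          (Fo F (TO C X (TO C Y Z)))
        (Fa F (TO C (TO C X Y) Z) (TO C X (TO C Y Z)) (Assoc C X Y Z))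
        (Comp D (TO D (TO D (Fo F X) (Fo F Y)) (Fo F Z)) (TO D (Fo F (TO C X Y)) (Fo F Z))
            (Fo F (TO C (TO C X Y) Z))
          (Mu F (TO C X Y) Z)
          (TA D (TO D (Fo F X) (Fo F Y)) (Fo F (TO C X Y)) (Fo F Z) (Fo F Z)
            (Mu F X Y) (Idn D (Fo F Z)))) =
      Comp D (TO D (TO D (Fo F X) (Fo F Y)) (Fo F Z)) (TO D (Fo F X) (TO D (Fo F Y) (Fo F Z)))
          (Fo F (TO C X (TO C Y Z)))
        (Comp D (TO D (Fo F X) (TO D (Fo F Y) (Fo F Z))) (TO D (Fo F X) (Fo F (TO C Y Z)))
            (Fo F (TO C X (TO C Y Z)))
          (Mu F X (TO C Y Z))
          (TA D (Fo F X) (Fo F X) (TO D (Fo F Y) (Fo F Z)) (Fo F (TO C Y Z))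
            (Idn D (Fo F X)) (Mu F Y Z)))
        (Assoc D (Fo F X) (Fo F Y) (Fo F Z))) \<and>
    (\<forall>X\<in>Ob C.
      Comp D (TO D (Unit D) (Fo F X)) (Fo F (TO C (Unit C) X)) (Fo F X)
        (Fa F (TO C (Unit C) X) X (LUnit C X))
        (Comp D (TO D (Unit D) (Fo F X)) (TO D (Fo F (Unit C)) (Fo F X)) (Fo F (TO C (Unit C) X))
          (Mu F (Unit C) X)
          (TA D (Unit D) (Fo F (Unit C)) (Fo F X) (Fo F X) (Eps F) (Idn D (Fo F X)))) =
      LUnit D (Fo F X) \<and>
      Comp D (TO D (Fo F X) (Unit D)) (Fo F (TO C X (Unit C))) (Fo F X)
        (Fa F (TO C X (Unit C)) X (RUnit C X))
        (Comp D (TO D (Fo F X) (Unit D)) (TO D (Fo F X) (Fo F (Unit C))) (Fo F (TO C X (Unit C)))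
          (Mu F X (Unit C))
          (TA D (Fo F X) (Fo F X) (Unit D) (Fo F (Unit C)) (Idn D (Fo F X)) (Eps F))) =
      RUnit D (Fo F X))"

definition monoidal_functor_comp ::
  "('q, 'c) moncat \<Rightarrow> ('p, 'b) moncat \<Rightarrow> ('o, 'a) moncat \<Rightarrow>
    ('p, 'b, 'q, 'c) mfunctr \<Rightarrow> ('o, 'a, 'p, 'b) mfunctr \<Rightarrow> ('o, 'a, 'q, 'c) mfunctr" where
  "monoidal_functor_comp E D C G F =
    \<lparr>Fo = (\<lambda>X. Fo G (Fo F X)),
     Fa = (\<lambda>X Y f. Fa G (Fo F X) (Fo F Y) (Fa F X Y f)),
     Mu = (\<lambda>X Y.
       Comp E (TO E (Fo G (Fo F X)) (Fo G (Fo F Y))) (Fo G (TO D (Fo F X) (Fo F Y)))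
           (Fo G (Fo F (TO C X Y)))
         (Fa G (TO D (Fo F X) (Fo F Y)) (Fo F (TO C X Y)) (Mu F X Y)) (Mu G (Fo F X) (Fo F Y))),
     Eps = Comp E (Unit E) (Fo G (Unit D)) (Fo G (Fo F (Unit C)))
         (Fa G (Unit D) (Fo F (Unit C)) (Eps F)) (Eps G)\<rparr>"


section \<open>Enriched categories\<close>

text \<open>\<open>ECmp C x y z : C(x,y) \<otimes> C(y,z) \<rightarrow> C(x,z)\<close>.\<close>

record ('x, 'o, 'a) ecat =
  EOb :: "'x set"
  EHom :: "'x \<Rightarrow> 'x \<Rightarrow> 'o"
  ECmp :: "'x \<Rightarrow> 'x \<Rightarrow> 'x \<Rightarrow> 'a"
  EId :: "'x \<Rightarrow> 'a"

definition enriched_category :: "('o, 'a) moncat \<Rightarrow> ('x, 'o, 'a) ecat \<Rightarrow> bool" where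
  "enriched_category V C \<longleftrightarrow>
    (\<forall>x\<in>EOb C. \<forall>y\<in>EOb C. EHom C x y \<in> Ob V) \<and>
    (\<forall>x\<in>EOb C. \<forall>y\<in>EOb C. \<forall>z\<in>EOb C.
      ECmp C x y z \<in> Hom V (TO V (EHom C x y) (EHom C y z)) (EHom C x z)) \<and>
    (\<forall>x\<in>EOb C. EId C x \<in> Hom V (Unit V) (EHom C x x)) \<and>
    (\<forall>x\<in>EOb C. \<forall>y\<in>EOb C. \<forall>z\<in>EOb C. \<forall>w\<in>EOb C.
      Comp V (TO V (TO V (EHom C x y) (EHom C y z)) (EHom C z w))
          (TO V (EHom C x z) (EHom C z w)) (EHom C x w)
        (ECmp C x z w)
        (TA V (TO V (EHom C x y) (EHom C y z)) (EHom C x z) (EHom C z w) (EHom C z w)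
          (ECmp C x y z) (Idn V (EHom C z w))) =
      Comp V (TO V (TO V (EHom C x y) (EHom C y z)) (EHom C z w))
          (TO V (EHom C x y) (TO V (EHom C y z) (EHom C z w))) (EHom C x w)
        (Comp V (TO V (EHom C x y) (TO V (EHom C y z) (EHom C z w)))
            (TO V (EHom C x y) (EHom C y w)) (EHom C x w)
          (ECmp C x y w)
          (TA V (EHom C x y) (EHom C x y) (TO V (EHom C y z) (EHom C z w)) (EHom C y w)
            (Idn V (EHom C x y)) (ECmp C y z w)))
        (Assoc V (EHom C x y) (EHom C y z) (EHom C z w))) \<and>
    (\<forall>x\<in>EOb C. \<forall>y\<in>EOb C.
      Comp V (TO V (Unit V) (EHom C x y)) (TO V (EHom C x x) (EHom C x y)) (EHom C x y)
        (ECmp C x x y)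
        (TA V (Unit V) (EHom C x x) (EHom C x y) (EHom C x y) (EId C x) (Idn V (EHom C x y))) =
      LUnit V (EHom C x y) \<and>
      Comp V (TO V (EHom C x y) (Unit V)) (TO V (EHom C x y) (EHom C y y)) (EHom C x y)
        (ECmp C x y y)
        (TA V (EHom C x y) (EHom C x y) (Unit V) (EHom C y y) (Idn V (EHom C x y)) (EId C y)) =
      RUnit V (EHom C x y))"

record ('x, 'y, 'a) efun =
  EFo :: "'x \<Rightarrow> 'y"
  EFa :: "'x \<Rightarrow> 'x \<Rightarrow> 'a"

text \<open>Enriched functors are extensional, so that equal functors are equal as HOL values.\<close>

definition enriched_functor ::
  "('o, 'a) moncat \<Rightarrow> ('x, 'o, 'a) ecat \<Rightarrow> ('y, 'o, 'a) ecat \<Rightarrow> ('x, 'y, 'a) efun \<Rightarrow> bool" where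
  "enriched_functor V C D F \<longleftrightarrow>
    EFo F \<in> EOb C \<rightarrow>\<^sub>E EOb D \<and>
    EFa F \<in> (\<Pi>\<^sub>E x\<in>EOb C. \<Pi>\<^sub>E y\<in>EOb C. Hom V (EHom C x y) (EHom D (EFo F x) (EFo F y))) \<and>
    (\<forall>x\<in>EOb C. Comp V (Unit V) (EHom C x x) (EHom D (EFo F x) (EFo F x)) (EFa F x x) (EId C x) =
      EId D (EFo F x)) \<and>
    (\<forall>x\<in>EOb C. \<forall>y\<in>EOb C. \<forall>z\<in>EOb C.
      Comp V (TO V (EHom C x y) (EHom C y z)) (EHom C x z) (EHom D (EFo F x) (EFo F z))
        (EFa F x z) (ECmp C x y z) =
      Comp V (TO V (EHom C x y) (EHom C y z))
          (TO V (EHom D (EFo F x) (EFo F y)) (EHom D (EFo F y) (EFo F z)))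
          (EHom D (EFo F x) (EFo F z))
        (ECmp D (EFo F x) (EFo F y) (EFo F z))
        (TA V (EHom C x y) (EHom D (EFo F x) (EFo F y)) (EHom C y z) (EHom D (EFo F y) (EFo F z))
          (EFa F x y) (EFa F y z)))"

definition efun_comp ::
  "('o, 'a) moncat \<Rightarrow> ('x, 'o, 'a) ecat \<Rightarrow> ('y, 'o, 'a) ecat \<Rightarrow> ('z, 'o, 'a) ecat \<Rightarrow>
    ('y, 'z, 'a) efun \<Rightarrow> ('x, 'y, 'a) efun \<Rightarrow> ('x, 'z, 'a) efun" where
  "efun_comp V C D E G F =
    \<lparr>EFo = (\<lambda>x\<in>EOb C. EFo G (EFo F x)),
     EFa = (\<lambda>x\<in>EOb C. \<lambda>y\<in>EOb C.
       Comp V (EHom C x y) (EHom D (EFo F x) (EFo F y))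
           (EHom E (EFo G (EFo F x)) (EFo G (EFo F y)))
         (EFa G (EFo F x) (EFo F y)) (EFa F x y))\<rparr>"

definition efun_id :: "('o, 'a) moncat \<Rightarrow> ('x, 'o, 'a) ecat \<Rightarrow> ('x, 'x, 'a) efun" where
  "efun_id V C =
    \<lparr>EFo = (\<lambda>x\<in>EOb C. x), EFa = (\<lambda>x\<in>EOb C. \<lambda>y\<in>EOb C. Idn V (EHom C x y))\<rparr>"

definition ECat :: "('o, 'a) moncat \<Rightarrow> (('x, 'o, 'a) ecat, ('x, 'x, 'a) efun) cat" where
  "ECat V =
    \<lparr>Ob = {C. enriched_category V C},
     Hom = (\<lambda>C D. {F. enriched_functor V C D F}),
     Comp = efun_comp V,
     Idn = efun_id V\<rparr>"

definition change_of_base ::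
  "('o, 'a) moncat \<Rightarrow> ('p, 'b) moncat \<Rightarrow> ('o, 'a, 'p, 'b) mfunctr \<Rightarrow>
    (('x, 'o, 'a) ecat, ('x, 'x, 'a) efun, ('x, 'p, 'b) ecat, ('x, 'x, 'b) efun) functr" where
  "change_of_base V V' R =
    \<lparr>Fo = (\<lambda>C.
       \<lparr>EOb = EOb C,
        EHom = (\<lambda>x y. Fo R (EHom C x y)),
        ECmp = (\<lambda>x y z.
          Comp V' (TO V' (Fo R (EHom C x y)) (Fo R (EHom C y z)))
              (Fo R (TO V (EHom C x y) (EHom C y z))) (Fo R (EHom C x z))
            (Fa R (TO V (EHom C x y) (EHom C y z)) (EHom C x z) (ECmp C x y z))
            (Mu R (EHom C x y) (EHom C y z))),
        EId = (\<lambda>x. Comp V' (Unit V') (Fo R (Unit V)) (Fo R (EHom C x x))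
            (Fa R (Unit V) (EHom C x x) (EId C x)) (Eps R))\<rparr>),
     Fa = (\<lambda>C D F.
       \<lparr>EFo = EFo F,
        EFa = (\<lambda>x\<in>EOb C. \<lambda>y\<in>EOb C.
          Fa R (EHom C x y) (EHom D (EFo F x) (EFo F y)) (EFa F x y))\<rparr>)\<rparr>"


section \<open>Presheaves, simplicial sets, nerves\<close>

text \<open>\<open>act X b b' u : X(b') \<rightarrow> X(b)\<close> for \<open>u : b \<rightarrow> b'\<close>.\<close>

record ('b, 'm, 'e) psh =
  cells :: "'b \<Rightarrow> 'e set"
  act :: "'b \<Rightarrow> 'b \<Rightarrow> 'm \<Rightarrow> 'e \<Rightarrow> 'e"

definition presheaf :: "('b, 'm, 'z) cat_scheme \<Rightarrow> ('b, 'm, 'e) psh \<Rightarrow> bool" where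
  "presheaf B X \<longleftrightarrow>
    (\<forall>b\<in>Ob B. \<forall>b'\<in>Ob B. \<forall>u\<in>Hom B b b'. act X b b' u \<in> cells X b' \<rightarrow> cells X b) \<and>
    (\<forall>b\<in>Ob B. \<forall>x\<in>cells X b. act X b b (Idn B b) x = x) \<and>
    (\<forall>b\<in>Ob B. \<forall>b'\<in>Ob B. \<forall>b''\<in>Ob B. \<forall>u\<in>Hom B b b'. \<forall>v\<in>Hom B b' b''. \<forall>x\<in>cells X b''.
      act X b b'' (Comp B b b' b'' v u) x = act X b b' u (act X b' b'' v x))"

definition psh_hom ::
  "('b, 'm, 'z) cat_scheme \<Rightarrow> ('b, 'm, 'e) psh \<Rightarrow> ('b, 'm, 'e) psh \<Rightarrow> ('b \<Rightarrow> 'e \<Rightarrow> 'e) set" where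
  "psh_hom B X Y = {t \<in> (\<Pi>\<^sub>E b\<in>Ob B. cells X b \<rightarrow>\<^sub>E cells Y b).
    \<forall>b\<in>Ob B. \<forall>b'\<in>Ob B. \<forall>u\<in>Hom B b b'. \<forall>x\<in>cells X b'.
      t b (act X b b' u x) = act Y b b' u (t b' x)}"

definition Psh :: "('b, 'm, 'z) cat_scheme \<Rightarrow> (('b, 'm, 'e) psh, 'b \<Rightarrow> 'e \<Rightarrow> 'e) cat" where
  "Psh B =
    \<lparr>Ob = {X. presheaf B X},
     Hom = psh_hom B,
     Comp = (\<lambda>X Y Z t s. \<lambda>b\<in>Ob B. compose (cells X b) (t b) (s b)),
     Idn = (\<lambda>X. \<lambda>b\<in>Ob B. \<lambda>x\<in>cells X b. x)\<rparr>"

text \<open>Natural isomorphism of two presheaf-valued functors. The element types may differ, in which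
  case the two functors do not literally have the same codomain in HOL.\<close>

definition psh_functor_iso ::
  "('c, 'f, 'y) cat_scheme \<Rightarrow> ('b, 'm, 'z) cat_scheme \<Rightarrow>
    ('c, 'f, ('b, 'm, 'd) psh, 'b \<Rightarrow> 'd \<Rightarrow> 'd) functr \<Rightarrow>
    ('c, 'f, ('b, 'm, 'e) psh, 'b \<Rightarrow> 'e \<Rightarrow> 'e) functr \<Rightarrow> bool" where
  "psh_functor_iso C B N N' \<longleftrightarrow> is_functor C (Psh B) N \<and> is_functor C (Psh B) N' \<and>
    (\<exists>\<theta>.
      (\<forall>c\<in>Ob C. \<forall>b\<in>Ob B. bij_betw (\<theta> c b) (cells (Fo N c) b) (cells (Fo N' c) b)) \<and>
      (\<forall>c\<in>Ob C. \<forall>b\<in>Ob B. \<forall>b'\<in>Ob B. \<forall>u\<in>Hom B b b'. \<forall>x\<in>cells (Fo N c) b'.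
        \<theta> c b (act (Fo N c) b b' u x) = act (Fo N' c) b b' u (\<theta> c b' x)) \<and>
      (\<forall>c\<in>Ob C. \<forall>c'\<in>Ob C. \<forall>f\<in>Hom C c c'. \<forall>b\<in>Ob B. \<forall>x\<in>cells (Fo N c) b.
        \<theta> c' b (Fa N c c' f b x) = Fa N' c c' f b (\<theta> c b x)))"

text \<open>The object \<open>n\<close> of \<open>Delta\<close> is the ordinal \<open>{0, \<dots>, n}\<close>.\<close>

definition Delta :: "(nat, nat \<Rightarrow> nat) cat" where
  "Delta =
    \<lparr>Ob = UNIV,
     Hom = (\<lambda>m n. {f \<in> {..m} \<rightarrow>\<^sub>E {..n}. mono_on {..m} f}),
     Comp = (\<lambda>m n k g f. compose {..m} g f),
     Idn = (\<lambda>n. \<lambda>i\<in>{..n}. i)\<rparr>"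

text \<open>The nerve of a cosimplicial enriched category: \<open>N(C)\<^sub>n\<close> is the set of enriched functors
  from the \<open>n\<close>-th one to \<open>C\<close>.\<close>

definition nerve ::
  "('o, 'a) moncat \<Rightarrow>
    (nat, nat \<Rightarrow> nat, ('x, 'o, 'a) ecat, ('x, 'x, 'a) efun) functr \<Rightarrow>
    (('y, 'o, 'a) ecat, ('y, 'y, 'a) efun,
     (nat, nat \<Rightarrow> nat, ('x, 'y, 'a) efun) psh,
     nat \<Rightarrow> ('x, 'y, 'a) efun \<Rightarrow> ('x, 'y, 'a) efun) functr" where
  "nerve V \<DD> =
    \<lparr>Fo = (\<lambda>C.
       \<lparr>cells = (\<lambda>n. {G. enriched_functor V (Fo \<DD> n) C G}),
        act = (\<lambda>m n f G. efun_comp V (Fo \<DD> m) (Fo \<DD> n) C G (Fa \<DD> m n f))\<rparr>),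
     Fa = (\<lambda>C D F n. \<lambda>G\<in>{G. enriched_functor V (Fo \<DD> n) C G}.
       efun_comp V (Fo \<DD> n) C D F G)\<rparr>"


section \<open>The cube category\<close>

text \<open>The poset \<open>[1]\<^sup>n\<close> is represented by the Boolean lists of length \<open>n\<close>, a map out of it by an
  extensional function. Positions are counted from 1, whereas list indices start at 0.\<close>

definition cube :: "nat \<Rightarrow> bool list set" where
  "cube n = {xs. length xs = n}"

definition box_face :: "bool \<Rightarrow> nat \<Rightarrow> nat \<Rightarrow> bool list \<Rightarrow> bool list" where
  "box_face \<epsilon> i n = (\<lambda>xs\<in>cube n. take (i - 1) xs @ \<epsilon> # drop (i - 1) xs)"

definition box_degen :: "nat \<Rightarrow> nat \<Rightarrow> bool list \<Rightarrow> bool list" where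
  "box_degen i n = (\<lambda>xs\<in>cube (Suc n). take (i - 1) xs @ drop i xs)"

definition box_conn :: "nat \<Rightarrow> nat \<Rightarrow> bool list \<Rightarrow> bool list" where
  "box_conn i n =
    (\<lambda>xs\<in>cube (Suc n). take (i - 1) xs @ max (xs ! (i - 1)) (xs ! i) # drop (i + 1) xs)"

inductive box_map :: "nat \<Rightarrow> nat \<Rightarrow> (bool list \<Rightarrow> bool list) \<Rightarrow> bool" where
  ident: "box_map n n (\<lambda>xs\<in>cube n. xs)"
| face: "1 \<le> i \<Longrightarrow> i \<le> Suc n \<Longrightarrow> box_map n (Suc n) (box_face \<epsilon> i n)"
| degen: "1 \<le> i \<Longrightarrow> i \<le> Suc n \<Longrightarrow> box_map (Suc n) n (box_degen i n)"
| conn: "1 \<le> i \<Longrightarrow> i \<le> n \<Longrightarrow> box_map (Suc n) n (box_conn i n)"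
| comp: "box_map m n f \<Longrightarrow> box_map n k g \<Longrightarrow> box_map m k (compose (cube m) g f)"

definition box :: "(nat, bool list \<Rightarrow> bool list) moncat" where
  "box =
    \<lparr>Ob = UNIV,
     Hom = (\<lambda>m n. {f. box_map m n f}),
     Comp = (\<lambda>m n k g f. compose (cube m) g f),
     Idn = (\<lambda>n. \<lambda>xs\<in>cube n. xs),
     TO = (+),
     TA = (\<lambda>m m' n n' f g. \<lambda>xs\<in>cube (m + n). f (take m xs) @ g (drop m xs)),
     Unit = 0,
     Assoc = (\<lambda>m n k. \<lambda>xs\<in>cube (m + n + k). xs),
     LUnit = (\<lambda>n. \<lambda>xs\<in>cube n. xs),
     RUnit = (\<lambda>n. \<lambda>xs\<in>cube n. xs)\<rparr>"


section \<open>Cubical sets with Day convolution\<close>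

text \<open>A universe for cubical sets that contains a given type \<open>'a\<close> (later: the arrows of \<open>W\<close>) and
  the elements of representables, and is closed under Day convolution. The term
  \<open>Tens m n \<phi> x y\<close> with \<open>\<phi> : [1]\<^sup>k \<rightarrow> [1]\<^sup>m \<otimes> [1]\<^sup>n\<close>, \<open>x \<in> X\<^sub>m\<close>, \<open>y \<in> Y\<^sub>n\<close> denotes an element of
  \<open>(X \<otimes> Y)\<^sub>k\<close>, the coend over \<open>m\<close> and \<open>n\<close> of \<open>box(k, m + n) \<times> X\<^sub>m \<times> Y\<^sub>n\<close>.\<close>

datatype 'a elt =
  Atom 'a
| Box "bool list \<Rightarrow> bool list"
| Tens nat nat "bool list \<Rightarrow> bool list" "'a elt" "'a elt"

type_synonym 'a cset = "(nat, bool list \<Rightarrow> bool list, 'a elt) psh"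
type_synonym 'a cmap = "nat \<Rightarrow> 'a elt \<Rightarrow> 'a elt"

definition day_terms :: "'a cset \<Rightarrow> 'a cset \<Rightarrow> nat \<Rightarrow> 'a elt set" where
  "day_terms X Y k =
    {Tens m n \<phi> x y | m n \<phi> x y. \<phi> \<in> Hom box k (m + n) \<and> x \<in> cells X m \<and> y \<in> cells Y n}"

definition day_step :: "'a cset \<Rightarrow> 'a cset \<Rightarrow> nat \<Rightarrow> ('a elt \<times> 'a elt) set" where
  "day_step X Y k =
    {(Tens m n \<phi> (act X m m' u x) (act Y n n' v y),
      Tens m' n' (Comp box k (m + n) (m' + n') (TA box m m' n n' u v) \<phi>) x y)
     | m m' n n' \<phi> u v x y.
       \<phi> \<in> Hom box k (m + n) \<and> u \<in> Hom box m m' \<and> v \<in> Hom box n n' \<and>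
       x \<in> cells X m' \<and> y \<in> cells Y n'}"

definition day_eq :: "'a cset \<Rightarrow> 'a cset \<Rightarrow> nat \<Rightarrow> ('a elt \<times> 'a elt) set" where
  "day_eq X Y k = (day_step X Y k \<union> (day_step X Y k)\<inverse>)\<^sup>*"

text \<open>A class of the generated equivalence is represented by a chosen element, which depends on
  the class only.\<close>

definition day_class :: "'a cset \<Rightarrow> 'a cset \<Rightarrow> nat \<Rightarrow> 'a elt \<Rightarrow> 'a elt" where
  "day_class X Y k t = (SOME s. (t, s) \<in> day_eq X Y k)"

definition day :: "'a cset \<Rightarrow> 'a cset \<Rightarrow> 'a cset" where
  "day X Y =
    \<lparr>cells = (\<lambda>k. day_class X Y k ` day_terms X Y k),
     act = (\<lambda>j k \<psi> t. case t of
       Tens m n \<phi> x y \<Rightarrow> day_class X Y j (Tens m n (Comp box j k (m + n) \<phi> \<psi>) x y))\<rparr>"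

definition day_map ::
  "'a cset \<Rightarrow> 'a cset \<Rightarrow> 'a cset \<Rightarrow> 'a cset \<Rightarrow> 'a cmap \<Rightarrow> 'a cmap \<Rightarrow> 'a cmap" where
  "day_map X X' Y Y' s t = (\<lambda>k. \<lambda>e\<in>cells (day X Y) k. case e of
    Tens m n \<phi> x y \<Rightarrow> day_class X' Y' k (Tens m n \<phi> (s m x) (t n y)))"

definition day_assoc :: "'a cset \<Rightarrow> 'a cset \<Rightarrow> 'a cset \<Rightarrow> 'a cmap" where
  "day_assoc X Y Z = (\<lambda>k. \<lambda>e\<in>cells (day (day X Y) Z) k. case e of
    Tens r n \<phi> (Tens p q \<psi> x y) z \<Rightarrow>
      day_class X (day Y Z) k
        (Tens p (q + n) (Comp box k (r + n) (p + q + n) (TA box r (p + q) n n \<psi> (Idn box n)) \<phi>)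
          x (day_class Y Z (q + n) (Tens q n (Idn box (q + n)) y z))))"

definition yo :: "nat \<Rightarrow> 'a cset" where
  "yo n =
    \<lparr>cells = (\<lambda>k. Box ` Hom box k n),
     act = (\<lambda>j k \<psi> t. case t of Box \<phi> \<Rightarrow> Box (Comp box j k n \<phi> \<psi>))\<rparr>"

definition yo_map :: "nat \<Rightarrow> nat \<Rightarrow> (bool list \<Rightarrow> bool list) \<Rightarrow> 'a cmap" where
  "yo_map m n u = (\<lambda>k. \<lambda>t\<in>cells (yo m) k. case t of Box \<phi> \<Rightarrow> Box (Comp box k m n u \<phi>))"

text \<open>The isomorphism of \<open>yo m \<otimes> yo n\<close> with \<open>yo (m + n)\<close>.\<close>

definition day_yo :: "nat \<Rightarrow> nat \<Rightarrow> 'a cmap" where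
  "day_yo m n = (\<lambda>k. \<lambda>e\<in>cells (day (yo m) (yo n)) k. case e of
    Tens p q \<phi> (Box x) (Box y) \<Rightarrow> Box (Comp box k (p + q) (m + n) (TA box p m q n x y) \<phi>))"

definition day_lunit :: "'a cset \<Rightarrow> 'a cmap" where
  "day_lunit X = (\<lambda>k. \<lambda>e\<in>cells (day (yo 0) X) k. case e of
    Tens m n \<phi> (Box u) x \<Rightarrow>
      act X k n (Comp box k (m + n) n (TA box m 0 n n u (Idn box n)) \<phi>) x)"

definition day_runit :: "'a cset \<Rightarrow> 'a cmap" where
  "day_runit X = (\<lambda>k. \<lambda>e\<in>cells (day X (yo 0)) k. case e of
    Tens m n \<phi> x (Box u) \<Rightarrow>
      act X k m (Comp box k (m + n) m (TA box m m n 0 (Idn box m) u) \<phi>) x)"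

definition CSet :: "('a cset, 'a cmap) moncat" where
  "CSet =
    \<lparr>Ob = Ob (Psh box), Hom = Hom (Psh box), Comp = Comp (Psh box), Idn = Idn (Psh box),
     TO = day, TA = day_map, Unit = yo 0,
     Assoc = day_assoc, LUnit = day_lunit, RUnit = day_runit\<rparr>"


section \<open>The cubical nerve\<close>

definition empty_cset :: "'a cset" where
  "empty_cset = \<lparr>cells = (\<lambda>k. {}), act = (\<lambda>j k \<psi> t. t)\<rparr>"

definition empty_map :: "'a cmap" where
  "empty_map = (\<lambda>k. \<lambda>t\<in>{}. t)"

definition Wc_hom :: "nat \<Rightarrow> nat \<Rightarrow> 'a cset" where
  "Wc_hom i j = (if i < j then yo (j - i - 1) else if i = j then yo 0 else empty_cset)"

text \<open>Composition with an identity (\<open>i = j\<close> or \<open>j = k\<close>) is forced to be a unitor; when \<open>i > j\<close> or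
  \<open>j > k\<close> the source is empty.\<close>

definition Wc_ob :: "nat \<Rightarrow> (nat, 'a cset, 'a cmap) ecat" where
  "Wc_ob n =
    \<lparr>EOb = {..n},
     EHom = Wc_hom,
     ECmp = (\<lambda>i j k.
       if i < j \<and> j < k then
         Comp CSet (day (yo (j - i - 1)) (yo (k - j - 1))) (yo (k - i - 2)) (yo (k - i - 1))
           (yo_map (k - i - 2) (k - i - 1) (box_face True (j - i) (k - i - 2)))
           (day_yo (j - i - 1) (k - j - 1))
       else if i = j \<and> j \<le> k then LUnit CSet (Wc_hom j k)
       else if i < j \<and> j = k then RUnit CSet (Wc_hom i j)
       else empty_map),
     EId = (\<lambda>i. Idn CSet (yo 0))\<rparr>"

definition Delta_face :: "nat \<Rightarrow> nat \<Rightarrow> nat \<Rightarrow> nat" where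
  "Delta_face k n = (\<lambda>i\<in>{..n}. if i < k then i else Suc i)"

definition Delta_degen :: "nat \<Rightarrow> nat \<Rightarrow> nat \<Rightarrow> nat" where
  "Delta_degen k n = (\<lambda>i\<in>{..Suc n}. if i \<le> k then i else i - 1)"

definition Wc_face :: "nat \<Rightarrow> nat \<Rightarrow> (nat, nat, 'a cmap) efun" where
  "Wc_face k n =
    \<lparr>EFo = Delta_face k n,
     EFa = (\<lambda>i\<in>{..n}. \<lambda>j\<in>{..n}.
       if i < k \<and> k \<le> j then yo_map (j - i - 1) (j - i) (box_face False (k - i) (j - i - 1))
       else Idn CSet (Wc_hom i j))\<rparr>"

definition Wc_degen :: "nat \<Rightarrow> nat \<Rightarrow> (nat, nat, 'a cmap) efun" where
  "Wc_degen k n =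
    \<lparr>EFo = Delta_degen k n,
     EFa = (\<lambda>i\<in>{..Suc n}. \<lambda>j\<in>{..Suc n}.
       if k = i \<and> i + 1 < j then yo_map (j - i - 1) (j - i - 2) (box_degen 1 (j - i - 2))
       else if i < k \<and> k + 1 < j then
         yo_map (j - i - 1) (j - i - 2) (box_conn (k - i) (j - i - 2))
       else if i < k \<and> k + 1 = j then
         yo_map (j - i - 1) (j - i - 2) (box_degen (j - i - 1) (j - i - 2))
       else Idn CSet (Wc_hom i j))\<rparr>"

text \<open>\<open>W\<^sub>c\<close> is prescribed on the cofaces and codegeneracies, which generate \<open>Delta\<close>;
  \<open>Wc_rel m n f F\<close> states that the value \<open>F\<close> at \<open>f\<close> results from writing \<open>f\<close> as a composite of
  these.\<close>

inductive Wc_rel :: "nat \<Rightarrow> nat \<Rightarrow> (nat \<Rightarrow> nat) \<Rightarrow> (nat, nat, 'a cmap) efun \<Rightarrow> bool" where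
  ident: "Wc_rel n n (Idn Delta n) (efun_id CSet (Wc_ob n))"
| face: "k \<le> Suc n \<Longrightarrow> Wc_rel n (Suc n) (Delta_face k n) (Wc_face k n)"
| degen: "k \<le> n \<Longrightarrow> Wc_rel (Suc n) n (Delta_degen k n) (Wc_degen k n)"
| comp: "Wc_rel m n f F \<Longrightarrow> Wc_rel n p g G \<Longrightarrow>
    Wc_rel m p (Comp Delta m n p g f) (efun_comp CSet (Wc_ob m) (Wc_ob n) (Wc_ob p) G F)"

definition Wc ::
  "(nat, nat \<Rightarrow> nat, (nat, 'a cset, 'a cmap) ecat, (nat, nat, 'a cmap) efun) functr" where
  "Wc = \<lparr>Fo = Wc_ob, Fa = (\<lambda>m n f. THE F. Wc_rel m n f F)\<rparr>"

text \<open>The right adjoint \<open>R\<^sup>H(A)\<^sub>n = W(H[1]\<^sup>n, A)\<close>. The lax structure is the one conjugate to the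
  strong monoidal structure of the left Kan extension of \<open>H\<close>: a pair \<open>a : H[1]\<^sup>m \<rightarrow> A\<close>,
  \<open>b : H[1]\<^sup>n \<rightarrow> B\<close> goes to the composite of \<open>H[1]\<^sup>m\<^sup>+\<^sup>n \<simeq> H[1]\<^sup>m \<otimes> H[1]\<^sup>n\<close> with \<open>a \<otimes> b\<close>.\<close>

definition RH ::
  "('o, 'a) moncat \<Rightarrow> (nat, bool list \<Rightarrow> bool list, 'o, 'a) mfunctr \<Rightarrow>
    ('o, 'a, 'a cset, 'a cmap) mfunctr" where
  "RH W H =
    (let R = (\<lambda>A.
       \<lparr>cells = (\<lambda>n. Atom ` Hom W (Fo H n) A),
        act = (\<lambda>m n u t. case t of
          Atom a \<Rightarrow> Atom (Comp W (Fo H m) (Fo H n) A a (Fa H m n u)))\<rparr>)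
     in
    \<lparr>Fo = R,
     Fa = (\<lambda>A B f n. \<lambda>t\<in>cells (R A) n. case t of Atom a \<Rightarrow> Atom (Comp W (Fo H n) A B f a)),
     Mu = (\<lambda>A B k. \<lambda>t\<in>cells (day (R A) (R B)) k. case t of
       Tens m n \<phi> (Atom a) (Atom b) \<Rightarrow>
         Atom (Comp W (Fo H k) (TO W (Fo H m) (Fo H n)) (TO W A B)
           (TA W (Fo H m) A (Fo H n) B a b)
           (Comp W (Fo H k) (Fo H (m + n)) (TO W (Fo H m) (Fo H n))
             (inv_arrow W (TO W (Fo H m) (Fo H n)) (Fo H (m + n)) (Mu H m n))
             (Fa H k (m + n) \<phi>)))),
     Eps = (\<lambda>k. \<lambda>t\<in>cells (yo 0) k. case t of
       Box u \<Rightarrow> Atom (Comp W (Fo H k) (Fo H 0) (Unit W)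
         (inv_arrow W (Unit W) (Fo H 0) (Eps H)) (Fa H k 0 u)))\<rparr>)"

definition N_cub ::
  "(('x, 'a cset, 'a cmap) ecat, ('x, 'x, 'a cmap) efun,
    (nat, nat \<Rightarrow> nat, (nat, 'x, 'a cmap) efun) psh,
    nat \<Rightarrow> (nat, 'x, 'a cmap) efun \<Rightarrow> (nat, 'x, 'a cmap) efun) functr" where
  "N_cub = nerve CSet Wc"

definition N_H ::
  "('o, 'a) moncat \<Rightarrow> (nat, bool list \<Rightarrow> bool list, 'o, 'a) mfunctr \<Rightarrow>
    (('x, 'o, 'a) ecat, ('x, 'x, 'a) efun,
     (nat, nat \<Rightarrow> nat, (nat, 'x, 'a cmap) efun) psh,
     nat \<Rightarrow> (nat, 'x, 'a cmap) efun \<Rightarrow> (nat, 'x, 'a cmap) efun) functr" where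
  "N_H W H = functor_comp N_cub (change_of_base W CSet (RH W H))"


section \<open>Necklaces\<close>

type_synonym necklace = "nat set \<times> nat"

definition nec_hom :: "necklace \<Rightarrow> necklace \<Rightarrow> (nat \<Rightarrow> nat) set" where
  "nec_hom S S' = (case (S, S') of ((T, p), (U, q)) \<Rightarrow>
    {f \<in> {..p} \<rightarrow>\<^sub>E {..q}. mono_on {..p} f \<and> f 0 = 0 \<and> f p = q \<and> U \<subseteq> f ` T})"

definition wedge :: "necklace \<Rightarrow> necklace \<Rightarrow> necklace" where
  "wedge S S' = (case (S, S') of ((T, p), (U, q)) \<Rightarrow> (T \<union> (+) p ` U, p + q))"

definition nec_id :: "necklace \<Rightarrow> nat \<Rightarrow> nat" where
  "nec_id S = (\<lambda>i\<in>{..snd S}. i)"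

definition Nec :: "(necklace, nat \<Rightarrow> nat) moncat" where
  "Nec =
    \<lparr>Ob = {(T, p). {0, p} \<subseteq> T \<and> T \<subseteq> {..p}},
     Hom = nec_hom,
     Comp = (\<lambda>S S' S'' g f. compose {..snd S} g f),
     Idn = nec_id,
     TO = wedge,
     TA = (\<lambda>S S' Z Z' f g. \<lambda>i\<in>{..snd S + snd Z}.
       if i \<le> snd S then f i else snd S' + g (i - snd S)),
     Unit = ({0}, 0),
     Assoc = (\<lambda>S S' S''. nec_id (wedge (wedge S S') S'')),
     LUnit = nec_id,
     RUnit = nec_id\<rparr>"

definition simplex :: "nat \<Rightarrow> necklace" where
  "simplex n = ({0, n}, n)"

definition missing :: "necklace \<Rightarrow> nat set" where
  "missing S = {..snd S} - fst S"

definition nec_decode :: "necklace \<Rightarrow> bool list \<Rightarrow> nat set" where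
  "nec_decode S xs =
    fst S \<union> {sorted_list_of_set (missing S) ! j | j. j < card (missing S) \<and> xs ! j}"

definition nec_encode :: "necklace \<Rightarrow> nat set \<Rightarrow> bool list" where
  "nec_encode S V = map (\<lambda>v. v \<in> V) (sorted_list_of_set (missing S))"

definition nec_dim :: "(necklace, nat \<Rightarrow> nat, nat, bool list \<Rightarrow> bool list) mfunctr" where
  "nec_dim =
    \<lparr>Fo = (\<lambda>S. card (missing S)),
     Fa = (\<lambda>S S' f. \<lambda>xs\<in>cube (card (missing S)). nec_encode S' (f ` nec_decode S xs)),
     Mu = (\<lambda>S S'. Idn box (card (missing S) + card (missing S'))),
     Eps = Idn box 0\<rparr>"


section \<open>Necklicial nerves\<close>

definition Phi ::
  "('o, 'a) moncat \<Rightarrow> (necklace, nat \<Rightarrow> nat, 'o, 'a) mfunctr \<Rightarrow>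
    (nat, nat \<Rightarrow> nat, (nat, 'o, 'a) ecat, (nat, nat, 'a) efun) functr" where
  "Phi W D =
    (let h = (\<lambda>i j. if i \<le> j then Fo D (simplex (j - i)) else initial_ob W) in
    \<lparr>Fo = (\<lambda>n.
       \<lparr>EOb = {..n},
        EHom = h,
        ECmp = (\<lambda>i j k.
          if i \<le> j \<and> j \<le> k then
            Comp W (TO W (h i j) (h j k)) (Fo D (wedge (simplex (j - i)) (simplex (k - j)))) (h i k)
              (Fa D (wedge (simplex (j - i)) (simplex (k - j))) (simplex (k - i))
                (\<lambda>l\<in>{..k - i}. l))
              (Mu D (simplex (j - i)) (simplex (k - j)))
          else the_arrow W (TO W (h i j) (h j k)) (h i k)),
        EId = (\<lambda>i. Eps D)\<rparr>),
     Fa = (\<lambda>m n f.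
       \<lparr>EFo = f,
        EFa = (\<lambda>i\<in>{..m}. \<lambda>j\<in>{..m}.
          if i \<le> j then
            Fa D (simplex (j - i)) (simplex (f j - f i)) (\<lambda>k\<in>{..j - i}. f (k + i) - f i)
          else the_arrow W (h i j) (h (f i) (f j)))\<rparr>)\<rparr>)"

definition necklicial_with ::
  "('o, 'a) moncat \<Rightarrow>
    (('x, 'o, 'a) ecat, ('x, 'x, 'a) efun, (nat, nat \<Rightarrow> nat, 'e) psh, nat \<Rightarrow> 'e \<Rightarrow> 'e) functr \<Rightarrow>
    (necklace, nat \<Rightarrow> nat, 'o, 'a) mfunctr \<Rightarrow> bool" where
  "necklicial_with W N D \<longleftrightarrow>
    strong_monoidal_functor Nec W D \<and> psh_functor_iso (ECat W) Delta N (nerve W (Phi W D))"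

end

(*
The functor dim sends the m-simplex to the cube of dimension m - 1, so that W_c(i,j) is the
cubical set represented by dim(Delta^(j-i)), and the faces, degeneracies and connections in the
definition of W_c are what dim assigns to the necklace maps underlying cofaces, codegeneracies
and the splitting of a simplex into two. That dim takes values in the cube category is due to
monotonicity: V |-> f(V) is a tensor product of disjunctions over consecutive blocks of
coordinates. By the Yoneda lemma a morphism from a representable cubical set to R^H(A) is an
arrow from H([1]^n) to A, and since the Day convolution of two representables is representable,
the composition axiom of an enriched functor W_c^n -> R^H(C) need only be tested on one
universal element, where it becomes the composition axiom of a functor Phi(H o dim)^n -> C.
*)
theory Submission
  imports Defs
begin

section \<open>Categories and enriched functors\<close>

text \<open>The claim includes that \<open>N_H W H\<close> is a functor to simplicial sets. A direct
  proof would have to show that Day convolution makes \<open>CSet\<close> monoidal and that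
  \<open>RH W H\<close> is lax monoidal. Instead, the bijections between the two sets of enriched
  functors are established first, by comparing the equations that cut them out, and all
  functoriality is then transported from the nerve of \<open>Phi W D\<close>, whose laws are checked
  in \<open>W\<close>. A second obstacle is that \<open>Wc\<close> is prescribed on cofaces and
  codegeneracies only, its value elsewhere being a definite description. Functoriality of dim
  resolves this: \<open>Wc_fun\<close> is a closed formula for all monotone maps which agrees with
  the prescribed values and respects composition, so that every factorization into generators yields
  the same result. Cocompleteness and the preservation of colimits are applied to the empty diagram.
  They make the homs of \<open>Phi W D\<close> with \<open>i > j\<close>, and all tensor products
  with such a factor, initial; equations between arrows out of them hold automatically, just as
  equations between maps out of empty cubical sets do on the other side.\<close>

lemma cat_id: "category C \<Longrightarrow> X \<in> Ob C \<Longrightarrow> Idn C X \<in> Hom C X X"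
  by (simp add: category_def)

lemma cat_comp:
  "\<lbrakk>category C; X \<in> Ob C; Y \<in> Ob C; Z \<in> Ob C; f \<in> Hom C X Y; g \<in> Hom C Y Z\<rbrakk>
    \<Longrightarrow> Comp C X Y Z g f \<in> Hom C X Z"
  by (simp add: category_def)

lemma cat_comp_id:
  "\<lbrakk>category C; X \<in> Ob C; Y \<in> Ob C; f \<in> Hom C X Y\<rbrakk> \<Longrightarrow> Comp C X X Y f (Idn C X) = f"
  by (simp add: category_def)

lemma cat_id_comp:
  "\<lbrakk>category C; X \<in> Ob C; Y \<in> Ob C; f \<in> Hom C X Y\<rbrakk> \<Longrightarrow> Comp C X Y Y (Idn C Y) f = f"
  by (simp add: category_def)

lemma cat_assoc:
  "\<lbrakk>category C; X \<in> Ob C; Y \<in> Ob C; Z \<in> Ob C; T \<in> Ob C;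
    f \<in> Hom C X Y; g \<in> Hom C Y Z; h \<in> Hom C Z T\<rbrakk>
    \<Longrightarrow> Comp C X Y T (Comp C Y Z T h g) f = Comp C X Z T h (Comp C X Y Z g f)"
  by (simp add: category_def)

lemmas cat_rules = cat_id cat_comp cat_comp_id cat_id_comp cat_assoc

lemma cat_inv_arrow:
  assumes C: "category C" and X: "X \<in> Ob C" and Y: "Y \<in> Ob C" and iso: "iso_arrow C X Y f"
  shows "inverse_arrows C X Y f (inv_arrow C X Y f)"
proof -
  obtain g where g: "inverse_arrows C X Y f g"
    using iso by (auto simp: iso_arrow_def)
  have "g' = g" if g': "inverse_arrows C X Y f g'" for g'
  proof -
    have "g' = Comp C Y Y X g' (Comp C Y X Y f g)"
      using g g' C X Y by (simp add: inverse_arrows_def cat_comp_id)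
    also have "\<dots> = Comp C Y X X (Comp C X Y X g' f) g"
      using g g' C X Y cat_assoc[of C Y X Y X g f g'] by (simp add: inverse_arrows_def)
    also have "\<dots> = g"
      using g g' C X Y by (simp add: inverse_arrows_def cat_id_comp)
    finally show ?thesis .
  qed
  then show ?thesis
    unfolding inv_arrow_def using g by (metis theI)
qed

lemma monoidal_category_cat: "monoidal_category V \<Longrightarrow> category V"
  by (simp add: monoidal_category_def)

lemma monoidal_Unit: "monoidal_category V \<Longrightarrow> Unit V \<in> Ob V"
  by (simp add: monoidal_category_def)

lemma monoidal_TO: "\<lbrakk>monoidal_category V; X \<in> Ob V; Y \<in> Ob V\<rbrakk> \<Longrightarrow> TO V X Y \<in> Ob V"
  by (simp add: monoidal_category_def)

lemma monoidal_TA: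
  "\<lbrakk>monoidal_category V; X \<in> Ob V; X' \<in> Ob V; Y \<in> Ob V; Y' \<in> Ob V; f \<in> Hom V X X'; g \<in> Hom V Y Y'\<rbrakk>
    \<Longrightarrow> TA V X X' Y Y' f g \<in> Hom V (TO V X Y) (TO V X' Y')"
  by (simp add: monoidal_category_def)

lemma monoidal_TA_id:
  "\<lbrakk>monoidal_category V; X \<in> Ob V; Y \<in> Ob V\<rbrakk>
    \<Longrightarrow> TA V X X Y Y (Idn V X) (Idn V Y) = Idn V (TO V X Y)"
  by (simp add: monoidal_category_def)

lemma monoidal_TA_comp:
  "\<lbrakk>monoidal_category V; X \<in> Ob V; X' \<in> Ob V; X'' \<in> Ob V; Y \<in> Ob V; Y' \<in> Ob V; Y'' \<in> Ob V;
    f \<in> Hom V X X'; f' \<in> Hom V X' X''; g \<in> Hom V Y Y'; g' \<in> Hom V Y' Y''\<rbrakk>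
    \<Longrightarrow> TA V X X'' Y Y'' (Comp V X X' X'' f' f) (Comp V Y Y' Y'' g' g) =
      Comp V (TO V X Y) (TO V X' Y') (TO V X'' Y'') (TA V X' X'' Y' Y'' f' g') (TA V X X' Y Y' f g)"
  by (simp add: monoidal_category_def)

lemmas monoidal_rules = monoidal_category_cat monoidal_Unit monoidal_TO monoidal_TA

text \<open>The composition of enriched functors makes no use of the associativity and unit axioms of an
  enriched category; dispensing with them here spares their proof for the categories \<open>\<Phi>(D)\<^sup>n\<close>.\<close>

definition enriched_typed :: "('o, 'a) moncat \<Rightarrow> ('x, 'o, 'a) ecat \<Rightarrow> bool" where
  "enriched_typed V C \<longleftrightarrow>
    (\<forall>x\<in>EOb C. \<forall>y\<in>EOb C. EHom C x y \<in> Ob V) \<and>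
    (\<forall>x\<in>EOb C. \<forall>y\<in>EOb C. \<forall>z\<in>EOb C.
      ECmp C x y z \<in> Hom V (TO V (EHom C x y) (EHom C y z)) (EHom C x z)) \<and>
    (\<forall>x\<in>EOb C. EId C x \<in> Hom V (Unit V) (EHom C x x))"

lemma enriched_category_typed: "enriched_category V C \<Longrightarrow> enriched_typed V C"
  by (simp add: enriched_category_def enriched_typed_def)

lemma enriched_typedD:
  assumes "enriched_typed V C"
  shows "\<And>x y. x \<in> EOb C \<Longrightarrow> y \<in> EOb C \<Longrightarrow> EHom C x y \<in> Ob V"
    and "\<And>x y z. x \<in> EOb C \<Longrightarrow> y \<in> EOb C \<Longrightarrow> z \<in> EOb C \<Longrightarrow>
      ECmp C x y z \<in> Hom V (TO V (EHom C x y) (EHom C y z)) (EHom C x z)"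
    and "\<And>x. x \<in> EOb C \<Longrightarrow> EId C x \<in> Hom V (Unit V) (EHom C x x)"
  using assms by (auto simp: enriched_typed_def)

lemma enriched_functorD:
  assumes "enriched_functor V C D F"
  shows "\<And>x. x \<in> EOb C \<Longrightarrow> EFo F x \<in> EOb D"
    and "\<And>x y. x \<in> EOb C \<Longrightarrow> y \<in> EOb C \<Longrightarrow>
      EFa F x y \<in> Hom V (EHom C x y) (EHom D (EFo F x) (EFo F y))"
    and "\<And>x. x \<in> EOb C \<Longrightarrow>
      Comp V (Unit V) (EHom C x x) (EHom D (EFo F x) (EFo F x)) (EFa F x x) (EId C x) =
      EId D (EFo F x)"
    and "\<And>x y z. x \<in> EOb C \<Longrightarrow> y \<in> EOb C \<Longrightarrow> z \<in> EOb C \<Longrightarrow>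
      Comp V (TO V (EHom C x y) (EHom C y z)) (EHom C x z) (EHom D (EFo F x) (EFo F z))
        (EFa F x z) (ECmp C x y z) =
      Comp V (TO V (EHom C x y) (EHom C y z))
          (TO V (EHom D (EFo F x) (EFo F y)) (EHom D (EFo F y) (EFo F z)))
          (EHom D (EFo F x) (EFo F z))
        (ECmp D (EFo F x) (EFo F y) (EFo F z))
        (TA V (EHom C x y) (EHom D (EFo F x) (EFo F y)) (EHom C y z) (EHom D (EFo F y) (EFo F z))
          (EFa F x y) (EFa F y z))"
    and "EFo F \<in> extensional (EOb C)"
    and "EFa F \<in> extensional (EOb C)"
    and "\<And>x. x \<in> EOb C \<Longrightarrow> EFa F x \<in> extensional (EOb C)"
  using assms by (auto simp: enriched_functor_def PiE_iff Pi_iff)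

lemma enriched_functorI:
  assumes "\<And>x. x \<in> EOb C \<Longrightarrow> EFo F x \<in> EOb D"
    and "\<And>x y. x \<in> EOb C \<Longrightarrow> y \<in> EOb C \<Longrightarrow>
      EFa F x y \<in> Hom V (EHom C x y) (EHom D (EFo F x) (EFo F y))"
    and "\<And>x. x \<in> EOb C \<Longrightarrow>
      Comp V (Unit V) (EHom C x x) (EHom D (EFo F x) (EFo F x)) (EFa F x x) (EId C x) =
      EId D (EFo F x)"
    and "\<And>x y z. x \<in> EOb C \<Longrightarrow> y \<in> EOb C \<Longrightarrow> z \<in> EOb C \<Longrightarrow>
      Comp V (TO V (EHom C x y) (EHom C y z)) (EHom C x z) (EHom D (EFo F x) (EFo F z))
        (EFa F x z) (ECmp C x y z) =
      Comp V (TO V (EHom C x y) (EHom C y z))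
          (TO V (EHom D (EFo F x) (EFo F y)) (EHom D (EFo F y) (EFo F z)))
          (EHom D (EFo F x) (EFo F z))
        (ECmp D (EFo F x) (EFo F y) (EFo F z))
        (TA V (EHom C x y) (EHom D (EFo F x) (EFo F y)) (EHom C y z) (EHom D (EFo F y) (EFo F z))
          (EFa F x y) (EFa F y z))"
    and "EFo F \<in> extensional (EOb C)"
    and "EFa F \<in> extensional (EOb C)"
    and "\<And>x. x \<in> EOb C \<Longrightarrow> EFa F x \<in> extensional (EOb C)"
  shows "enriched_functor V C D F"
  using assms by (auto simp: enriched_functor_def PiE_iff Pi_iff)

lemma efun_eqI:
  fixes F G :: "('x, 'y, 'a) efun"
  assumes "EFo F \<in> extensional A" "EFo G \<in> extensional A"
    and "EFa F \<in> extensional A" "EFa G \<in> extensional A"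
    and "\<And>x. x \<in> A \<Longrightarrow> EFa F x \<in> extensional A" "\<And>x. x \<in> A \<Longrightarrow> EFa G x \<in> extensional A"
    and "\<And>x. x \<in> A \<Longrightarrow> EFo F x = EFo G x"
    and "\<And>x y. x \<in> A \<Longrightarrow> y \<in> A \<Longrightarrow> EFa F x y = EFa G x y"
  shows "F = G"
proof -
  have "EFo F = EFo G" using assms by (intro extensionalityI[where A = A]) auto
  moreover have "EFa F x = EFa G x" if "x \<in> A" for x
    using assms that by (intro extensionalityI[where A = A]) auto
  then have "EFa F = EFa G" using assms by (intro extensionalityI[where A = A]) auto
  ultimately show ?thesis by (cases F; cases G) simp
qed

lemma enriched_functor_efun_comp:
  assumes V: "monoidal_category V"
    and C: "enriched_typed V C" and D: "enriched_typed V D" and E: "enriched_typed V E"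
    and F: "enriched_functor V C D F" and G: "enriched_functor V D E G"
  shows "enriched_functor V C E (efun_comp V C D E G F)"
proof (rule enriched_functorI)
  note [simp] = V monoidal_rules[OF V] enriched_typedD[OF C] enriched_typedD[OF D]
    enriched_typedD[OF E] enriched_functorD(1-2)[OF F] enriched_functorD(1-2)[OF G] cat_comp cat_assoc
  note monoidal_TA[simp]
  fix x assume x: "x \<in> EOb C"
  show "EFo (efun_comp V C D E G F) x \<in> EOb E"
    using x by (simp add: efun_comp_def)
  show "Comp V (Unit V) (EHom C x x) (EHom E (EFo (efun_comp V C D E G F) x)
      (EFo (efun_comp V C D E G F) x)) (EFa (efun_comp V C D E G F) x x) (EId C x) =
      EId E (EFo (efun_comp V C D E G F) x)"
    using x by (simp add: efun_comp_def enriched_functorD(3)[OF F] enriched_functorD(3)[OF G])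
  show "EFa (efun_comp V C D E G F) x \<in> extensional (EOb C)"
    using x by (simp add: efun_comp_def)
  fix y assume y: "y \<in> EOb C"
  show "EFa (efun_comp V C D E G F) x y \<in> Hom V (EHom C x y)
          (EHom E (EFo (efun_comp V C D E G F) x) (EFo (efun_comp V C D E G F) y))"
    using x y by (simp add: efun_comp_def)
  fix z assume z: "z \<in> EOb C"
  let ?X = "TO V (EHom C x y) (EHom C y z)"
  let ?Y = "TO V (EHom D (EFo F x) (EFo F y)) (EHom D (EFo F y) (EFo F z))"
  let ?d = "EHom D (EFo F x) (EFo F z)"
  let ?Gx = "EFo G (EFo F x)" let ?Gy = "EFo G (EFo F y)" let ?Gz = "EFo G (EFo F z)"
  let ?e = "EHom E ?Gx ?Gz"
  have "Comp V ?X (EHom C x z) ?e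
      (Comp V (EHom C x z) ?d ?e (EFa G (EFo F x) (EFo F z)) (EFa F x z)) (ECmp C x y z)
    = Comp V ?X ?d ?e (EFa G (EFo F x) (EFo F z))
        (Comp V ?X (EHom C x z) ?d (EFa F x z) (ECmp C x y z))"
    using x y z by simp
  also have "\<dots> = Comp V ?X ?Y ?e
      (Comp V ?Y ?d ?e (EFa G (EFo F x) (EFo F z)) (ECmp D (EFo F x) (EFo F y) (EFo F z)))
      (TA V (EHom C x y) (EHom D (EFo F x) (EFo F y)) (EHom C y z) (EHom D (EFo F y) (EFo F z))
          (EFa F x y) (EFa F y z))"
    using x y z by (simp add: enriched_functorD(4)[OF F])
  also have "\<dots> = Comp V ?X (TO V (EHom E ?Gx ?Gy) (EHom E ?Gy ?Gz)) ?e (ECmp E ?Gx ?Gy ?Gz)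
      (TA V (EHom C x y) (EHom E ?Gx ?Gy) (EHom C y z) (EHom E ?Gy ?Gz)
        (Comp V (EHom C x y) (EHom D (EFo F x) (EFo F y)) (EHom E ?Gx ?Gy)
          (EFa G (EFo F x) (EFo F y)) (EFa F x y))
        (Comp V (EHom C y z) (EHom D (EFo F y) (EFo F z)) (EHom E ?Gy ?Gz)
          (EFa G (EFo F y) (EFo F z)) (EFa F y z)))"
    using x y z by (simp add: enriched_functorD(4)[OF G] monoidal_TA_comp)
  finally show "Comp V ?X (EHom C x z)
        (EHom E (EFo (efun_comp V C D E G F) x) (EFo (efun_comp V C D E G F) z))
        (EFa (efun_comp V C D E G F) x z) (ECmp C x y z) =
      Comp V ?X
          (TO V (EHom E (EFo (efun_comp V C D E G F) x) (EFo (efun_comp V C D E G F) y))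
            (EHom E (EFo (efun_comp V C D E G F) y) (EFo (efun_comp V C D E G F) z)))
          (EHom E (EFo (efun_comp V C D E G F) x) (EFo (efun_comp V C D E G F) z))
        (ECmp E (EFo (efun_comp V C D E G F) x) (EFo (efun_comp V C D E G F) y)
          (EFo (efun_comp V C D E G F) z))
        (TA V (EHom C x y) (EHom E (EFo (efun_comp V C D E G F) x) (EFo (efun_comp V C D E G F) y))
          (EHom C y z) (EHom E (EFo (efun_comp V C D E G F) y) (EFo (efun_comp V C D E G F) z))
          (EFa (efun_comp V C D E G F) x y) (EFa (efun_comp V C D E G F) y z))"
    using x y z by (simp add: efun_comp_def)
qed (auto simp: efun_comp_def)

lemma efun_comp_assoc:
  assumes V: "category V" and B: "enriched_typed V B"
    and C: "enriched_typed V C" and D: "enriched_typed V D" and E: "enriched_typed V E"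
    and F: "enriched_functor V B C F" and G: "enriched_functor V C D G" and K: "enriched_functor V D E K"
  shows "efun_comp V B C E (efun_comp V C D E K G) F = efun_comp V B D E K (efun_comp V B C D G F)"
proof (rule efun_eqI[where A = "EOb B"])
  fix x y assume "x \<in> EOb B" "y \<in> EOb B"
  then show "EFa (efun_comp V B C E (efun_comp V C D E K G) F) x y =
      EFa (efun_comp V B D E K (efun_comp V B C D G F)) x y"
    using V by (simp add: efun_comp_def cat_rules enriched_typedD[OF B] enriched_typedD[OF C]
      enriched_typedD[OF D] enriched_typedD[OF E] enriched_functorD(1-2)[OF F]
      enriched_functorD(1-2)[OF G] enriched_functorD(1-2)[OF K])
qed (auto simp: efun_comp_def enriched_functorD(1)[OF F])

lemma efun_comp_id:
  assumes V: "category V" and C: "enriched_typed V C" and D: "enriched_typed V D"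
    and F: "enriched_functor V C D F"
  shows "efun_comp V C C D F (efun_id V C) = F"
  by (rule efun_eqI[where A = "EOb C"])
    (auto simp: efun_comp_def efun_id_def V cat_rules enriched_typedD[OF C] enriched_typedD[OF D]
      enriched_functorD(1-2,5-7)[OF F])

lemma efun_id_comp:
  assumes V: "category V" and C: "enriched_typed V C" and D: "enriched_typed V D"
    and F: "enriched_functor V C D F"
  shows "efun_comp V C D D (efun_id V D) F = F"
  by (rule efun_eqI[where A = "EOb C"])
    (auto simp: efun_comp_def efun_id_def V cat_rules enriched_typedD[OF C] enriched_typedD[OF D]
      enriched_functorD(1-2,5-7)[OF F])


section \<open>Nerves and presheaf-valued functors\<close>

lemma Delta_id: "Idn Delta n \<in> Hom Delta n n"
  by (auto simp: Delta_def mono_on_def)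

lemma Delta_comp: "f \<in> Hom Delta m n \<Longrightarrow> g \<in> Hom Delta n p \<Longrightarrow> Comp Delta m n p g f \<in> Hom Delta m p"
  by (auto simp: Delta_def mono_on_def compose_def PiE_iff Pi_iff)

text \<open>The assumptions make \<open>\<DD>\<close> a cosimplicial object. The laws of the nerve
  are then the associativity and unit laws of \<open>efun_comp\<close>: simplicial operators act by
  precomposition, enriched functors by postcomposition.\<close>

lemma nerve_functor:
  fixes \<DD> :: "(nat, nat \<Rightarrow> nat, ('x, 'o, 'a) ecat, ('x, 'x, 'a) efun) functr"
  assumes V: "monoidal_category V"
    and typed: "\<And>n. enriched_typed V (Fo \<DD> n)"
    and mor: "\<And>m n f. f \<in> Hom Delta m n \<Longrightarrow> enriched_functor V (Fo \<DD> m) (Fo \<DD> n) (Fa \<DD> m n f)"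
    and ident: "\<And>n. Fa \<DD> n n (Idn Delta n) = efun_id V (Fo \<DD> n)"
    and comp: "\<And>m n p f g. f \<in> Hom Delta m n \<Longrightarrow> g \<in> Hom Delta n p \<Longrightarrow>
      Fa \<DD> m p (Comp Delta m n p g f) =
      efun_comp V (Fo \<DD> m) (Fo \<DD> n) (Fo \<DD> p) (Fa \<DD> n p g) (Fa \<DD> m n f)"
  shows "is_functor (ECat V) (Psh Delta) (nerve V \<DD>)"
proof -
  have cat: "category V" using V by (rule monoidal_category_cat)
  note comp_in = enriched_functor_efun_comp[OF V]
  have psh: "presheaf Delta (Fo (nerve V \<DD>) C)" if "enriched_category V C" for C :: "('y, 'o, 'a) ecat"
  proof -
    have C: "enriched_typed V C" using that by (rule enriched_category_typed)
    show ?thesis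
      unfolding presheaf_def
      by (auto simp: nerve_def ident comp efun_comp_id[OF cat typed C] typed C mor
        efun_comp_assoc[OF cat typed typed typed C] intro!: comp_in)
  qed
  have hom: "Fa (nerve V \<DD>) C D F \<in> psh_hom Delta (Fo (nerve V \<DD>) C) (Fo (nerve V \<DD>) D)"
    if CD: "enriched_category V C" "enriched_category V D" and F: "enriched_functor V C D F"
    for C D :: "('y, 'o, 'a) ecat" and F
  proof -
    have C: "enriched_typed V C" and D: "enriched_typed V D"
      using CD by (auto intro: enriched_category_typed)
    show ?thesis
      unfolding psh_hom_def
      using F by (auto simp: nerve_def mor typed C D Delta_def
          efun_comp_assoc[OF cat typed typed C D] intro!: comp_in split: if_splits)
  qed
  show ?thesis
    unfolding is_functor_def
  proof (intro conjI ballI)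
    fix C :: "('y, 'o, 'a) ecat" assume C: "C \<in> Ob (ECat V)"
    show "Fo (nerve V \<DD>) C \<in> Ob (Psh Delta)"
      using C psh by (simp add: ECat_def Psh_def)
    have tC: "enriched_typed V C" using C by (simp add: ECat_def enriched_category_typed)
    show "Fa (nerve V \<DD>) C C (Idn (ECat V) C) = Idn (Psh Delta) (Fo (nerve V \<DD>) C)"
      by (auto simp: nerve_def ECat_def Psh_def Delta_def fun_eq_iff restrict_def
        efun_id_comp[OF cat typed tC])
    fix D :: "('y, 'o, 'a) ecat" assume D: "D \<in> Ob (ECat V)"
    have tD: "enriched_typed V D" using D by (simp add: ECat_def enriched_category_typed)
    fix F assume F: "F \<in> Hom (ECat V) C D"
    show "Fa (nerve V \<DD>) C D F \<in> Hom (Psh Delta) (Fo (nerve V \<DD>) C) (Fo (nerve V \<DD>) D)"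
      using C D F hom by (simp add: ECat_def Psh_def)
    fix E :: "('y, 'o, 'a) ecat" assume E: "E \<in> Ob (ECat V)"
    have tE: "enriched_typed V E" using E by (simp add: ECat_def enriched_category_typed)
    fix G assume G: "G \<in> Hom (ECat V) D E"
    show "Fa (nerve V \<DD>) C E (Comp (ECat V) C D E G F) =
       Comp (Psh Delta) (Fo (nerve V \<DD>) C) (Fo (nerve V \<DD>) D) (Fo (nerve V \<DD>) E)
        (Fa (nerve V \<DD>) D E G) (Fa (nerve V \<DD>) C D F)"
      using F G by (auto simp: nerve_def ECat_def Psh_def Delta_def fun_eq_iff restrict_def compose_def
        comp_in[OF typed tC tD] efun_comp_assoc[OF cat typed tC tD tE])
  qed
qed

lemma psh_hom_eqI:
  assumes s: "s \<in> psh_hom B X Y" and t: "t \<in> psh_hom B X Y"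
    and eq: "\<And>b x. b \<in> Ob B \<Longrightarrow> x \<in> cells X b \<Longrightarrow> s b x = t b x"
  shows "s = t"
proof -
  have "s b = t b" if "b \<in> Ob B" for b
  proof (rule extensionalityI[where A = "cells X b"])
    show "s b \<in> extensional (cells X b)" "t b \<in> extensional (cells X b)"
      using that s t PiE_mem[of s "Ob B" "\<lambda>b. cells X b \<rightarrow>\<^sub>E cells Y b" b]
        PiE_mem[of t "Ob B" "\<lambda>b. cells X b \<rightarrow>\<^sub>E cells Y b" b]
      by (simp_all add: psh_hom_def PiE_iff)
  qed (use that eq in auto)
  then show ?thesis
    using s t by (intro extensionalityI[where A = "Ob B"]) (auto simp: psh_hom_def PiE_iff)
qed

text \<open>That \<open>N\<close> is a functor is part of the conclusion. Every cell of
  \<open>N\<close> has the form \<open>\<psi> c b y\<close>, so by \<open>act\<close> and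
  \<open>map\<close> each law for \<open>N\<close> reduces to the same law for \<open>N'\<close>;
  \<open>ext\<close> and \<open>ext'\<close> fix the values away from the cells.\<close>

lemma psh_functor_iso_transport:
  assumes C: "category C" and B: "category B"
    and N': "is_functor C (Psh B) N'"
    and bij: "\<And>c b. c \<in> Ob C \<Longrightarrow> b \<in> Ob B \<Longrightarrow> bij_betw (\<psi> c b) (cells (Fo N' c) b) (cells (Fo N c) b)"
    and act: "\<And>c b b' u x. c \<in> Ob C \<Longrightarrow> b \<in> Ob B \<Longrightarrow> b' \<in> Ob B \<Longrightarrow> u \<in> Hom B b b' \<Longrightarrow>
      x \<in> cells (Fo N' c) b' \<Longrightarrow> act (Fo N c) b b' u (\<psi> c b' x) = \<psi> c b (act (Fo N' c) b b' u x)"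
    and ext: "\<And>c c' f. c \<in> Ob C \<Longrightarrow> c' \<in> Ob C \<Longrightarrow> f \<in> Hom C c c' \<Longrightarrow> Fa N c c' f \<in> extensional (Ob B)"
    and ext': "\<And>c c' f b. c \<in> Ob C \<Longrightarrow> c' \<in> Ob C \<Longrightarrow> f \<in> Hom C c c' \<Longrightarrow> b \<in> Ob B \<Longrightarrow>
      Fa N c c' f b \<in> extensional (cells (Fo N c) b)"
    and map: "\<And>c c' f b x. c \<in> Ob C \<Longrightarrow> c' \<in> Ob C \<Longrightarrow> f \<in> Hom C c c' \<Longrightarrow> b \<in> Ob B \<Longrightarrow>
      x \<in> cells (Fo N' c) b \<Longrightarrow> Fa N c c' f b (\<psi> c b x) = \<psi> c' b (Fa N' c c' f b x)"
  shows "psh_functor_iso C B N N'"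
proof -
  have psh': "presheaf B (Fo N' c)" if "c \<in> Ob C" for c
    using N' that by (simp add: is_functor_def Psh_def)
  have hom': "Fa N' c c' f \<in> psh_hom B (Fo N' c) (Fo N' c')"
    if "c \<in> Ob C" "c' \<in> Ob C" "f \<in> Hom C c c'" for c c' f
    using N' that by (simp add: is_functor_def Psh_def)
  have act'_in: "act (Fo N' c) b b' u x \<in> cells (Fo N' c) b"
    if "c \<in> Ob C" "b \<in> Ob B" "b' \<in> Ob B" "u \<in> Hom B b b'" "x \<in> cells (Fo N' c) b'" for c b b' u x
    using psh'[of c] that by (auto simp: presheaf_def)
  have map'_in: "Fa N' c c' f b x \<in> cells (Fo N' c') b"
    if "c \<in> Ob C" "c' \<in> Ob C" "f \<in> Hom C c c'" "b \<in> Ob B" "x \<in> cells (Fo N' c) b" for c c' f b x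
    using hom'[of c c' f] that by (auto simp: psh_hom_def)
  have \<psi>_in: "\<psi> c b x \<in> cells (Fo N c) b" if "c \<in> Ob C" "b \<in> Ob B" "x \<in> cells (Fo N' c) b" for c b x
    using bij[of c b] that by (auto simp: bij_betw_def)
  have ex: "\<exists>y \<in> cells (Fo N' c) b. x = \<psi> c b y" if "c \<in> Ob C" "b \<in> Ob B" "x \<in> cells (Fo N c) b" for c b x
    using bij[of c b] that by (auto simp: bij_betw_def)
  have psh: "presheaf B (Fo N c)" if c: "c \<in> Ob C" for c
    unfolding presheaf_def
  proof (intro conjI ballI)
    fix b b' u assume b: "b \<in> Ob B" "b' \<in> Ob B" and u: "u \<in> Hom B b b'"
    show "act (Fo N c) b b' u \<in> cells (Fo N c) b' \<rightarrow> cells (Fo N c) b"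
    proof
      fix x assume "x \<in> cells (Fo N c) b'"
      then obtain y where "y \<in> cells (Fo N' c) b'" "x = \<psi> c b' y" using ex c b by blast
      then show "act (Fo N c) b b' u x \<in> cells (Fo N c) b"
        using c b u by (simp add: act \<psi>_in act'_in)
    qed
  next
    fix b x assume b: "b \<in> Ob B" and "x \<in> cells (Fo N c) b"
    then obtain y where "y \<in> cells (Fo N' c) b" "x = \<psi> c b y" using ex c b by blast
    then show "act (Fo N c) b b (Idn B b) x = x"
      using c b psh'[OF c] B by (simp add: act cat_id presheaf_def)
  next
    fix b b' b'' u v x assume b: "b \<in> Ob B" "b' \<in> Ob B" "b'' \<in> Ob B"
      and u: "u \<in> Hom B b b'" and v: "v \<in> Hom B b' b''" and "x \<in> cells (Fo N c) b''"
    then obtain y where "y \<in> cells (Fo N' c) b''" "x = \<psi> c b'' y" using ex c b by blast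
    then show "act (Fo N c) b b'' (Comp B b b' b'' v u) x = act (Fo N c) b b' u (act (Fo N c) b' b'' v x)"
      using c b u v psh'[OF c] B by (simp add: act act'_in cat_comp) (simp add: presheaf_def)
  qed
  have hom: "Fa N c c' f \<in> psh_hom B (Fo N c) (Fo N c')"
    if c: "c \<in> Ob C" "c' \<in> Ob C" and f: "f \<in> Hom C c c'" for c c' f
    unfolding psh_hom_def
  proof (intro CollectI conjI ballI PiE_I)
    fix b x assume b: "b \<in> Ob B" and "x \<in> cells (Fo N c) b"
    then obtain y where "y \<in> cells (Fo N' c) b" "x = \<psi> c b y" using ex c by blast
    then show "Fa N c c' f b x \<in> cells (Fo N c') b"
      using c b f by (simp add: map \<psi>_in map'_in)
  next
    fix b b' u x assume b: "b \<in> Ob B" "b' \<in> Ob B" and u: "u \<in> Hom B b b'" and "x \<in> cells (Fo N c) b'"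
    then obtain y where y: "y \<in> cells (Fo N' c) b'" "x = \<psi> c b' y" using ex c by blast
    have "Fa N' c c' f b (act (Fo N' c) b b' u y) = act (Fo N' c') b b' u (Fa N' c c' f b' y)"
      using hom'[OF c f] b u y by (simp add: psh_hom_def)
    then show "Fa N c c' f b (act (Fo N c) b b' u x) = act (Fo N c') b b' u (Fa N c c' f b' x)"
      using c b f u y by (simp add: act map act'_in map'_in)
  next
    fix b x assume "b \<in> Ob B" "x \<notin> cells (Fo N c) b"
    then show "Fa N c c' f b x = undefined"
      using ext'[OF c f] by (auto simp: extensional_def)
  next
    fix b assume "b \<notin> Ob B"
    then show "Fa N c c' f b = undefined"
      using ext[OF c f] by (auto simp: extensional_def)
  qed
  have N: "is_functor C (Psh B) N"
    unfolding is_functor_def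
  proof (intro conjI ballI)
    fix c assume c: "c \<in> Ob C"
    show "Fo N c \<in> Ob (Psh B)" using psh[OF c] by (simp add: Psh_def)
    show "Fa N c c (Idn C c) = Idn (Psh B) (Fo N c)"
    proof (rule psh_hom_eqI)
      show "Fa N c c (Idn C c) \<in> psh_hom B (Fo N c) (Fo N c)"
        using c C by (simp add: hom cat_id)
      show "Idn (Psh B) (Fo N c) \<in> psh_hom B (Fo N c) (Fo N c)"
        using psh[OF c] by (auto simp: Psh_def psh_hom_def presheaf_def)
      fix b x assume b: "b \<in> Ob B" and x: "x \<in> cells (Fo N c) b"
      then obtain y where y: "y \<in> cells (Fo N' c) b" "x = \<psi> c b y" using ex c by blast
      have "Fa N' c c (Idn C c) = Idn (Psh B) (Fo N' c)"
        using N' c by (simp add: is_functor_def)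
      then show "Fa N c c (Idn C c) b x = Idn (Psh B) (Fo N c) b x"
        using c b x y C by (simp add: map cat_id) (simp add: Psh_def)
    qed
    fix c' f assume c': "c' \<in> Ob C" and f: "f \<in> Hom C c c'"
    show "Fa N c c' f \<in> Hom (Psh B) (Fo N c) (Fo N c')"
      using hom[OF c c' f] by (simp add: Psh_def)
    fix c'' g assume c'': "c'' \<in> Ob C" and g: "g \<in> Hom C c' c''"
    show "Fa N c c'' (Comp C c c' c'' g f) =
      Comp (Psh B) (Fo N c) (Fo N c') (Fo N c'') (Fa N c' c'' g) (Fa N c c' f)"
    proof (rule psh_hom_eqI)
      show "Fa N c c'' (Comp C c c' c'' g f) \<in> psh_hom B (Fo N c) (Fo N c'')"
        using c c' c'' f g C by (simp add: hom cat_comp)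
      show "Comp (Psh B) (Fo N c) (Fo N c') (Fo N c'') (Fa N c' c'' g) (Fa N c c' f)
          \<in> psh_hom B (Fo N c) (Fo N c'')"
        using hom[OF c c' f] hom[OF c' c'' g] psh[OF c]
        by (auto simp: Psh_def psh_hom_def compose_def presheaf_def PiE_iff Pi_iff)
      fix b x assume b: "b \<in> Ob B" and x: "x \<in> cells (Fo N c) b"
      then obtain y where y: "y \<in> cells (Fo N' c) b" "x = \<psi> c b y" using ex c by blast
      have "Fa N' c c'' (Comp C c c' c'' g f) =
          Comp (Psh B) (Fo N' c) (Fo N' c') (Fo N' c'') (Fa N' c' c'' g) (Fa N' c c' f)"
        using N' c c' c'' f g by (simp add: is_functor_def)
      then have "Fa N' c c'' (Comp C c c' c'' g f) b y = Fa N' c' c'' g b (Fa N' c c' f b y)"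
        using b y by (simp add: Psh_def compose_def)
      then show "Fa N c c'' (Comp C c c' c'' g f) b x =
          Comp (Psh B) (Fo N c) (Fo N c') (Fo N c'') (Fa N c' c'' g) (Fa N c c' f) b x"
        using c c' c'' f g b x y C
        by (simp add: map cat_comp map'_in Psh_def compose_def)
    qed
  qed
  \<comment> \<open>\<open>psh_functor_iso\<close> asks for bijections from \<open>N\<close> to
    \<open>N'\<close>, whereas \<open>\<psi>\<close> runs from \<open>N'\<close> to
    \<open>N\<close>.\<close>
  define \<theta> where "\<theta> c b = inv_into (cells (Fo N' c) b) (\<psi> c b)" for c b
  have \<theta>: "\<theta> c b (\<psi> c b y) = y" if "c \<in> Ob C" "b \<in> Ob B" "y \<in> cells (Fo N' c) b" for c b y
    using bij[of c b] that by (simp add: \<theta>_def bij_betw_def)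
  show ?thesis
    unfolding psh_functor_iso_def
  proof (intro conjI N N' exI[of _ \<theta>] ballI)
    fix c b assume "c \<in> Ob C" "b \<in> Ob B"
    then show "bij_betw (\<theta> c b) (cells (Fo N c) b) (cells (Fo N' c) b)"
      unfolding \<theta>_def by (intro bij_betw_inv_into bij)
  next
    fix c b b' u x assume c: "c \<in> Ob C" and b: "b \<in> Ob B" "b' \<in> Ob B" and u: "u \<in> Hom B b b'"
      and "x \<in> cells (Fo N c) b'"
    then obtain y where "y \<in> cells (Fo N' c) b'" "x = \<psi> c b' y" using ex by blast
    then show "\<theta> c b (act (Fo N c) b b' u x) = act (Fo N' c) b b' u (\<theta> c b' x)"
      using c b u by (simp add: act \<theta> act'_in)
  next
    fix c c' f b x assume c: "c \<in> Ob C" "c' \<in> Ob C" and f: "f \<in> Hom C c c'" and b: "b \<in> Ob B"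
      and "x \<in> cells (Fo N c) b"
    then obtain y where "y \<in> cells (Fo N' c) b" "x = \<psi> c b y" using ex by blast
    then show "\<theta> c' b (Fa N c c' f b x) = Fa N' c c' f b (\<theta> c b x)"
      using c b f by (simp add: map \<theta> map'_in)
  qed
qed

section \<open>The cube category\<close>

lemma cube_conv [simp]: "xs \<in> cube n \<longleftrightarrow> length xs = n"
  by (simp add: cube_def)

lemma box_simps [simp]:
  "Ob box = UNIV" "Hom box m n = {f. box_map m n f}" "Comp box m n k g f = compose (cube m) g f"
  "Idn box n = (\<lambda>xs\<in>cube n. xs)" "TO box = (+)" "Unit box = 0"
  "Assoc box m n k = (\<lambda>xs\<in>cube (m + n + k). xs)" "LUnit box n = (\<lambda>xs\<in>cube n. xs)"
  "RUnit box n = (\<lambda>xs\<in>cube n. xs)"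
  by (simp_all add: box_def)

lemma TA_box: "TA box m m' n n' f g = (\<lambda>xs\<in>cube (m + n). f (take m xs) @ g (drop m xs))"
  by (simp add: box_def)

lemma box_map_funcset: "box_map m n f \<Longrightarrow> f \<in> cube m \<rightarrow>\<^sub>E cube n"
  by (induction rule: box_map.induct)
    (auto simp: box_face_def box_degen_def box_conn_def compose_def PiE_iff Pi_iff extensional_def)

lemma box_map_length: "box_map m n f \<Longrightarrow> length xs = m \<Longrightarrow> length (f xs) = n"
  using box_map_funcset[of m n f] by (auto simp: PiE_iff)

lemma box_map_eqI:
  "\<lbrakk>box_map m n f; box_map m n g; \<And>xs. length xs = m \<Longrightarrow> f xs = g xs\<rbrakk> \<Longrightarrow> f = g"
  using box_map_funcset[of m n f] box_map_funcset[of m n g]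
  by (intro extensionalityI[where A = "cube m"]) (auto simp: PiE_iff)

lemma compose_cube_ident [simp]:
  "box_map m n f \<Longrightarrow> compose (cube m) f (\<lambda>xs\<in>cube m. xs) = f"
  "box_map m n f \<Longrightarrow> compose (cube m) (\<lambda>xs\<in>cube n. xs) f = f"
proof -
  assume f: "box_map m n f"
  show "compose (cube m) f (\<lambda>xs\<in>cube m. xs) = f"
    by (rule box_map_eqI[OF box_map.comp[OF box_map.ident f] f]) (simp add: compose_def)
  show "compose (cube m) (\<lambda>xs\<in>cube n. xs) f = f"
    by (rule box_map_eqI[OF box_map.comp[OF f box_map.ident] f])
      (simp add: compose_def box_map_length[OF f])
qed

lemma cube_map_eqI:
  "(\<And>xs. length xs = n \<Longrightarrow> f xs = g xs) \<Longrightarrow> (\<lambda>xs\<in>cube n. f xs) = (\<lambda>xs\<in>cube n. g xs)"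
  by (auto simp: restrict_def)

lemma cube_map_append_eqI:
  assumes "\<And>xs ys. length xs = m \<Longrightarrow> length ys = n \<Longrightarrow> f (xs @ ys) = g (xs @ ys)"
  shows "(\<lambda>xs\<in>cube (m + n). f xs) = (\<lambda>xs\<in>cube (m + n). g xs)"
proof (rule cube_map_eqI)
  fix xs :: "bool list" assume "length xs = m + n"
  then show "f xs = g xs"
    using assms[of "take m xs" "drop m xs"] by simp
qed

text \<open>\<open>box_map\<close> is closed under composition by definition, but closure under the
  tensor product has to be proved. Appending untouched coordinates turns each generator into the
  generator with the same index on a larger cube.\<close>

lemma TA_box_whisker_right:
  "box_map m m' f \<Longrightarrow> box_map (m + n) (m' + n) (\<lambda>xs\<in>cube (m + n). f (take m xs) @ drop m xs)"
proof (induction rule: box_map.induct)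
  case (ident m)
  have "(\<lambda>xs\<in>cube (m + n). (\<lambda>xs\<in>cube m. xs) (take m xs) @ drop m xs) = (\<lambda>xs\<in>cube (m + n). xs)"
    by (intro cube_map_append_eqI) simp
  then show ?case by (simp only: box_map.ident)
next
  case (face i m \<epsilon>)
  have "(\<lambda>xs\<in>cube (m + n). box_face \<epsilon> i m (take m xs) @ drop m xs) = box_face \<epsilon> i (m + n)"
    unfolding box_face_def using face by (intro cube_map_append_eqI) simp
  then show ?case using face box_map.face[of i "m + n" \<epsilon>] by simp
next
  case (degen i m)
  have "(\<lambda>xs\<in>cube (Suc m + n). box_degen i m (take (Suc m) xs) @ drop (Suc m) xs) = box_degen i (m + n)"
    unfolding box_degen_def using degen
    by (simp only: add_Suc[symmetric], intro cube_map_append_eqI) simp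
  then show ?case using degen box_map.degen[of i "m + n"] by simp
next
  case (conn i m)
  have "(\<lambda>xs\<in>cube (Suc m + n). box_conn i m (take (Suc m) xs) @ drop (Suc m) xs) = box_conn i (m + n)"
    unfolding box_conn_def using conn
    by (simp only: add_Suc[symmetric], intro cube_map_append_eqI)
      (simp add: nth_append less_imp_diff_less)
  then show ?case using conn box_map.conn[of i "m + n"] by simp
next
  case (comp m m' f m'' g)
  have "(\<lambda>xs\<in>cube (m + n). compose (cube m) g f (take m xs) @ drop m xs) =
    compose (cube (m + n)) (\<lambda>xs\<in>cube (m' + n). g (take m' xs) @ drop m' xs)
      (\<lambda>xs\<in>cube (m + n). f (take m xs) @ drop m xs)"
    using comp.hyps(1) by (auto simp: compose_def fun_eq_iff restrict_def box_map_length)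
  then show ?case by (simp only: box_map.comp[OF comp.IH])
qed

text \<open>Prepending \<open>n\<close> untouched coordinates shifts the index of each generator by
  \<open>n\<close>.\<close>

lemma TA_box_whisker_left:
  "box_map m m' f \<Longrightarrow> box_map (n + m) (n + m') (\<lambda>xs\<in>cube (n + m). take n xs @ f (drop n xs))"
proof (induction rule: box_map.induct)
  case (ident m)
  have "(\<lambda>xs\<in>cube (n + m). take n xs @ (\<lambda>xs\<in>cube m. xs) (drop n xs)) = (\<lambda>xs\<in>cube (n + m). xs)"
    by (intro cube_map_append_eqI) simp
  then show ?case by (simp only: box_map.ident)
next
  case (face i m \<epsilon>)
  have "(\<lambda>xs\<in>cube (n + m). take n xs @ box_face \<epsilon> i m (drop n xs)) = box_face \<epsilon> (n + i) (n + m)"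
    unfolding box_face_def using face
    by (intro cube_map_append_eqI) simp
  then show ?case using face box_map.face[of "n + i" "n + m" \<epsilon>] by simp
next
  case (degen i m)
  have "(\<lambda>xs\<in>cube (n + Suc m). take n xs @ box_degen i m (drop n xs)) = box_degen (n + i) (n + m)"
    unfolding box_degen_def using degen
    by (simp only: add_Suc_right[symmetric], intro cube_map_append_eqI) simp
  then show ?case using degen box_map.degen[of "n + i" "n + m"] by simp
next
  case (conn i m)
  have "(\<lambda>xs\<in>cube (n + Suc m). take n xs @ box_conn i m (drop n xs)) = box_conn (n + i) (n + m)"
    unfolding box_conn_def using conn
    by (simp only: add_Suc_right[symmetric], intro cube_map_append_eqI)
      (cases i; simp add: nth_append less_imp_diff_less)
  then show ?case using conn box_map.conn[of "n + i" "n + m"] by simp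
next
  case (comp m m' f m'' g)
  have "(\<lambda>xs\<in>cube (n + m). take n xs @ compose (cube m) g f (drop n xs)) =
    compose (cube (n + m)) (\<lambda>xs\<in>cube (n + m'). take n xs @ g (drop n xs))
      (\<lambda>xs\<in>cube (n + m). take n xs @ f (drop n xs))"
    using comp.hyps(1) by (auto simp: compose_def fun_eq_iff restrict_def box_map_length)
  then show ?case by (simp only: box_map.comp[OF comp.IH])
qed

text \<open>By the interchange law, the tensor product acts by \<open>f\<close> on the left block
  first and by \<open>g\<close> on the right block afterwards.\<close>

lemma box_map_TA:
  assumes f: "box_map m m' f" and g: "box_map n n' g"
  shows "box_map (m + n) (m' + n') (TA box m m' n n' f g)"
proof -
  have "TA box m m' n n' f g =
    compose (cube (m + n)) (\<lambda>xs\<in>cube (m' + n). take m' xs @ g (drop m' xs))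
      (\<lambda>xs\<in>cube (m + n). f (take m xs) @ drop m xs)"
    using f by (auto simp: TA_box compose_def fun_eq_iff restrict_def box_map_length)
  then show ?thesis
    by (simp only: box_map.comp[OF TA_box_whisker_right[OF f] TA_box_whisker_left[OF g]])
qed

text \<open>Induction on the number of coordinates: a new last coordinate is joined to the value so
  far by a connection if \<open>P\<close> selects it, and deleted by a degeneracy otherwise. The
  constant \<open>a\<close> enters at the start, as a vertex of the interval.\<close>

lemma box_map_Or: "box_map r 1 (\<lambda>xs\<in>cube r. [a \<or> (\<exists>j<r. xs ! j \<and> P j)])"
proof (induction r)
  case 0
  have "(\<lambda>xs\<in>cube 0. [a \<or> (\<exists>j<0. xs ! j \<and> P j)]) = box_face a 1 0"
    by (auto simp: box_face_def fun_eq_iff restrict_def)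
  then show ?case using box_map.face[of 1 0 a] by simp
next
  case (Suc r)
  let ?h = "\<lambda>xs\<in>cube r. [a \<or> (\<exists>j<r. xs ! j \<and> P j)]"
  show ?case
  proof (cases "P r")
    case True
    have "(\<lambda>xs\<in>cube (Suc r). [a \<or> (\<exists>j<Suc r. xs ! j \<and> P j)]) =
      compose (cube (Suc r)) (box_conn 1 1) (\<lambda>xs\<in>cube (r + 1). ?h (take r xs) @ drop r xs)"
      using True by (auto simp: compose_def box_conn_def fun_eq_iff restrict_def less_Suc_eq max_def
        nth_append hd_drop_conv_nth)
    then show ?thesis
      using box_map.comp[OF TA_box_whisker_right[OF Suc, of 1], of 1 "box_conn 1 1"]
        box_map.conn[of 1 1] by (simp add: numeral_2_eq_2)
  next
    case False
    have "(\<lambda>xs\<in>cube (Suc r). [a \<or> (\<exists>j<Suc r. xs ! j \<and> P j)]) =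
      compose (cube (Suc r)) ?h (box_degen (Suc r) r)"
      using False by (auto simp: compose_def box_degen_def fun_eq_iff restrict_def less_Suc_eq)
    then show ?thesis
      using box_map.comp[OF box_map.degen[of "Suc r" r] Suc] by (simp del: restrict_apply)
  qed
qed

lemma box_map_terminal: "box_map m 0 (\<lambda>xs\<in>cube m. [])"
proof (induction m)
  case 0
  have "(\<lambda>xs\<in>cube 0. []) = (\<lambda>xs\<in>cube 0. xs)"
    by (rule cube_map_eqI) simp
  then show ?case by (simp only: box_map.ident)
next
  case (Suc m)
  have eq: "(\<lambda>xs\<in>cube (Suc m). []) = compose (cube (Suc m)) (\<lambda>xs\<in>cube m. []) (box_degen 1 m)"
    by (auto simp: compose_def box_degen_def fun_eq_iff restrict_def)
  show ?case
    unfolding eq using box_map.degen[of 1 m] by (intro box_map.comp[OF _ Suc]) simp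
qed

text \<open>A nondecreasing reindexing \<open>F\<close> of the coordinates cuts the source into consecutive blocks,
  one for each output coordinate; on each block the map is a disjunction.\<close>

lemma box_map_reindex:
  fixes F :: "nat \<Rightarrow> nat"
  assumes "sorted_wrt (<) N" and "mono_on {..<m} F"
  shows "box_map m (length N) (\<lambda>xs\<in>cube m. map (\<lambda>v. v \<in> A \<or> (\<exists>j<m. xs ! j \<and> F j = v)) N)"
  using assms
proof (induction N arbitrary: m F)
  case Nil
  then show ?case using box_map_terminal[of m] by (simp del: restrict_apply)
next
  case (Cons v N)
  \<comment> \<open>\<open>r\<close> is the first coordinate sent beyond \<open>v\<close>, or
    \<open>m\<close> if there is none. The output \<open>v\<close> depends only on coordinates
    before \<open>r\<close>, the later outputs only on those from \<open>r\<close> on. Coordinates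
    sent below \<open>v\<close> stay in the first block, where they affect nothing.\<close>
  define r where "r = (if \<exists>j<m. v < F j then LEAST j. j < m \<and> v < F j else m)"
  have r: "r \<le> m" "\<And>j. j < m \<Longrightarrow> j < r \<longleftrightarrow> F j \<le> v"
  proof -
    show "r \<le> m"
      by (auto simp: r_def) (metis (mono_tags, lifting) LeastI less_imp_le)
    fix j assume j: "j < m"
    show "j < r \<longleftrightarrow> F j \<le> v"
    proof (cases "\<exists>j<m. v < F j")
      case True
      then have *: "r < m" "v < F r" "\<And>i. i < m \<Longrightarrow> v < F i \<Longrightarrow> r \<le> i"
        using LeastI_ex[of "\<lambda>j. j < m \<and> v < F j"] Least_le[of "\<lambda>j. j < m \<and> v < F j"]
        by (auto simp: r_def)
      then show ?thesis
        using j monotone_onD[OF Cons.prems(2), of r j] by (meson lessThan_iff not_le order.strict_trans2)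
    next
      case False
      then have "r = m" "F j \<le> v" using j unfolding r_def by (meson not_less)+
      then show ?thesis using j by simp
    qed
  qed
  have m: "m = r + (m - r)" using r by simp
  let ?h = "\<lambda>xs\<in>cube r. [v \<in> A \<or> (\<exists>j<r. xs ! j \<and> F j = v)]"
  let ?k = "\<lambda>xs\<in>cube (m - r). map (\<lambda>v. v \<in> A \<or> (\<exists>j<m - r. xs ! j \<and> F (r + j) = v)) N"
  have "box_map (m - r) (length N) ?k"
    using Cons.prems by (intro Cons.IH) (auto simp: mono_on_def less_diff_conv add.commute)
  then have "box_map (r + (m - r)) (1 + length N) (TA box r 1 (m - r) (length N) ?h ?k)"
    by (intro box_map_TA box_map_Or)
  moreover have "TA box r 1 (m - r) (length N) ?h ?k =
    (\<lambda>xs\<in>cube m. map (\<lambda>v. v \<in> A \<or> (\<exists>j<m. xs ! j \<and> F j = v)) (v # N))"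
  proof (rule ext)
    fix xs
    show "TA box r 1 (m - r) (length N) ?h ?k xs =
      (\<lambda>xs\<in>cube m. map (\<lambda>v. v \<in> A \<or> (\<exists>j<m. xs ! j \<and> F j = v)) (v # N)) xs"
    proof (cases "length xs = m")
      case True
      have "j < r \<and> take r xs ! j \<and> F j = v \<longleftrightarrow> j < m \<and> xs ! j \<and> F j = v" for j
        using r(1) r(2)[of j] by auto
      then have head: "(\<exists>j<r. take r xs ! j \<and> F j = v) \<longleftrightarrow> (\<exists>j<m. xs ! j \<and> F j = v)"
        by blast
      have tail: "(\<exists>j<m - r. xs ! (r + j) \<and> F (r + j) = u) \<longleftrightarrow> (\<exists>j<m. xs ! j \<and> F j = u)"
        if "u \<in> set N" for u
      proof
        assume "\<exists>j<m. xs ! j \<and> F j = u"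
        then obtain j where j: "j < m" "xs ! j" "F j = u" by blast
        have "v < u" using that Cons.prems(1) by auto
        then have "r \<le> j" using j r(2)[of j] by auto
        then show "\<exists>j<m - r. xs ! (r + j) \<and> F (r + j) = u"
          using j by (intro exI[of _ "j - r"]) auto
      qed (auto simp: less_diff_conv add.commute)
      show ?thesis
        using True r(1) head by (simp add: TA_box tail)
    qed (use r(1) in \<open>auto simp: TA_box\<close>)
  qed
  ultimately show ?case using m by (simp del: restrict_apply)
qed

section \<open>Necklaces\<close>

lemma Nec_simps [simp]:
  "Hom Nec = nec_hom" "Comp Nec S S' S'' g f = compose {..snd S} g f" "Idn Nec = nec_id"
  "TO Nec = wedge" "Unit Nec = ({0}, 0)" "Assoc Nec S S' S'' = nec_id (wedge (wedge S S') S'')"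
  "LUnit Nec = nec_id" "RUnit Nec = nec_id"
  by (simp_all add: Nec_def)

lemma TA_Nec: "TA Nec S S' Z Z' f g = (\<lambda>i\<in>{..snd S + snd Z}.
       if i \<le> snd S then f i else snd S' + g (i - snd S))"
  by (simp add: Nec_def)

lemma Ob_Nec_iff: "S \<in> Ob Nec \<longleftrightarrow> 0 \<in> fst S \<and> snd S \<in> fst S \<and> fst S \<subseteq> {..snd S}"
  by (auto simp: Nec_def)

lemma nec_homD:
  assumes "f \<in> nec_hom S S'"
  shows "f \<in> {..snd S} \<rightarrow>\<^sub>E {..snd S'}" "mono_on {..snd S} f" "f 0 = 0" "f (snd S) = snd S'"
    "fst S' \<subseteq> f ` fst S"
  using assms by (cases S; cases S'; simp add: nec_hom_def)+

lemma nec_homI: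
  assumes "f \<in> {..snd S} \<rightarrow>\<^sub>E {..snd S'}" "mono_on {..snd S} f" "f 0 = 0" "f (snd S) = snd S'"
    "fst S' \<subseteq> f ` fst S"
  shows "f \<in> nec_hom S S'"
  using assms by (cases S; cases S') (simp add: nec_hom_def)

lemma finite_missing [simp]: "finite (missing S)"
  by (simp add: missing_def)

text \<open>The vertices other than the joints, in increasing order; list positions are the
  coordinates of the cube that dim assigns to \<open>S\<close>.\<close>

abbreviation beads :: "necklace \<Rightarrow> nat list" where
  "beads S \<equiv> sorted_list_of_set (missing S)"

lemma nth_beads: "j < card (missing S) \<Longrightarrow> beads S ! j \<in> missing S"
  using nth_mem[of j "beads S"] by simp

lemma nec_decode_bounds:
  assumes "S \<in> Ob Nec"
  shows "fst S \<subseteq> nec_decode S xs" and "nec_decode S xs \<subseteq> {..snd S}"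
proof -
  have "missing S \<subseteq> {..snd S}" by (auto simp: missing_def)
  then show "fst S \<subseteq> nec_decode S xs" "nec_decode S xs \<subseteq> {..snd S}"
    using assms nth_beads[of _ S] unfolding nec_decode_def Ob_Nec_iff by blast+
qed

lemma nec_encode_decode:
  assumes "length xs = card (missing S)"
  shows "nec_encode S (nec_decode S xs) = xs"
proof (rule nth_equalityI)
  fix i assume "i < length (nec_encode S (nec_decode S xs))"
  then have i: "i < card (missing S)" by (simp add: nec_encode_def)
  then have "beads S ! i \<notin> fst S" using nth_beads[OF i] by (simp add: missing_def)
  moreover have "beads S ! i = beads S ! j \<longleftrightarrow> i = j" if "j < card (missing S)" for j
    using i that nth_eq_iff_index_eq[of "beads S" i j] by simp
  ultimately have "beads S ! i \<in> nec_decode S xs \<longleftrightarrow> xs ! i"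
    using i unfolding nec_decode_def by blast
  then show "nec_encode S (nec_decode S xs) ! i = xs ! i"
    using i by (simp add: nec_encode_def)
qed (simp add: nec_encode_def assms)

text \<open>Encoding records membership of beads only, so \<open>V\<close> is recovered just when it
  contains all joints and no foreign vertices.\<close>

lemma nec_decode_encode:
  assumes "fst S \<subseteq> V" "V \<subseteq> {..snd S}"
  shows "nec_decode S (nec_encode S V) = V"
proof -
  have "\<exists>j<card (missing S). v = beads S ! j" if "v \<in> V" "v \<notin> fst S" for v
  proof -
    have "v \<in> set (beads S)" using that assms by (auto simp: missing_def)
    then show ?thesis by (metis in_set_conv_nth length_sorted_list_of_set)
  qed
  moreover have "nec_encode S V ! j \<longleftrightarrow> beads S ! j \<in> V" if "j < card (missing S)" for j
    using that by (simp add: nec_encode_def)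
  ultimately show ?thesis
    using assms unfolding nec_decode_def by blast
qed

lemma nec_dim_simps [simp]:
  "Fo nec_dim S = card (missing S)"
  "Mu nec_dim S S' = Idn box (card (missing S) + card (missing S'))"
  "Eps nec_dim = Idn box 0"
  by (simp_all add: nec_dim_def)

lemma nec_dim_apply:
  "length xs = card (missing S) \<Longrightarrow> Fa nec_dim S S' f xs = nec_encode S' (f ` nec_decode S xs)"
  by (simp add: nec_dim_def)

text \<open>An output bead is hit either by a joint of \<open>S\<close>, which makes its coordinate
  constantly true, or by selected beads. Monotonicity of \<open>f\<close> makes the reindexing
  \<open>?F\<close> of beads nondecreasing, as \<open>box_map_reindex\<close> demands.\<close>

lemma box_map_nec_dim:
  assumes S: "S \<in> Ob Nec" and f: "f \<in> nec_hom S S'"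
  shows "box_map (card (missing S)) (card (missing S')) (Fa nec_dim S S' f)"
proof -
  let ?F = "\<lambda>j. f (beads S ! j)"
  have "mono_on {..<card (missing S)} ?F"
  proof (rule mono_onI)
    fix i j assume ij: "i \<in> {..<card (missing S)}" "j \<in> {..<card (missing S)}" "i \<le> j"
    then have "beads S ! i \<le> beads S ! j"
      by (simp add: sorted_nth_mono)
    then show "?F i \<le> ?F j"
      using ij nth_beads[of i S] nth_beads[of j S] monotone_onD[OF nec_homD(2)[OF f]]
      by (auto simp: missing_def)
  qed
  moreover have "sorted_wrt (<) (beads S')" by simp
  ultimately have "box_map (card (missing S)) (length (beads S'))
    (\<lambda>xs\<in>cube (card (missing S)).
      map (\<lambda>v. v \<in> f ` fst S \<or> (\<exists>j<card (missing S). xs ! j \<and> ?F j = v)) (beads S'))"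
    by (intro box_map_reindex)
  moreover have "Fa nec_dim S S' f = (\<lambda>xs\<in>cube (card (missing S)).
      map (\<lambda>v. v \<in> f ` fst S \<or> (\<exists>j<card (missing S). xs ! j \<and> ?F j = v)) (beads S'))"
    by (auto simp: nec_dim_def nec_encode_def nec_decode_def fun_eq_iff restrict_def)
  ultimately show ?thesis by simp
qed

lemma nec_dim_id: "Fa nec_dim S S (nec_id S) = Idn box (card (missing S))" if "S \<in> Ob Nec"
proof -
  have "nec_id S ` nec_decode S xs = nec_decode S xs" for xs
    using nec_decode_bounds(2)[OF that, of xs] by (force simp: nec_id_def)
  then show ?thesis
    by (auto simp: nec_dim_def nec_encode_decode restrict_def)
qed

lemma nec_dim_comp:
  assumes S: "S \<in> Ob Nec" and S': "S' \<in> Ob Nec" and f: "f \<in> nec_hom S S'" and g: "g \<in> nec_hom S' S''"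
  shows "Fa nec_dim S S'' (compose {..snd S} g f) =
    compose (cube (card (missing S))) (Fa nec_dim S' S'' g) (Fa nec_dim S S' f)"
proof (rule ext)
  fix xs
  show "Fa nec_dim S S'' (compose {..snd S} g f) xs =
    compose (cube (card (missing S))) (Fa nec_dim S' S'' g) (Fa nec_dim S S' f) xs"
  proof (cases "length xs = card (missing S)")
    case True
    let ?V = "nec_decode S xs"
    have V: "fst S \<subseteq> ?V" "?V \<subseteq> {..snd S}"
      using nec_decode_bounds[OF S] by auto
    \<comment> \<open>Here the defining condition of necklace maps enters: the image of a vertex set
      contains all joints of \<open>S'\<close>, so encoding it loses nothing and the second map sees
      the true image.\<close>
    have "fst S' \<subseteq> f ` ?V" using nec_homD(5)[OF f] V by blast
    moreover have "f ` ?V \<subseteq> {..snd S'}" using nec_homD(1)[OF f] V by auto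
    ultimately have "nec_decode S' (nec_encode S' (f ` ?V)) = f ` ?V" by (rule nec_decode_encode)
    moreover have "compose {..snd S} g f ` ?V = g ` f ` ?V"
      using V by (force simp: compose_def image_image)
    ultimately show ?thesis
      using True by (simp add: nec_dim_apply compose_def) (simp add: nec_dim_apply nec_encode_def)
  qed (auto simp: nec_dim_def compose_def)
qed

section \<open>Wedges of necklaces and strict monoidality of dim\<close>

lemma wedge_Ob: "S \<in> Ob Nec \<Longrightarrow> S' \<in> Ob Nec \<Longrightarrow> wedge S S' \<in> Ob Nec"
  by (auto simp: Ob_Nec_iff wedge_def split: prod.splits)

lemma snd_wedge [simp]: "snd (wedge S S') = snd S + snd S'"
  and fst_wedge [simp]: "fst (wedge S S') = fst S \<union> (+) (snd S) ` fst S'"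
  by (auto simp: wedge_def split: prod.splits)

lemma wedge_assoc: "wedge (wedge S S') S'' = wedge S (wedge S' S'')"
  by (auto simp: prod_eq_iff image_image image_Un add.assoc)

lemma wedge_unit:
  assumes "S \<in> Ob Nec"
  shows "wedge ({0}, 0) S = S" and "wedge S ({0}, 0) = S"
  using assms by (auto simp: prod_eq_iff Ob_Nec_iff)

text \<open>The gluing point is a joint of both factors, hence a bead of neither, and every other
  vertex belongs to exactly one factor.\<close>

lemma missing_wedge:
  assumes S: "S \<in> Ob Nec" and S': "S' \<in> Ob Nec"
  shows "missing (wedge S S') = missing S \<union> (+) (snd S) ` missing S'"
proof -
  have "x \<in> missing (wedge S S') \<longleftrightarrow> x \<in> missing S \<union> (+) (snd S) ` missing S'" for x
  proof (cases "x \<le> snd S")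
    case True
    then show ?thesis
      using S S' by (auto simp: missing_def Ob_Nec_iff image_iff)
  next
    case False
    then obtain y where y: "x = snd S + y" "0 < y"
      by (metis add_0_right le_add_diff_inverse less_imp_le not_le zero_less_diff)
    then show ?thesis
      using S S' by (auto simp: missing_def Ob_Nec_iff image_iff)
  qed
  then show ?thesis by blast
qed

lemma missing_bounds: "S \<in> Ob Nec \<Longrightarrow> v \<in> missing S \<Longrightarrow> 0 < v \<and> v < snd S"
  by (cases v; cases "v = snd S") (auto simp: missing_def Ob_Nec_iff)

text \<open>Beads are interior vertices, so those of \<open>S\<close> all precede the shifted ones
  of \<open>S'\<close>: coordinates of a wedge are concatenated without reordering.\<close>

lemma beads_wedge:
  assumes S: "S \<in> Ob Nec" and S': "S' \<in> Ob Nec"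
  shows "beads (wedge S S') = beads S @ map ((+) (snd S)) (beads S')"
proof -
  let ?l = "beads S @ map ((+) (snd S)) (beads S')"
  have "sorted_wrt (<) ?l"
    using missing_bounds[OF S] missing_bounds[OF S']
    by (force simp: sorted_wrt_append sorted_wrt_map)
  moreover have "set ?l = missing (wedge S S')"
    by (simp add: missing_wedge[OF S S'])
  ultimately show ?thesis
    by (metis finite_missing sorted_list_of_set.idem_if_sorted_distinct strict_sorted_iff)
qed

lemma card_missing_wedge:
  assumes "S \<in> Ob Nec" and "S' \<in> Ob Nec"
  shows "card (missing (wedge S S')) = card (missing S) + card (missing S')"
  using arg_cong[OF beads_wedge[OF assms], of length] by simp

lemma nec_encode_wedge:
  assumes S: "S \<in> Ob Nec" and S': "S' \<in> Ob Nec" and V: "V \<subseteq> {..snd S}"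
  shows "nec_encode (wedge S S') (V \<union> (+) (snd S) ` V') = nec_encode S V @ nec_encode S' V'"
  using V missing_bounds[OF S] missing_bounds[OF S']
  by (force simp: nec_encode_def beads_wedge[OF S S'])

lemma nec_decode_wedge:
  assumes S: "S \<in> Ob Nec" and S': "S' \<in> Ob Nec"
    and len: "length xs = card (missing S)" "length ys = card (missing S')"
  shows "nec_decode (wedge S S') (xs @ ys) = nec_decode S xs \<union> (+) (snd S) ` nec_decode S' ys"
    (is "_ = ?V \<union> ?V'")
proof -
  have b: "fst S \<subseteq> ?V" "?V \<subseteq> {..snd S}" "fst S' \<subseteq> nec_decode S' ys" "nec_decode S' ys \<subseteq> {..snd S'}"
    using nec_decode_bounds[OF S] nec_decode_bounds[OF S'] by auto
  have "xs @ ys = nec_encode (wedge S S') (?V \<union> ?V')"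
    by (simp add: nec_encode_wedge[OF S S' b(2)] nec_encode_decode len)
  moreover have "fst (wedge S S') \<subseteq> ?V \<union> ?V'" "?V \<union> ?V' \<subseteq> {..snd (wedge S S')}"
    using b by auto
  ultimately show ?thesis by (metis nec_decode_encode)
qed

lemma TA_Nec_image:
  assumes f: "f \<in> nec_hom S S'" and g: "g \<in> nec_hom Z Z'"
    and V: "V \<subseteq> {..snd S}" and V': "V' \<subseteq> {..snd Z}"
  shows "TA Nec S S' Z Z' f g ` (V \<union> (+) (snd S) ` V') = f ` V \<union> (+) (snd S') ` g ` V'"
proof -
  have "TA Nec S S' Z Z' f g v = f v" if "v \<in> V" for v
    using that V by (auto simp: TA_Nec)
  \<comment> \<open>For \<open>v = 0\<close> the definition takes the branch of \<open>f\<close>;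
    the branches agree there because \<open>f\<close> ends at \<open>snd S'\<close> and
    \<open>g\<close> starts at 0.\<close>
  moreover have "TA Nec S S' Z Z' f g (snd S + v) = snd S' + g v" if "v \<in> V'" for v
    using that V' nec_homD(4)[OF f] nec_homD(3)[OF g] by (auto simp: TA_Nec)
  ultimately show ?thesis
    by (force simp: image_Un image_image)
qed

text \<open>Images commute with unions, so the image of a vertex set of a wedge is computed
  separately on the two factors.\<close>

lemma nec_dim_TA:
  assumes S: "S \<in> Ob Nec" "S' \<in> Ob Nec" "Z \<in> Ob Nec" "Z' \<in> Ob Nec"
    and f: "f \<in> nec_hom S S'" and g: "g \<in> nec_hom Z Z'"
  shows "Fa nec_dim (wedge S Z) (wedge S' Z') (TA Nec S S' Z Z' f g) =
    TA box (card (missing S)) (card (missing S')) (card (missing Z)) (card (missing Z'))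
      (Fa nec_dim S S' f) (Fa nec_dim Z Z' g)"
proof -
  have "Fa nec_dim (wedge S Z) (wedge S' Z') (TA Nec S S' Z Z' f g) (xs @ ys) =
     Fa nec_dim S S' f xs @ Fa nec_dim Z Z' g ys"
    if len: "length xs = card (missing S)" "length ys = card (missing Z)" for xs ys
  proof -
    have b: "nec_decode S xs \<subseteq> {..snd S}" "nec_decode Z ys \<subseteq> {..snd Z}"
      using nec_decode_bounds S by auto
    then have "f ` nec_decode S xs \<subseteq> {..snd S'}"
      using nec_homD(1)[OF f] by auto
    then show ?thesis
      using S len b
      by (simp add: nec_dim_apply card_missing_wedge nec_decode_wedge TA_Nec_image[OF f g]
        nec_encode_wedge)
  qed
  then have "(\<lambda>xs\<in>cube (card (missing S) + card (missing Z)).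
      Fa nec_dim (wedge S Z) (wedge S' Z') (TA Nec S S' Z Z' f g) xs) =
    TA box (card (missing S)) (card (missing S')) (card (missing Z)) (card (missing Z'))
      (Fa nec_dim S S' f) (Fa nec_dim Z Z' g)"
    unfolding TA_box by (intro cube_map_append_eqI) simp
  moreover have "Fa nec_dim (wedge S Z) (wedge S' Z') (TA Nec S S' Z Z' f g) =
    (\<lambda>xs\<in>cube (card (missing S) + card (missing Z)).
      Fa nec_dim (wedge S Z) (wedge S' Z') (TA Nec S S' Z Z' f g) xs)"
    using S by (auto simp: nec_dim_def card_missing_wedge restrict_def)
  ultimately show ?thesis by metis
qed

section \<open>The diagram of a strong monoidal functor on the cube category\<close>

lemma functorD:
  assumes "is_functor C D F"
  shows "\<And>X. X \<in> Ob C \<Longrightarrow> Fo F X \<in> Ob D"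
    and "\<And>X Y f. X \<in> Ob C \<Longrightarrow> Y \<in> Ob C \<Longrightarrow> f \<in> Hom C X Y \<Longrightarrow> Fa F X Y f \<in> Hom D (Fo F X) (Fo F Y)"
    and "\<And>X. X \<in> Ob C \<Longrightarrow> Fa F X X (Idn C X) = Idn D (Fo F X)"
    and "\<And>X Y Z f g. X \<in> Ob C \<Longrightarrow> Y \<in> Ob C \<Longrightarrow> Z \<in> Ob C \<Longrightarrow> f \<in> Hom C X Y \<Longrightarrow> g \<in> Hom C Y Z \<Longrightarrow>
      Fa F X Z (Comp C X Y Z g f) = Comp D (Fo F X) (Fo F Y) (Fo F Z) (Fa F Y Z g) (Fa F X Y f)"
  using assms by (auto simp: is_functor_def)

lemma strong_monoidal_functorD:
  assumes "strong_monoidal_functor C D F"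
  shows "is_functor C D F"
    and "iso_arrow D (Unit D) (Fo F (Unit C)) (Eps F)"
    and "\<And>X Y. X \<in> Ob C \<Longrightarrow> Y \<in> Ob C \<Longrightarrow>
      iso_arrow D (TO D (Fo F X) (Fo F Y)) (Fo F (TO C X Y)) (Mu F X Y)"
    and "\<And>X X' Y Y' f g. X \<in> Ob C \<Longrightarrow> X' \<in> Ob C \<Longrightarrow> Y \<in> Ob C \<Longrightarrow> Y' \<in> Ob C \<Longrightarrow>
      f \<in> Hom C X X' \<Longrightarrow> g \<in> Hom C Y Y' \<Longrightarrow>
      Comp D (TO D (Fo F X) (Fo F Y)) (TO D (Fo F X') (Fo F Y')) (Fo F (TO C X' Y'))
        (Mu F X' Y')
        (TA D (Fo F X) (Fo F X') (Fo F Y) (Fo F Y') (Fa F X X' f) (Fa F Y Y' g)) =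
      Comp D (TO D (Fo F X) (Fo F Y)) (Fo F (TO C X Y)) (Fo F (TO C X' Y'))
        (Fa F (TO C X Y) (TO C X' Y') (TA C X X' Y Y' f g)) (Mu F X Y)"
  using assms unfolding strong_monoidal_functor_def by blast+

lemma iso_arrow_Hom: "iso_arrow C X Y f \<Longrightarrow> f \<in> Hom C X Y"
  by (auto simp: iso_arrow_def inverse_arrows_def)

lemma nec_dim_functor: "is_functor Nec box nec_dim"
  unfolding is_functor_def
  by (auto simp del: box_simps(3,4) simp: box_map_nec_dim nec_dim_id nec_dim_comp)
    (simp add: nec_dim_comp)

lemma Nec_TA_Hom:
  assumes S: "S \<in> Ob Nec" "S' \<in> Ob Nec" "Z \<in> Ob Nec" "Z' \<in> Ob Nec"
    and f: "f \<in> nec_hom S S'" and g: "g \<in> nec_hom Z Z'"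
  shows "TA Nec S S' Z Z' f g \<in> nec_hom (wedge S Z) (wedge S' Z')"
proof (rule nec_homI)
  note f' = nec_homD[OF f] and g' = nec_homD[OF g]
  show "TA Nec S S' Z Z' f g \<in> {..snd (wedge S Z)} \<rightarrow>\<^sub>E {..snd (wedge S' Z')}"
    using f'(1) g'(1) by (force simp: TA_Nec PiE_iff extensional_def)
  show "mono_on {..snd (wedge S Z)} (TA Nec S S' Z Z' f g)"
  proof (rule mono_onI)
    fix i j assume "i \<in> {..snd (wedge S Z)}" "j \<in> {..snd (wedge S Z)}" "i \<le> j"
    then show "TA Nec S S' Z Z' f g i \<le> TA Nec S S' Z Z' f g j"
      using monotone_onD[OF f'(2), of i j] monotone_onD[OF g'(2), of "i - snd S" "j - snd S"]
        PiE_mem[OF f'(1), of i]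
      by (auto simp: TA_Nec)
  qed
  show "TA Nec S S' Z Z' f g 0 = 0" using f'(3) by (simp add: TA_Nec)
  show "TA Nec S S' Z Z' f g (snd (wedge S Z)) = snd (wedge S' Z')"
    using f'(4) g'(3,4) by (cases "snd Z") (auto simp: TA_Nec)
  show "fst (wedge S' Z') \<subseteq> TA Nec S S' Z Z' f g ` fst (wedge S Z)"
    using TA_Nec_image[OF f g, of "fst S" "fst Z"] S f'(5) g'(5) by (auto simp: Ob_Nec_iff)
qed

text \<open>The necklace functor to the cubes is strictly monoidal, so that composing with it does not
  change the structure maps.\<close>

lemma monoidal_functor_comp_nec_dim:
  assumes W: "monoidal_category W" and H: "strong_monoidal_functor box W H"
  defines "D \<equiv> monoidal_functor_comp W box Nec H nec_dim"
  shows "Fo D S = Fo H (card (missing S))"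
    and "Fa D S S' f = Fa H (card (missing S)) (card (missing S')) (Fa nec_dim S S' f)"
    and "Eps D = Eps H"
    and "S \<in> Ob Nec \<Longrightarrow> S' \<in> Ob Nec \<Longrightarrow> Mu D S S' = Mu H (card (missing S)) (card (missing S'))"
proof -
  note H' = strong_monoidal_functorD[OF H] and cat = monoidal_category_cat[OF W]
  note fH = functorD[OF H'(1), simplified]
  show "Fo D S = Fo H (card (missing S))"
    and "Fa D S S' f = Fa H (card (missing S)) (card (missing S')) (Fa nec_dim S S' f)"
    by (simp_all add: D_def monoidal_functor_comp_def)
  have "missing ({0}, 0) = {}" by (auto simp: missing_def)
  then show "Eps D = Eps H"
    using iso_arrow_Hom[OF H'(2)] fH(3)[of 0]
    by (simp add: D_def monoidal_functor_comp_def cat_id_comp cat fH(1) monoidal_Unit[OF W])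
  show "Mu D S S' = Mu H (card (missing S)) (card (missing S'))" if "S \<in> Ob Nec" "S' \<in> Ob Nec"
    using that iso_arrow_Hom[OF H'(3), of "card (missing S)" "card (missing S')"]
      fH(3)[of "card (missing S) + card (missing S')"]
    by (simp add: D_def monoidal_functor_comp_def cat_id_comp cat fH(1) monoidal_TO[OF W]
      card_missing_wedge)
qed

text \<open>Each axiom is the axiom for \<open>H\<close> at the dimensions of the necklaces. The
  associator and unitors of \<open>Nec\<close> are identities, which dim sends to identity maps of
  cubes, and these are the associator and unitors of \<open>box\<close>.\<close>

lemma strong_monoidal_nec:
  assumes W: "monoidal_category W" and H: "strong_monoidal_functor box W H"
  shows "strong_monoidal_functor Nec W (monoidal_functor_comp W box Nec H nec_dim)"
proof -
  note H' = strong_monoidal_functorD[OF H] and cat = monoidal_category_cat[OF W]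
  note fH = functorD[OF H'(1), simplified]
  note fd = functorD[OF nec_dim_functor]
  define D where "D = monoidal_functor_comp W box Nec H nec_dim"
  note D = monoidal_functor_comp_nec_dim[OF W H, folded D_def]
  have zero: "missing ({0}, 0) = {}" by (auto simp: missing_def)
  have unit: "({0}, 0) \<in> Ob Nec" by (simp add: Ob_Nec_iff)
  have fct: "is_functor Nec W D"
    unfolding is_functor_def
    using fH fd by (simp add: D nec_dim_id nec_dim_comp box_map_nec_dim del: box_simps(4) add: box_simps(4)[symmetric])
  have Mu_nat: "Comp W (TO W (Fo D X) (Fo D Y)) (TO W (Fo D X') (Fo D Y')) (Fo D (TO Nec X' Y'))
        (Mu D X' Y')
        (TA W (Fo D X) (Fo D X') (Fo D Y) (Fo D Y') (Fa D X X' f) (Fa D Y Y' g)) =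
      Comp W (TO W (Fo D X) (Fo D Y)) (Fo D (TO Nec X Y)) (Fo D (TO Nec X' Y'))
        (Fa D (TO Nec X Y) (TO Nec X' Y') (TA Nec X X' Y Y' f g)) (Mu D X Y)"
    if "X \<in> Ob Nec" "X' \<in> Ob Nec" "Y \<in> Ob Nec" "Y' \<in> Ob Nec"
      "f \<in> Hom Nec X X'" "g \<in> Hom Nec Y Y'" for X X' Y Y' f g
    using that H'(4)[of "card (missing X)" "card (missing X')" "card (missing Y)" "card (missing Y')"
        "Fa nec_dim X X' f" "Fa nec_dim Y Y' g"]
    by (simp add: D box_map_nec_dim card_missing_wedge nec_dim_TA)
  have assoc: "Fa D (wedge (wedge X Y) Z) (wedge X (wedge Y Z)) (nec_id (wedge (wedge X Y) Z)) =
     Fa H (card (missing X) + card (missing Y) + card (missing Z))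
      (card (missing X) + (card (missing Y) + card (missing Z)))
      (Assoc box (card (missing X)) (card (missing Y)) (card (missing Z)))"
    if "X \<in> Ob Nec" "Y \<in> Ob Nec" "Z \<in> Ob Nec" for X Y Z
    using that nec_dim_id[of "wedge X (wedge Y Z)"]
    by (simp add: D wedge_assoc card_missing_wedge wedge_Ob add.assoc del: restrict_apply)
  have units: "Fa D X X (nec_id X) = Fa H (card (missing X)) (card (missing X)) (LUnit box (card (missing X)))"
    "Fa D X X (nec_id X) = Fa H (card (missing X)) (card (missing X)) (RUnit box (card (missing X)))"
    if "X \<in> Ob Nec" for X
    using that nec_dim_id[of X] by (simp_all add: D del: restrict_apply)
  show ?thesis
    unfolding strong_monoidal_functor_def D_def[symmetric]
  proof (intro conjI ballI Mu_nat fct)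
    show "iso_arrow W (Unit W) (Fo D (Unit Nec)) (Eps D)"
      using H'(2) by (simp add: D zero)
    show "iso_arrow W (TO W (Fo D X) (Fo D Y)) (Fo D (TO Nec X Y)) (Mu D X Y)"
      if "X \<in> Ob Nec" "Y \<in> Ob Nec" for X Y
      using that H'(3) by (simp add: D card_missing_wedge)
  next
    fix X Y Z assume "X \<in> Ob Nec" "Y \<in> Ob Nec" "Z \<in> Ob Nec"
    then show "Comp W (TO W (TO W (Fo D X) (Fo D Y)) (Fo D Z)) (Fo D (TO Nec (TO Nec X Y) Z))
          (Fo D (TO Nec X (TO Nec Y Z)))
        (Fa D (TO Nec (TO Nec X Y) Z) (TO Nec X (TO Nec Y Z)) (Assoc Nec X Y Z))
        (Comp W (TO W (TO W (Fo D X) (Fo D Y)) (Fo D Z)) (TO W (Fo D (TO Nec X Y)) (Fo D Z))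
            (Fo D (TO Nec (TO Nec X Y) Z))
          (Mu D (TO Nec X Y) Z)
          (TA W (TO W (Fo D X) (Fo D Y)) (Fo D (TO Nec X Y)) (Fo D Z) (Fo D Z)
            (Mu D X Y) (Idn W (Fo D Z)))) =
      Comp W (TO W (TO W (Fo D X) (Fo D Y)) (Fo D Z)) (TO W (Fo D X) (TO W (Fo D Y) (Fo D Z)))
          (Fo D (TO Nec X (TO Nec Y Z)))
        (Comp W (TO W (Fo D X) (TO W (Fo D Y) (Fo D Z))) (TO W (Fo D X) (Fo D (TO Nec Y Z)))
            (Fo D (TO Nec X (TO Nec Y Z)))
          (Mu D X (TO Nec Y Z))
          (TA W (Fo D X) (Fo D X) (TO W (Fo D Y) (Fo D Z)) (Fo D (TO Nec Y Z))
            (Idn W (Fo D X)) (Mu D Y Z)))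
        (Assoc W (Fo D X) (Fo D Y) (Fo D Z))"
      using H
      by (simp add: assoc) (simp add: D card_missing_wedge wedge_Ob strong_monoidal_functor_def)
  next
    fix X assume "X \<in> Ob Nec"
    then show "Comp W (TO W (Unit W) (Fo D X)) (Fo D (TO Nec (Unit Nec) X)) (Fo D X)
        (Fa D (TO Nec (Unit Nec) X) X (LUnit Nec X))
        (Comp W (TO W (Unit W) (Fo D X)) (TO W (Fo D (Unit Nec)) (Fo D X)) (Fo D (TO Nec (Unit Nec) X))
          (Mu D (Unit Nec) X)
          (TA W (Unit W) (Fo D (Unit Nec)) (Fo D X) (Fo D X) (Eps D) (Idn W (Fo D X)))) =
      LUnit W (Fo D X)"
      using H by (simp add: wedge_unit units(1) del: box_simps(8))
        (simp add: D zero unit strong_monoidal_functor_def del: box_simps(8))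
  next
    fix X assume "X \<in> Ob Nec"
    then show "Comp W (TO W (Fo D X) (Unit W)) (Fo D (TO Nec X (Unit Nec))) (Fo D X)
        (Fa D (TO Nec X (Unit Nec)) X (RUnit Nec X))
        (Comp W (TO W (Fo D X) (Unit W)) (TO W (Fo D X) (Fo D (Unit Nec))) (Fo D (TO Nec X (Unit Nec)))
          (Mu D X (Unit Nec))
          (TA W (Fo D X) (Fo D X) (Unit W) (Fo D (Unit Nec)) (Idn W (Fo D X)) (Eps D))) =
      RUnit W (Fo D X)"
      using H by (simp add: wedge_unit units(2) del: box_simps(9))
        (simp add: D zero unit strong_monoidal_functor_def del: box_simps(9))
  qed
qed

section \<open>The cosimplicial enriched category of a necklace diagram\<close>

lemma is_initial_the_arrow:
  assumes "is_initial C X" "Y \<in> Ob C"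
  shows "the_arrow C X Y \<in> Hom C X Y" and "f \<in> Hom C X Y \<Longrightarrow> f = the_arrow C X Y"
proof -
  have ex1: "\<exists>!f. f \<in> Hom C X Y" using assms by (simp add: is_initial_def)
  then show *: "the_arrow C X Y \<in> Hom C X Y" unfolding the_arrow_def by (rule theI')
  show "f = the_arrow C X Y" if "f \<in> Hom C X Y" using ex1 * that by blast
qed

lemma is_initial_eq: "is_initial C X \<Longrightarrow> Y \<in> Ob C \<Longrightarrow> f \<in> Hom C X Y \<Longrightarrow> g \<in> Hom C X Y \<Longrightarrow> f = g"
  by (auto simp: is_initial_def)

lemma colimit_empty_diagram: "colimit J C F X \<iota> \<Longrightarrow> Ob J = {} \<Longrightarrow> is_initial C X"
  by (auto simp: colimit_def cocone_def is_initial_def)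

text \<open>An initial object is a colimit of the empty diagram. Tensoring with \<open>X\<close> on
  either side preserves this colimit, so the result is again initial.\<close>

lemma cocomplete_initial:
  assumes "cocomplete TYPE('u) W" and "tensor_preserves_colimits TYPE('u) W"
  shows "is_initial W (initial_ob W)"
    and "X \<in> Ob W \<Longrightarrow> is_initial W (TO W X (initial_ob W))"
    and "X \<in> Ob W \<Longrightarrow> is_initial W (TO W (initial_ob W) X)"
proof -
  define J :: "('u, 'u) cat" where "J = \<lparr>Ob = {}, Hom = undefined, Comp = undefined, Idn = undefined\<rparr>"
  have J: "category J" "Ob J = {}" by (simp_all add: J_def category_def)
  have F: "is_functor J W F" for F :: "('u, 'u, 'a, 'b) functr" by (simp add: J_def is_functor_def)
  \<comment> \<open>Anything is a functor on the category without objects, so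
    \<open>undefined\<close> serves as the diagram.\<close>
  obtain Z and \<iota> :: "'u \<Rightarrow> 'b" where "colimit J W undefined Z \<iota>"
    using assms(1)[unfolded cocomplete_def, rule_format, of J undefined] J(1) F by auto
  then have "is_initial W Z" using J(2) by (rule colimit_empty_diagram)
  then show init: "is_initial W (initial_ob W)"
    unfolding initial_ob_def by (rule someI)
  have "colimit J W F (initial_ob W) \<iota>" for F \<iota>
    using init by (auto simp: colimit_def cocone_def J_def is_initial_def)
  then have col: "colimit J W (functor_comp G F) (Fo G (initial_ob W)) (\<lambda>j. Fa G (Fo F j) (initial_ob W) (\<iota> j))"
    if "preserves_colimits TYPE('u) W W G" for G F \<iota>
    using that[unfolded preserves_colimits_def, rule_format, of J F "initial_ob W" \<iota>] J(1) F by simp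
  have *: "is_initial W (Fo G (initial_ob W))" if "preserves_colimits TYPE('u) W W G" for G
    by (rule colimit_empty_diagram[OF col[OF that] J(2)])
  show "is_initial W (TO W X (initial_ob W))" "is_initial W (TO W (initial_ob W) X)" if "X \<in> Ob W"
    using *[of "tensor_left W X"] *[of "tensor_right W X"] assms(2) that
    by (simp_all add: tensor_preserves_colimits_def tensor_left_def tensor_right_def)
qed

lemma simplex_Ob [simp]: "simplex n \<in> Ob Nec"
  by (auto simp: Ob_Nec_iff simplex_def)

lemma snd_simplex [simp]: "snd (simplex n) = n" and fst_simplex [simp]: "fst (simplex n) = {0, n}"
  by (simp_all add: simplex_def)

text \<open>The map of simplices induced by \<open>f\<close> from the interval between
  \<open>i\<close> and \<open>j\<close> to that between \<open>f i\<close> and \<open>f j\<close>,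
  both translated to start at 0.\<close>

definition segment :: "(nat \<Rightarrow> nat) \<Rightarrow> nat \<Rightarrow> nat \<Rightarrow> nat \<Rightarrow> nat" where
  "segment f i j = (\<lambda>k\<in>{..j - i}. f (k + i) - f i)"

lemma DeltaD:
  assumes "f \<in> Hom Delta m n"
  shows "\<And>i. i \<le> m \<Longrightarrow> f i \<le> n" and "\<And>i j. i \<le> j \<Longrightarrow> j \<le> m \<Longrightarrow> f i \<le> f j"
    and "f \<in> extensional {..m}"
  using assms by (auto simp: Delta_def mono_on_def PiE_iff)

lemma segment_Hom:
  assumes f: "f \<in> Hom Delta m n" and ij: "i \<le> j" "j \<le> m"
  shows "segment f i j \<in> nec_hom (simplex (j - i)) (simplex (f j - f i))"
proof (rule nec_homI)
  show "segment f i j \<in> {..snd (simplex (j - i))} \<rightarrow>\<^sub>E {..snd (simplex (f j - f i))}"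
    using DeltaD(2)[OF f] ij by (auto simp: segment_def intro!: diff_le_mono)
  show "mono_on {..snd (simplex (j - i))} (segment f i j)"
    using DeltaD(2)[OF f] ij by (auto simp: segment_def mono_on_def intro!: diff_le_mono)
  show "fst (simplex (f j - f i)) \<subseteq> segment f i j ` fst (simplex (j - i))"
    using ij by (auto simp: segment_def)
qed (use ij in \<open>simp_all add: segment_def\<close>)

text \<open>A necklace map may forget joints of its source but not create new ones, so the identity
  on vertices maps the wedge to the simplex and, for positive \<open>a\<close> and \<open>b\<close>,
  not conversely.\<close>

lemma split_Hom: "(\<lambda>l\<in>{..a + b}. l) \<in> nec_hom (wedge (simplex a) (simplex b)) (simplex (a + b))"
  by (rule nec_homI) (auto simp: mono_on_def)

lemma segment_id: "i \<le> j \<Longrightarrow> j \<le> n \<Longrightarrow> segment (Idn Delta n) i j = nec_id (simplex (j - i))"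
  by (auto simp: segment_def Delta_def nec_id_def fun_eq_iff)

lemma segment_comp:
  assumes f: "f \<in> Hom Delta m n" and ij: "i \<le> j" "j \<le> m"
  shows "segment (Comp Delta m n p g f) i j = compose {..j - i} (segment g (f i) (f j)) (segment f i j)"
  using DeltaD(2)[OF f] ij
  by (auto simp: segment_def Delta_def compose_def fun_eq_iff diff_le_mono)

text \<open>Forgetting the joint and then applying \<open>f\<close> equals applying \<open>f\<close>
  on both pieces and then forgetting the image joint. Through \<open>D\<close> this becomes
  compatibility of \<open>Phi W D\<close> with composition.\<close>

lemma segment_split:
  assumes f: "f \<in> Hom Delta m n" and ijk: "i \<le> j" "j \<le> k" "k \<le> m"
  shows "compose {..k - i} (segment f i k) (\<lambda>l\<in>{..k - i}. l) =
    compose {..k - i} (\<lambda>l\<in>{..f k - f i}. l)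
      (TA Nec (simplex (j - i)) (simplex (f j - f i)) (simplex (k - j)) (simplex (f k - f j))
        (segment f i j) (segment f j k))"
proof (rule extensionalityI[where A = "{..k - i}"])
  fix l assume l: "l \<in> {..k - i}"
  have m: "f i \<le> f j" "f j \<le> f k" "f (l + i) \<le> f k" using DeltaD(2)[OF f] ijk l by auto
  show "compose {..k - i} (segment f i k) (\<lambda>l\<in>{..k - i}. l) l =
    compose {..k - i} (\<lambda>l\<in>{..f k - f i}. l)
      (TA Nec (simplex (j - i)) (simplex (f j - f i)) (simplex (k - j)) (simplex (f k - f j))
        (segment f i j) (segment f j k)) l"
  proof (cases "l \<le> j - i")
    case True
    then show ?thesis
      using l ijk m by (auto simp: compose_def segment_def TA_Nec diff_le_mono)
  next
    case False
    then have "l - (j - i) + j = l + i" "l - (j - i) \<le> k - j" "f j \<le> f (l + i)"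
      using l ijk DeltaD(2)[OF f] by auto
    then show ?thesis
      using False l ijk m by (auto simp: compose_def segment_def TA_Nec)
  qed
qed (simp_all add: compose_def)

text \<open>The colimit hypotheses appear in the form in which they act, as initiality, which keeps
  the type of small sets out of the locale.\<close>

locale necklace_diagram =
  fixes W :: "('o, 'a) moncat" and D :: "(necklace, nat \<Rightarrow> nat, 'o, 'a) mfunctr"
  assumes W: "monoidal_category W" and D: "strong_monoidal_functor Nec W D"
    and initial: "is_initial W (initial_ob W)"
      "\<And>X. X \<in> Ob W \<Longrightarrow> is_initial W (TO W X (initial_ob W))"
      "\<And>X. X \<in> Ob W \<Longrightarrow> is_initial W (TO W (initial_ob W) X)"
begin

lemmas W_rules = monoidal_rules[OF W] and D_fun = functorD[OF strong_monoidal_functorD(1)[OF D], simplified]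

lemma initial_Ob [simp]: "initial_ob W \<in> Ob W"
  using initial(1) by (simp add: is_initial_def)

definition "h i j = (if i \<le> j then Fo D (simplex (j - i)) else initial_ob W)" for i j :: nat

text \<open>The composition of \<open>Phi W D\<close> for consecutive intervals of lengths
  \<open>a\<close> and \<open>b\<close>.\<close>

definition "split_arrow a b =
  Comp W (TO W (Fo D (simplex a)) (Fo D (simplex b))) (Fo D (wedge (simplex a) (simplex b)))
      (Fo D (simplex (a + b)))
    (Fa D (wedge (simplex a) (simplex b)) (simplex (a + b)) (\<lambda>l\<in>{..a + b}. l))
    (Mu D (simplex a) (simplex b))"

lemma h_Ob [simp]: "h i j \<in> Ob W"
  by (simp add: h_def D_fun)

lemma Mu_Hom: "X \<in> Ob Nec \<Longrightarrow> Y \<in> Ob Nec \<Longrightarrow>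
    Mu D X Y \<in> Hom W (TO W (Fo D X) (Fo D Y)) (Fo D (wedge X Y))"
  using iso_arrow_Hom[OF strong_monoidal_functorD(3)[OF D]] by simp

lemma split_arrow_Hom:
  "split_arrow a b \<in> Hom W (TO W (Fo D (simplex a)) (Fo D (simplex b))) (Fo D (simplex (a + b)))"
  unfolding split_arrow_def
  by (intro cat_comp W_rules Mu_Hom D_fun split_Hom wedge_Ob simplex_Ob)

lemma Phi_Ob:
  "EOb (Fo (Phi W D) n) = {..n}" "EHom (Fo (Phi W D) n) = h" "EId (Fo (Phi W D) n) i = Eps D"
  by (auto simp: Phi_def h_def fun_eq_iff)

lemma Phi_cmp:
  "i \<le> j \<Longrightarrow> j \<le> k \<Longrightarrow> ECmp (Fo (Phi W D) n) i j k = split_arrow (j - i) (k - j)"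
  "\<not> (i \<le> j \<and> j \<le> k) \<Longrightarrow> ECmp (Fo (Phi W D) n) i j k = the_arrow W (TO W (h i j) (h j k)) (h i k)"
  by (auto simp: Phi_def h_def split_arrow_def)

lemma Phi_Fa:
  "EFo (Fa (Phi W D) m n f) = f"
  "i \<le> j \<Longrightarrow> j \<le> m \<Longrightarrow> EFa (Fa (Phi W D) m n f) i j =
    Fa D (simplex (j - i)) (simplex (f j - f i)) (segment f i j)"
  "j < i \<Longrightarrow> i \<le> m \<Longrightarrow> EFa (Fa (Phi W D) m n f) i j = the_arrow W (h i j) (h (f i) (f j))"
  by (auto simp: Phi_def h_def segment_def)

lemma initial_h: "j < i \<Longrightarrow> is_initial W (h i j)"
  using initial(1) by (simp add: h_def)

lemma initial_TO_h: "\<not> (i \<le> j \<and> j \<le> k) \<Longrightarrow> is_initial W (TO W (h i j) (h j k))"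
  by (cases "i \<le> j") (auto simp: h_def D_fun intro: initial)

lemma Phi_typed: "enriched_typed W (Fo (Phi W D) n)"
  unfolding enriched_typed_def Phi_Ob
proof (intro conjI ballI)
  fix i j k assume "i \<in> {..n}" "j \<in> {..n}" "k \<in> {..n}"
  show "ECmp (Fo (Phi W D) n) i j k \<in> Hom W (TO W (h i j) (h j k)) (h i k)"
  proof (cases "i \<le> j \<and> j \<le> k")
    case True
    then show ?thesis using split_arrow_Hom[of "j - i" "k - j"] by (simp add: Phi_cmp h_def)
  next
    case False
    then show ?thesis
      using is_initial_the_arrow(1)[OF initial_TO_h[OF False]] by (simp add: Phi_cmp)
  qed
next
  fix i
  show "Eps D \<in> Hom W (Unit W) (h i i)"
    using iso_arrow_Hom[OF strong_monoidal_functorD(2)[OF D]] by (simp add: h_def simplex_def)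
qed simp

text \<open>Compatibility with composition combines \<open>segment_split\<close> with naturality of
  \<open>Mu D\<close>. It carries content only for \<open>i \<le> j \<le> k\<close>; otherwise both
  sides are arrows out of an initial object.\<close>

lemma Phi_enriched_functor:
  assumes f: "f \<in> Hom Delta m n"
  shows "enriched_functor W (Fo (Phi W D) m) (Fo (Phi W D) n) (Fa (Phi W D) m n f)"
proof (rule enriched_functorI, unfold Phi_Ob Phi_Fa(1))
  note mono = DeltaD(2)[OF f]
  show "f i \<in> {..n}" if "i \<in> {..m}" for i using that DeltaD(1)[OF f] by simp
  show hom: "EFa (Fa (Phi W D) m n f) i j \<in> Hom W (h i j) (h (f i) (f j))"
    if "i \<in> {..m}" "j \<in> {..m}" for i j
  proof (cases "i \<le> j")
    case True
    then show ?thesis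
      using that D_fun(2)[OF simplex_Ob simplex_Ob segment_Hom[OF f True]] mono
      by (simp add: Phi_Fa h_def)
  next
    case False
    then show ?thesis
      using that is_initial_the_arrow(1)[OF initial_h] by (simp add: Phi_Fa)
  qed
  show "Comp W (Unit W) (h i i) (h (f i) (f i)) (EFa (Fa (Phi W D) m n f) i i) (Eps D) = Eps D"
    if "i \<in> {..m}" for i
  proof -
    have "segment f i i = nec_id (simplex 0)" by (auto simp: segment_def nec_id_def fun_eq_iff)
    then show ?thesis
      using that D_fun(3)[of "simplex 0"] iso_arrow_Hom[OF strong_monoidal_functorD(2)[OF D]]
        cat_id_comp[OF _ _ D_fun(1)[of "simplex 0"]] simplex_Ob[of 0]
      unfolding simplex_def by (simp add: Phi_Fa h_def W_rules simplex_def)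
  qed
  fix i j k assume i: "i \<in> {..m}" and j: "j \<in> {..m}" and k: "k \<in> {..m}"
  let ?A = "EFa (Fa (Phi W D) m n f)"
  let ?l = "Comp W (TO W (h i j) (h j k)) (h i k) (h (f i) (f k)) (?A i k) (ECmp (Fo (Phi W D) m) i j k)"
  let ?r = "Comp W (TO W (h i j) (h j k)) (TO W (h (f i) (f j)) (h (f j) (f k))) (h (f i) (f k))
      (ECmp (Fo (Phi W D) n) (f i) (f j) (f k))
      (TA W (h i j) (h (f i) (f j)) (h j k) (h (f j) (f k)) (?A i j) (?A j k))"
  have fin: "f i \<in> {..n}" "f j \<in> {..n}" "f k \<in> {..n}" using i j k DeltaD(1)[OF f] by auto
  show "?l = ?r"
  proof (cases "i \<le> j \<and> j \<le> k")
    case False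
    have "?l \<in> Hom W (TO W (h i j) (h j k)) (h (f i) (f k))"
      using hom[OF i k] enriched_typedD(2)[OF Phi_typed, unfolded Phi_Ob, OF i j k]
      by (intro cat_comp) (auto intro: W_rules)
    moreover have "?r \<in> Hom W (TO W (h i j) (h j k)) (h (f i) (f k))"
      using hom[OF i j] hom[OF j k] enriched_typedD(2)[OF Phi_typed, unfolded Phi_Ob, OF fin]
      by (intro cat_comp W_rules) auto
    ultimately show ?thesis
      by (rule is_initial_eq[OF initial_TO_h[OF False] h_Ob])
  next
    case True
    let ?a = "j - i" let ?b = "k - j" let ?a' = "f j - f i" let ?b' = "f k - f j"
    let ?X = "TO W (Fo D (simplex ?a)) (Fo D (simplex ?b))"
    let ?Y = "Fo D (wedge (simplex ?a) (simplex ?b))"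
    let ?X' = "TO W (Fo D (simplex ?a')) (Fo D (simplex ?b'))"
    let ?Y' = "Fo D (wedge (simplex ?a') (simplex ?b'))"
    let ?T = "TA Nec (simplex ?a) (simplex ?a') (simplex ?b) (simplex ?b') (segment f i j) (segment f j k)"
    have ijk: "i \<le> j" "j \<le> k" "i \<le> k" "k \<le> m" "j \<le> m" using True k by auto
    have f': "f i \<le> f j" "f j \<le> f k" "f i \<le> f k" using mono ijk by auto
    have [simp]: "?a + ?b = k - i" "?a' + ?b' = f k - f i" using ijk f' by auto
    have seg: "segment f i j \<in> nec_hom (simplex ?a) (simplex ?a')"
      "segment f j k \<in> nec_hom (simplex ?b) (simplex ?b')"
      "segment f i k \<in> nec_hom (simplex (k - i)) (simplex (f k - f i))"
      using segment_Hom[OF f] ijk by auto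
    have T: "?T \<in> nec_hom (wedge (simplex ?a) (simplex ?b)) (wedge (simplex ?a') (simplex ?b'))"
      by (intro Nec_TA_Hom simplex_Ob seg)
    note split = split_Hom[of ?a ?b, simplified] split_Hom[of ?a' ?b', simplified]
    note in_W = W_rules cat_comp D_fun(1,2) Mu_Hom wedge_Ob simplex_Ob seg T split
    have "?l = Comp W ?X ?Y (Fo D (simplex (f k - f i)))
      (Comp W ?Y (Fo D (simplex (k - i))) (Fo D (simplex (f k - f i)))
        (Fa D (simplex (k - i)) (simplex (f k - f i)) (segment f i k))
        (Fa D (wedge (simplex ?a) (simplex ?b)) (simplex (k - i)) (\<lambda>l\<in>{..k - i}. l)))
      (Mu D (simplex ?a) (simplex ?b))"
      using ijk f' by (simp add: Phi_Fa Phi_cmp h_def split_arrow_def in_W cat_assoc)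
    also have "\<dots> = Comp W ?X ?Y (Fo D (simplex (f k - f i)))
      (Fa D (wedge (simplex ?a) (simplex ?b)) (simplex (f k - f i))
        (compose {..k - i} (segment f i k) (\<lambda>l\<in>{..k - i}. l)))
      (Mu D (simplex ?a) (simplex ?b))"
      using D_fun(4)[OF _ _ _ split(1) seg(3)] by (simp add: wedge_Ob)
    also have "\<dots> = Comp W ?X ?Y (Fo D (simplex (f k - f i)))
      (Fa D (wedge (simplex ?a) (simplex ?b)) (simplex (f k - f i))
        (compose {..k - i} (\<lambda>l\<in>{..f k - f i}. l) ?T))
      (Mu D (simplex ?a) (simplex ?b))"
      by (simp only: segment_split[OF f ijk(1,2,4)])
    also have "\<dots> = Comp W ?X ?Y (Fo D (simplex (f k - f i)))
      (Comp W ?Y ?Y' (Fo D (simplex (f k - f i)))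
        (Fa D (wedge (simplex ?a') (simplex ?b')) (simplex (f k - f i)) (\<lambda>l\<in>{..f k - f i}. l))
        (Fa D (wedge (simplex ?a) (simplex ?b)) (wedge (simplex ?a') (simplex ?b')) ?T))
      (Mu D (simplex ?a) (simplex ?b))"
      using D_fun(4)[OF _ _ _ T split(2)] by (simp add: wedge_Ob)
    also have "\<dots> = Comp W ?X ?Y' (Fo D (simplex (f k - f i)))
        (Fa D (wedge (simplex ?a') (simplex ?b')) (simplex (f k - f i)) (\<lambda>l\<in>{..f k - f i}. l))
        (Comp W ?X ?Y ?Y'
          (Fa D (wedge (simplex ?a) (simplex ?b)) (wedge (simplex ?a') (simplex ?b')) ?T)
          (Mu D (simplex ?a) (simplex ?b)))"
      by (simp add: in_W cat_assoc)
    also have "\<dots> = Comp W ?X ?Y' (Fo D (simplex (f k - f i)))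
        (Fa D (wedge (simplex ?a') (simplex ?b')) (simplex (f k - f i)) (\<lambda>l\<in>{..f k - f i}. l))
        (Comp W ?X ?X' ?Y' (Mu D (simplex ?a') (simplex ?b'))
          (TA W (Fo D (simplex ?a)) (Fo D (simplex ?a')) (Fo D (simplex ?b)) (Fo D (simplex ?b'))
          (Fa D (simplex ?a) (simplex ?a') (segment f i j)) (Fa D (simplex ?b) (simplex ?b') (segment f j k))))"
      using strong_monoidal_functorD(4)[OF D, of "simplex ?a" "simplex ?a'" "simplex ?b" "simplex ?b'"
          "segment f i j" "segment f j k"] seg by simp
    also have "\<dots> = ?r"
      using ijk f' by (simp add: Phi_Fa Phi_cmp h_def split_arrow_def in_W cat_assoc)
    finally show ?thesis .
  qed
next
  show "f \<in> extensional {..m}" by (rule DeltaD(3)[OF f])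
qed (auto simp: Phi_def)

lemma Phi_id: "Fa (Phi W D) n n (Idn Delta n) = efun_id W (Fo (Phi W D) n)"
proof (rule efun_eqI[where A = "{..n}"])
  fix i j assume i: "i \<in> {..n}" and j: "j \<in> {..n}"
  have [simp]: "Idn Delta n l = l" if "l \<le> n" for l using that by (simp add: Delta_def)
  show "EFa (Fa (Phi W D) n n (Idn Delta n)) i j = EFa (efun_id W (Fo (Phi W D) n)) i j"
  proof (cases "i \<le> j")
    case True
    then show ?thesis
      using i j D_fun(3)[of "simplex (j - i)"]
      by (simp add: Phi_Fa segment_id efun_id_def Phi_Ob h_def)
  next
    case False
    then show ?thesis
      using i j is_initial_the_arrow(2)[OF initial_h h_Ob, OF _ cat_id, of j i]
      by (simp add: Phi_Fa efun_id_def Phi_Ob W_rules)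
  qed
qed (auto simp: Phi_def efun_id_def Delta_def)

lemma Phi_comp:
  assumes f: "f \<in> Hom Delta m n" and g: "g \<in> Hom Delta n p"
  shows "Fa (Phi W D) m p (Comp Delta m n p g f) =
    efun_comp W (Fo (Phi W D) m) (Fo (Phi W D) n) (Fo (Phi W D) p) (Fa (Phi W D) n p g) (Fa (Phi W D) m n f)"
proof (rule efun_eqI[where A = "{..m}"])
  let ?gf = "Comp Delta m n p g f"
  have gf: "?gf \<in> Hom Delta m p" using f g by (rule Delta_comp)
  fix i j assume i: "i \<in> {..m}" and j: "j \<in> {..m}"
  have [simp]: "?gf l = g (f l)" if "l \<le> m" for l using that by (simp add: Delta_def compose_def)
  have fn: "f i \<le> n" "f j \<le> n" using i j DeltaD(1)[OF f] by auto
  show "EFa (Fa (Phi W D) m p ?gf) i j =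
    EFa (efun_comp W (Fo (Phi W D) m) (Fo (Phi W D) n) (Fo (Phi W D) p)
      (Fa (Phi W D) n p g) (Fa (Phi W D) m n f)) i j"
  proof (cases "i \<le> j")
    case True
    then have "f i \<le> f j" "g (f i) \<le> g (f j)"
      using i j fn DeltaD(2)[OF f] DeltaD(2)[OF g] by auto
    then show ?thesis
      using True i j fn D_fun(4)[OF _ _ _ segment_Hom[OF f True] segment_Hom[OF g]]
      by (simp add: Phi_Fa efun_comp_def Phi_Ob h_def segment_comp[OF f])
  next
    case False
    have "EFa (Fa (Phi W D) m p ?gf) i j \<in> Hom W (h i j) (h (g (f i)) (g (f j)))"
      using enriched_functorD(2)[OF Phi_enriched_functor[OF gf], of i j] i j
      by (simp add: Phi_Ob Phi_Fa)
    moreover have "EFa (efun_comp W (Fo (Phi W D) m) (Fo (Phi W D) n) (Fo (Phi W D) p)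
      (Fa (Phi W D) n p g) (Fa (Phi W D) m n f)) i j \<in> Hom W (h i j) (h (g (f i)) (g (f j)))"
      using enriched_functorD(2)[OF enriched_functor_efun_comp[OF W Phi_typed Phi_typed Phi_typed
        Phi_enriched_functor[OF f] Phi_enriched_functor[OF g]], of i j] i j
      by (simp add: Phi_Ob Phi_Fa efun_comp_def)
    ultimately show ?thesis
      using False by (intro is_initial_eq[OF initial_h h_Ob]) auto
  qed
qed (auto simp: Phi_def efun_comp_def Delta_def compose_def)

lemma nerve_Phi_functor: "is_functor (ECat W) (Psh Delta) (nerve W (Phi W D))"
  by (intro nerve_functor W Phi_typed Phi_enriched_functor Phi_id Phi_comp)

end

section \<open>The cosimplicial object of the cubical nerve\<close>

lemma Wc_hom_le: "i \<le> j \<Longrightarrow> Wc_hom i j = yo (j - i - 1)"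
  and Wc_hom_gr: "j < i \<Longrightarrow> Wc_hom i j = empty_cset"
  by (auto simp: Wc_hom_def)

lemma CSet_simps:
  "Comp CSet X Y Z t s = (\<lambda>k. compose (cells X k) (t k) (s k))"
  "Idn CSet X = (\<lambda>k. \<lambda>x\<in>cells X k. x)" "Hom CSet X Y = psh_hom box X Y"
  "TO CSet = day" "TA CSet = day_map" "Unit CSet = yo 0" "LUnit CSet = day_lunit" "RUnit CSet = day_runit"
  by (simp_all add: CSet_def Psh_def restrict_def)

lemma cells_yo [simp]: "cells (yo n) k = Box ` {\<phi>. box_map k n \<phi>}"
  by (simp add: yo_def)

lemma cells_empty [simp]: "cells empty_cset k = {}"
  by (simp add: empty_cset_def)

lemma Idn_empty_cset: "Idn CSet empty_cset = empty_map"
  by (simp add: CSet_simps empty_map_def)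

lemma Comp_from_empty:
  "(\<And>k. cells X k = {}) \<Longrightarrow> Comp CSet X Y Z t s = empty_map"
  by (simp add: CSet_simps empty_map_def compose_def restrict_def)

lemma yo_map_Box [simp]: "box_map k m \<phi> \<Longrightarrow> yo_map m n u k (Box \<phi>) = Box (compose (cube k) u \<phi>)"
  by (auto simp: yo_map_def)

lemma yo_map_extensional [simp]: "yo_map m n u k \<in> extensional (cells (yo m) k)"
  by (simp add: yo_map_def)

lemma yo_map_id: "yo_map n n (Idn box n) = Idn CSet (yo n)"
proof (rule ext)
  fix k
  show "yo_map n n (Idn box n) k = Idn CSet (yo n) k"
    by (rule extensionalityI[where A = "cells (yo n) k"], rule yo_map_extensional)
      (auto simp: CSet_simps simp del: restrict_apply simp: restrict_apply')
qed

lemma yo_map_comp: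
  assumes u: "box_map m n u" and v: "box_map n p v"
  shows "Comp CSet (yo m) (yo n) (yo p) (yo_map n p v) (yo_map m n u) = yo_map m p (compose (cube m) v u)"
proof (rule ext)
  fix k
  show "Comp CSet (yo m) (yo n) (yo p) (yo_map n p v) (yo_map m n u) k = yo_map m p (compose (cube m) v u) k"
  proof (rule extensionalityI[where A = "cells (yo m) k"])
    fix t assume "t \<in> cells (yo m) k"
    then obtain \<phi> where \<phi>: "t = Box \<phi>" "box_map k m \<phi>" by auto
    have "compose (cube k) v (compose (cube k) u \<phi>) = compose (cube k) (compose (cube m) v u) \<phi>"
      using box_map_length[OF \<phi>(2)] by (auto simp: compose_def fun_eq_iff)
    then show "Comp CSet (yo m) (yo n) (yo p) (yo_map n p v) (yo_map m n u) k t =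
        yo_map m p (compose (cube m) v u) k t"
      using \<phi> u v by (simp add: CSet_simps compose_eq box_map.comp)
  qed (simp_all only: CSet_simps compose_extensional yo_map_extensional)
qed

section \<open>Cube maps assigned by dim to maps of simplices\<close>

lemma missing_simplex: "missing (simplex n) = {1..<n}"
  by (auto simp: missing_def simplex_def)

lemma card_missing_simplex [simp]: "card (missing (simplex n)) = n - 1"
  by (simp add: missing_simplex)

text \<open>Coordinate \<open>l\<close> of the cube is the interior vertex \<open>Suc l\<close>. The
  endpoints of the source go to the endpoints of the target and so contribute to no
  coordinate.\<close>

lemma nec_dim_simplex_apply:
  assumes f: "f \<in> nec_hom (simplex a) (simplex b)" and xs: "length xs = a - 1"
  shows "Fa nec_dim (simplex a) (simplex b) f xs = map (\<lambda>v. \<exists>l<a - 1. xs ! l \<and> f (Suc l) = v) [1..<b]"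
proof -
  have "beads (simplex a) ! l = Suc l" if "l < a - 1" for l
    using that by (simp add: missing_simplex)
  then have "{beads (simplex a) ! l | l. l < a - 1 \<and> xs ! l} = {Suc l | l. l < a - 1 \<and> xs ! l}"
    by (intro Collect_cong) metis
  then have "nec_decode (simplex a) xs = {0, a} \<union> {Suc l | l. l < a - 1 \<and> xs ! l}"
    by (simp add: nec_decode_def)
  then have "v \<in> f ` nec_decode (simplex a) xs \<longleftrightarrow> (\<exists>l<a - 1. xs ! l \<and> f (Suc l) = v)"
    if "0 < v" "v < b" for v
    using that nec_homD(3,4)[OF f] by auto
  then show ?thesis
    using xs by (simp add: nec_dim_apply) (simp add: nec_encode_def missing_simplex)
qed

text \<open>This is dim of a segment. Truncated subtraction gives dimension 0 to both the edge and
  the point, so the dimension \<open>j - i - 1\<close> is right also for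
  \<open>i = j\<close>.\<close>

definition segment_cube :: "(nat \<Rightarrow> nat) \<Rightarrow> nat \<Rightarrow> nat \<Rightarrow> bool list \<Rightarrow> bool list" where
  "segment_cube f i j = Fa nec_dim (simplex (j - i)) (simplex (f j - f i)) (segment f i j)"

lemma box_map_segment_cube:
  "\<lbrakk>f \<in> Hom Delta m n; i \<le> j; j \<le> m\<rbrakk> \<Longrightarrow> box_map (j - i - 1) (f j - f i - 1) (segment_cube f i j)"
  using box_map_nec_dim[OF simplex_Ob segment_Hom, of f m n i j] by (simp add: segment_cube_def)

text \<open>Reduces the identification of a cube map to single coordinates: output \<open>p\<close>
  must be the disjunction of the inputs whose vertices go to the vertex
  \<open>Suc p\<close>.\<close>

lemma segment_cube_eqI:
  assumes f: "f \<in> Hom Delta m n" and ij: "i \<le> j" "j \<le> m"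
    and g: "box_map (j - i - 1) (f j - f i - 1) g"
    and eq: "\<And>xs p. length xs = j - i - 1 \<Longrightarrow> p < f j - f i - 1 \<Longrightarrow>
      g xs ! p = (\<exists>l<j - i - 1. xs ! l \<and> f (Suc l + i) - f i = Suc p)"
  shows "segment_cube f i j = g"
proof (rule box_map_eqI[OF box_map_segment_cube[OF f ij] g])
  fix xs :: "bool list" assume xs: "length xs = j - i - 1"
  show "segment_cube f i j xs = g xs"
  proof (rule nth_equalityI)
    show "length (segment_cube f i j xs) = length (g xs)"
      using box_map_length[OF g xs] box_map_length[OF box_map_segment_cube[OF f ij] xs] by simp
    fix p assume "p < length (segment_cube f i j xs)"
    then have p: "p < f j - f i - 1"
      using box_map_length[OF box_map_segment_cube[OF f ij] xs] by simp
    have "segment f i j (Suc l) = f (Suc l + i) - f i" if "l < j - i - 1" for l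
    proof -
      have "Suc l \<le> j - i" using that by simp
      then show ?thesis by (simp add: segment_def)
    qed
    then have "(\<exists>l<j - i - 1. xs ! l \<and> segment f i j (Suc l) = Suc p) \<longleftrightarrow>
        (\<exists>l<j - i - 1. xs ! l \<and> f (Suc l + i) - f i = Suc p)"
      by auto
    then show "segment_cube f i j xs ! p = g xs ! p"
      using p eq[OF xs p] nec_dim_simplex_apply[OF segment_Hom[OF f ij] xs]
      by (simp add: segment_cube_def)
  qed
qed

text \<open>A map that is a translation on the interval induces the identity of the cube. The last
  assumption admits a shift forward or a shift back by one, which is what cofaces and codegeneracies
  do, and keeps the truncated subtractions exact.\<close>

lemma segment_cube_id:
  assumes f: "f \<in> Hom Delta m n" and ij: "i \<le> j" "j \<le> m"
    and shift: "\<And>l. i \<le> l \<Longrightarrow> l \<le> j \<Longrightarrow> f l = l + f i - i" and "i \<le> f i \<or> f i = i - 1 \<and> 0 < i"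
  shows "segment_cube f i j = Idn box (j - i - 1)"
proof -
  have "f (l + i) - f i = l" if "l \<le> j - i" for l
    using shift[of "l + i"] that ij assms(5) by auto
  then have "segment f i j = nec_id (simplex (j - i))" "f j - f i = j - i"
    using shift[of j] ij assms(5) by (auto simp: segment_def nec_id_def restrict_def)
  then show ?thesis
    using nec_dim_id[of "simplex (j - i)"] by (simp add: segment_cube_def del: restrict_apply)
qed

lemma segment_cube_trivial:
  assumes f: "f \<in> Hom Delta m n" and ij: "i \<le> j" "j \<le> m" and "j - i \<le> 1" "f j - f i \<le> 1"
  shows "segment_cube f i j = Idn box 0"
  by (rule segment_cube_eqI[OF f ij]) (use assms box_map.ident[of 0] in auto)

lemma Delta_face_Hom: "k \<le> Suc n \<Longrightarrow> Delta_face k n \<in> Hom Delta n (Suc n)"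
  by (auto simp: Delta_face_def Delta_def mono_on_def)

lemma Delta_degen_Hom: "k \<le> n \<Longrightarrow> Delta_degen k n \<in> Hom Delta (Suc n) n"
  by (auto simp: Delta_degen_def Delta_def mono_on_def)

lemma ex_less_conj_eq:
  fixes q :: nat
  assumes "\<And>l. l < N \<Longrightarrow> Q l \<longleftrightarrow> l = q" "q < N"
  shows "(\<exists>l<N. P l \<and> Q l) \<longleftrightarrow> P q"
  using assms by blast

text \<open>The vertex \<open>k\<close> is missed by the coface, so its coordinate is an empty
  disjunction, constantly \<open>False\<close>. Coordinates before it keep their index and those
  after it move up by one.\<close>

lemma segment_cube_face:
  assumes k: "k \<le> Suc n" and ij: "i < k" "k \<le> j" "j \<le> n"
  shows "segment_cube (Delta_face k n) i j = box_face False (k - i) (j - i - 1)"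
proof (rule segment_cube_eqI[OF Delta_face_Hom[OF k]])
  have f: "Delta_face k n i = i" "Delta_face k n j = Suc j" using ij by (auto simp: Delta_face_def)
  show "box_map (j - i - 1) (Delta_face k n j - Delta_face k n i - 1) (box_face False (k - i) (j - i - 1))"
  proof -
    have "Suc (j - i - 1) = Suc j - i - 1" using ij by simp
    then show ?thesis
      using box_map.face[of "k - i" "j - i - 1" False] ij unfolding f by simp
  qed
  fix xs :: "bool list" and p
  assume xs: "length xs = j - i - 1" and p: "p < Delta_face k n j - Delta_face k n i - 1"
  have step: "Delta_face k n (Suc (l + i)) - Delta_face k n i = Suc p \<longleftrightarrow>
      (if Suc (l + i) < k then l = p else Suc l = p)" if "l < j - i - 1" for l
  proof -
    have "Suc (l + i) \<le> n" using that ij by simp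
    then show ?thesis using f(1) by (simp add: Delta_face_def Suc_diff_le)
  qed
  consider "Suc p + i < k" | "Suc p + i = k" | "k < Suc p + i" by linarith
  then show "box_face False (k - i) (j - i - 1) xs ! p =
    (\<exists>l<j - i - 1. xs ! l \<and> Delta_face k n (Suc l + i) - Delta_face k n i = Suc p)"
  proof cases
    case 1
    have "(\<exists>l<j - i - 1. xs ! l \<and> Delta_face k n (Suc l + i) - Delta_face k n i = Suc p) \<longleftrightarrow> xs ! p"
      by (rule ex_less_conj_eq) (use 1 ij in \<open>auto simp: step\<close>)
    moreover have "p < k - i - 1" using 1 by simp
    ultimately show ?thesis
      using 1 ij xs by (simp add: box_face_def nth_append)
  next
    case 2
    have "\<not> (\<exists>l<j - i - 1. xs ! l \<and> Delta_face k n (Suc l + i) - Delta_face k n i = Suc p)"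
      using 2 step by (auto split: if_splits)
    moreover have "k - i - 1 = p" "p \<le> j - i - 1" using 2 ij by auto
    ultimately show ?thesis
      using ij xs by (simp add: box_face_def nth_append)
  next
    case 3
    then obtain q where q: "p = Suc q" "k \<le> Suc (q + i)" using ij by (cases p) auto
    have "q < j - i - 1" using q(1) p f by simp
    then have "(\<exists>l<j - i - 1. xs ! l \<and> Delta_face k n (Suc l + i) - Delta_face k n i = Suc p) \<longleftrightarrow> xs ! q"
      by (intro ex_less_conj_eq) (use q(2) in \<open>auto simp: step[unfolded q(1)] q(1)\<close>)
    then have "(\<exists>l<j - i - 1. xs ! l \<and> Delta_face k n (Suc l + i) - Delta_face k n i = Suc p) \<longleftrightarrow> xs ! (p - 1)"
      using q(1) by simp
    moreover have "p = (k - i - 1) + Suc (p - (k - i))" "k - i - 1 \<le> j - i - 1" using 3 ij by auto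
    ultimately show ?thesis
      using 3 ij xs by (auto simp: box_face_def nth_append min_def)
  qed
qed (use ij in auto)

text \<open>The codegeneracy merges the vertex \<open>k + 1\<close> with the left endpoint
  \<open>k\<close>, so the first coordinate is lost.\<close>

lemma segment_cube_degen_left:
  assumes ij: "k + 1 < j" "j \<le> Suc n"
  shows "segment_cube (Delta_degen k n) k j = box_degen 1 (j - k - 2)"
proof (rule segment_cube_eqI[OF Delta_degen_Hom])
  have f: "Delta_degen k n k = k" "Delta_degen k n j = j - 1" using ij by (auto simp: Delta_degen_def)
  have j: "j - k - 1 = Suc (j - k - 2)" "j - 1 - k - 1 = j - k - 2" using ij by auto
  show "box_map (j - k - 1) (Delta_degen k n j - Delta_degen k n k - 1) (box_degen 1 (j - k - 2))"
    using box_map.degen[of 1 "j - k - 2"] unfolding f j by simp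
  fix xs :: "bool list" and p
  assume xs: "length xs = j - k - 1" and p: "p < Delta_degen k n j - Delta_degen k n k - 1"
  have "(\<exists>l<j - k - 1. xs ! l \<and> Delta_degen k n (Suc l + k) - Delta_degen k n k = Suc p) \<longleftrightarrow> xs ! Suc p"
  proof (rule ex_less_conj_eq)
    fix l assume "l < j - k - 1"
    then have "Suc (l + k) \<le> Suc n" using ij by simp
    then show "Delta_degen k n (Suc l + k) - Delta_degen k n k = Suc p \<longleftrightarrow> l = Suc p"
      using f(1) by (simp add: Delta_degen_def)
  qed (use p f in simp)
  then show "box_degen 1 (j - k - 2) xs ! p =
    (\<exists>l<j - k - 1. xs ! l \<and> Delta_degen k n (Suc l + k) - Delta_degen k n k = Suc p)"
    using p f xs j(1) by (simp add: box_degen_def)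
qed (use ij in auto)

text \<open>The last interior vertex \<open>k\<close> is merged with the right endpoint
  \<open>k + 1\<close>, so the last coordinate is lost.\<close>

lemma segment_cube_degen_right:
  assumes ij: "i < k" "k \<le> n"
  shows "segment_cube (Delta_degen k n) i (Suc k) = box_degen (k - i) (k - i - 1)"
proof (rule segment_cube_eqI[OF Delta_degen_Hom])
  have f: "Delta_degen k n i = i" "Delta_degen k n (Suc k) = k" using ij by (auto simp: Delta_degen_def)
  have j: "Suc k - i - 1 = Suc (k - i - 1)" "Suc (k - i - 1) = k - i" using ij by auto
  show "box_map (Suc k - i - 1) (Delta_degen k n (Suc k) - Delta_degen k n i - 1) (box_degen (k - i) (k - i - 1))"
    using box_map.degen[of "k - i" "k - i - 1"] ij unfolding f j(1) by simp
  fix xs :: "bool list" and p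
  assume xs: "length xs = Suc k - i - 1" and p: "p < Delta_degen k n (Suc k) - Delta_degen k n i - 1"
  have "(\<exists>l<Suc k - i - 1. xs ! l \<and> Delta_degen k n (Suc l + i) - Delta_degen k n i = Suc p) \<longleftrightarrow> xs ! p"
  proof (rule ex_less_conj_eq)
    fix l assume "l < Suc k - i - 1"
    then have "Suc (l + i) \<le> k" by simp
    then show "Delta_degen k n (Suc l + i) - Delta_degen k n i = Suc p \<longleftrightarrow> l = p"
      using f(1) ij by (simp add: Delta_degen_def)
  qed (use p f in simp)
  then show "box_degen (k - i) (k - i - 1) xs ! p =
    (\<exists>l<Suc k - i - 1. xs ! l \<and> Delta_degen k n (Suc l + i) - Delta_degen k n i = Suc p)"
    using p f xs j(2) by (simp add: box_degen_def nth_append)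
qed (use ij in auto)

text \<open>Both \<open>k\<close> and \<open>k + 1\<close> are interior and have the same image,
  which belongs to the image of a vertex set iff one of them is selected: their coordinates are
  joined by a maximum.\<close>

lemma segment_cube_degen_conn:
  assumes ij: "i < k" "k + 1 < j" "j \<le> Suc n"
  shows "segment_cube (Delta_degen k n) i j = box_conn (k - i) (j - i - 2)"
proof (rule segment_cube_eqI[OF Delta_degen_Hom])
  have f: "Delta_degen k n i = i" "Delta_degen k n j = j - 1" using ij by (auto simp: Delta_degen_def)
  have j: "j - i - 1 = Suc (j - i - 2)" "j - 1 - i - 1 = j - i - 2" using ij by auto
  show "box_map (j - i - 1) (Delta_degen k n j - Delta_degen k n i - 1) (box_conn (k - i) (j - i - 2))"
    using box_map.conn[of "k - i" "j - i - 2"] ij unfolding f j by simp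
  fix xs :: "bool list" and p
  assume xs: "length xs = j - i - 1" and p: "p < Delta_degen k n j - Delta_degen k n i - 1"
  have step: "Delta_degen k n (Suc (l + i)) - Delta_degen k n i = Suc p \<longleftrightarrow>
      (if Suc (l + i) \<le> k then l = p else l = Suc p)" if "l < j - i - 1" for l
  proof -
    have "Suc (l + i) \<le> Suc n" using that ij by simp
    then show ?thesis using f(1) by (simp add: Delta_degen_def)
  qed
  have pj: "p < j - i - 1" "Suc p < j - i - 1" using p f ij by auto
  consider "Suc p + i < k" | "Suc p + i = k" | "k < Suc p + i" by linarith
  then show "box_conn (k - i) (j - i - 2) xs ! p =
    (\<exists>l<j - i - 1. xs ! l \<and> Delta_degen k n (Suc l + i) - Delta_degen k n i = Suc p)"
  proof cases
    case 1
    have "(\<exists>l<j - i - 1. xs ! l \<and> Delta_degen k n (Suc l + i) - Delta_degen k n i = Suc p) \<longleftrightarrow> xs ! p"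
      by (rule ex_less_conj_eq) (use 1 pj in \<open>auto simp: step\<close>)
    moreover have "p < k - i - 1" using 1 by simp
    ultimately show ?thesis
      using 1 ij xs j(1) by (simp add: box_conn_def nth_append)
  next
    case 2
    have "Delta_degen k n (Suc l + i) - Delta_degen k n i = Suc p \<longleftrightarrow> l = p \<or> l = Suc p"
      if "l < j - i - 1" for l
      using 2 step[OF that] by auto
    then have "(\<exists>l<j - i - 1. xs ! l \<and> Delta_degen k n (Suc l + i) - Delta_degen k n i = Suc p) \<longleftrightarrow>
        xs ! p \<or> xs ! Suc p"
      using pj by blast
    moreover have "k - i - 1 = p" "k - i = Suc p" using 2 by auto
    ultimately show ?thesis
      using xs j(1) pj by (auto simp: box_conn_def nth_append max_def)
  next
    case 3
    have "(\<exists>l<j - i - 1. xs ! l \<and> Delta_degen k n (Suc l + i) - Delta_degen k n i = Suc p) \<longleftrightarrow> xs ! Suc p"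
      by (rule ex_less_conj_eq) (use 3 pj in \<open>auto simp: step\<close>)
    moreover have "\<not> p < k - i - 1" "p - (k - i - 1) = Suc (p + i - k)" using 3 ij by auto
    moreover have "drop (Suc (k - i)) xs ! (p + i - k) = xs ! Suc p"
      using 3 ij xs by (subst nth_drop) (auto intro: arg_cong[where f = "(!) xs"])
    ultimately show ?thesis
      using xs j(1) pj by (simp add: box_conn_def nth_append min_def)
  qed
qed (use ij in auto)

text \<open>The value of \<open>Wc\<close> at an arbitrary monotone map in closed form, as
  \<open>Wc_Fa\<close> will confirm.\<close>

definition Wc_fun :: "nat \<Rightarrow> (nat \<Rightarrow> nat) \<Rightarrow> (nat, nat, 'a cmap) efun" where
  "Wc_fun m f =
    \<lparr>EFo = f,
     EFa = (\<lambda>i\<in>{..m}. \<lambda>j\<in>{..m}.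
       if i \<le> j then yo_map (j - i - 1) (f j - f i - 1) (segment_cube f i j) else empty_map)\<rparr>"

lemma Wc_fun_id: "efun_id CSet (Wc_ob n) = Wc_fun n (Idn Delta n)"
proof (rule efun_eqI[where A = "{..n}"])
  fix i j assume i: "i \<in> {..n}" and j: "j \<in> {..n}"
  have "Idn Delta n l = l" if "l \<le> n" for l using that by (simp add: Delta_def)
  then show "EFa (efun_id CSet (Wc_ob n)) i j = EFa (Wc_fun n (Idn Delta n)) i j"
    using i j segment_cube_id[OF Delta_id, of i j n]
    by (auto simp: efun_id_def Wc_fun_def Wc_ob_def Wc_hom_le Wc_hom_gr Idn_empty_cset yo_map_id simp del: box_simps)
qed (auto simp: efun_id_def Wc_fun_def Wc_ob_def Delta_def)

lemma Wc_fun_face: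
  assumes k: "k \<le> Suc n"
  shows "Wc_face k n = Wc_fun n (Delta_face k n)"
proof (rule efun_eqI[where A = "{..n}"])
  fix i j assume i: "i \<in> {..n}" and j: "j \<in> {..n}"
  note f = Delta_face_Hom[OF k]
  show "EFa (Wc_face k n) i j = EFa (Wc_fun n (Delta_face k n)) i j"
  proof (cases "i < k \<and> k \<le> j")
    case True
    then show ?thesis
      using i j segment_cube_face[OF k, of i j]
      by (simp add: Wc_face_def Wc_fun_def Delta_face_def[THEN fun_cong])
  next
    case False
    have "segment_cube (Delta_face k n) i j = Idn box (j - i - 1)" if "i \<le> j"
      using that i j False by (intro segment_cube_id[OF f]) (auto simp: Delta_face_def)
    moreover have "Delta_face k n j - Delta_face k n i = j - i"
      using i j False by (auto simp: Delta_face_def)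
    ultimately show ?thesis
      using i j False
      by (auto simp: Wc_face_def Wc_fun_def Wc_hom_le Wc_hom_gr Idn_empty_cset yo_map_id simp del: box_simps)
  qed
qed (auto simp: Wc_face_def Wc_fun_def Delta_face_def)

lemma Wc_fun_degen:
  assumes k: "k \<le> n"
  shows "Wc_degen k n = Wc_fun (Suc n) (Delta_degen k n)"
proof (rule efun_eqI[where A = "{..Suc n}"])
  fix i j assume i: "i \<in> {..Suc n}" and j: "j \<in> {..Suc n}"
  note f = Delta_degen_Hom[OF k]
  consider "k = i" "i + 1 < j" | "i < k" "k + 1 < j" | "i < k" "j = Suc k" | "k = i" "i \<le> j" "j \<le> i + 1"
    | "i \<le> j" "k < i \<or> j \<le> k" "k \<noteq> i" | "j < i"
    by linarith
  then show "EFa (Wc_degen k n) i j = EFa (Wc_fun (Suc n) (Delta_degen k n)) i j"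
  proof cases
    case 1
    then show ?thesis
      using i j segment_cube_degen_left[of k j n]
      by (simp add: Wc_degen_def Wc_fun_def) (simp add: Delta_degen_def numeral_2_eq_2)
  next
    case 2
    then show ?thesis
      using i j segment_cube_degen_conn[of i k j n]
      by (simp add: Wc_degen_def Wc_fun_def) (simp add: Delta_degen_def numeral_2_eq_2)
  next
    case 3
    then show ?thesis
      using i j segment_cube_degen_right[of i k n]
      by (simp add: Wc_degen_def Wc_fun_def) (simp add: Delta_degen_def numeral_2_eq_2)
  next
    \<comment> \<open>For \<open>j = i + 1\<close> the edge collapses to a point. Both have the cube
      of dimension 0, so the prescribed identity is still the right map.\<close>
    case 4
    then have "segment_cube (Delta_degen k n) i j = Idn box 0"
      using i j by (intro segment_cube_trivial[OF f]) (auto simp: Delta_degen_def)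
    then show ?thesis
      using 4 i j
      by (simp add: Wc_degen_def Wc_fun_def Wc_hom_le yo_map_id del: box_simps)
        (simp add: Delta_degen_def yo_map_id del: box_simps)
  next
    case 5
    have "segment_cube (Delta_degen k n) i j = Idn box (j - i - 1)"
      using 5 i j by (intro segment_cube_id[OF f]) (auto simp: Delta_degen_def)
    moreover have "Delta_degen k n j - Delta_degen k n i = j - i"
      using i j 5 by (auto simp: Delta_degen_def)
    ultimately show ?thesis
      using i j 5
      by (auto simp add: Wc_degen_def Wc_fun_def Wc_hom_le yo_map_id simp del: box_simps)
  next
    case 6
    then have "\<not> (k = i \<and> i + 1 < j)" "\<not> (i < k \<and> k + 1 < j)" "\<not> (i < k \<and> k + 1 = j)" by auto
    then show ?thesis
      using 6 i j by (auto simp: Wc_degen_def Wc_fun_def Wc_hom_gr Idn_empty_cset)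
  qed
qed (auto simp: Wc_degen_def Wc_fun_def Delta_degen_def)

lemma segment_cube_comp:
  assumes f: "f \<in> Hom Delta m n" and g: "g \<in> Hom Delta n p" and ij: "i \<le> j" "j \<le> m"
  shows "segment_cube (Comp Delta m n p g f) i j =
    compose (cube (j - i - 1)) (segment_cube g (f i) (f j)) (segment_cube f i j)"
proof -
  have c: "Comp Delta m n p g f i = g (f i)" "Comp Delta m n p g f j = g (f j)"
    using ij by (auto simp: Delta_def compose_def)
  have "f i \<le> f j" "f j \<le> n" using DeltaD[OF f] ij by auto
  then show ?thesis
    using nec_dim_comp[OF simplex_Ob simplex_Ob segment_Hom[OF f ij] segment_Hom[OF g]]
    by (simp add: segment_cube_def c segment_comp[OF f ij])
qed

text \<open>Functoriality of dim carried over to representables; for \<open>j < i\<close> both sides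
  are the map out of the empty cubical set.\<close>

lemma Wc_fun_comp:
  assumes f: "f \<in> Hom Delta m n" and g: "g \<in> Hom Delta n p"
  shows "efun_comp CSet (Wc_ob m) (Wc_ob n) (Wc_ob p) (Wc_fun n g) (Wc_fun m f) =
    Wc_fun m (Comp Delta m n p g f)"
proof (rule efun_eqI[where A = "{..m}"])
  fix i j assume i: "i \<in> {..m}" and j: "j \<in> {..m}"
  have c: "Comp Delta m n p g f l = g (f l)" if "l \<le> m" for l
    using that by (simp add: Delta_def compose_def)
  have fn: "f i \<le> n" "f j \<le> n" using DeltaD(1)[OF f] i j by auto
  show "EFa (efun_comp CSet (Wc_ob m) (Wc_ob n) (Wc_ob p) (Wc_fun n g) (Wc_fun m f)) i j =
    EFa (Wc_fun m (Comp Delta m n p g f)) i j"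
  proof (cases "i \<le> j")
    case True
    then have le: "f i \<le> f j" "g (f i) \<le> g (f j)"
      using DeltaD(2)[OF f] DeltaD(2)[OF g] i j fn by auto
    then show ?thesis
      using i j True fn segment_cube_comp[OF f g True]
        yo_map_comp[OF box_map_segment_cube[OF f True] box_map_segment_cube[OF g le(1)]]
      by (simp add: efun_comp_def Wc_fun_def Wc_ob_def Wc_hom_le c)
  next
    case False
    then show ?thesis
      using i j by (simp add: efun_comp_def Wc_fun_def Wc_ob_def Wc_hom_gr Comp_from_empty)
  qed
qed (auto simp: efun_comp_def Wc_fun_def Wc_ob_def Delta_def compose_def)

text \<open>Independence of the factorization: whichever composite of generators produces
  \<open>f\<close>, the resulting value is the closed formula at \<open>f\<close>.\<close>

lemma Wc_rel_eq: "Wc_rel m n f F \<Longrightarrow> f \<in> Hom Delta m n \<and> F = Wc_fun m f"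
proof (induction rule: Wc_rel.induct)
  case (comp m n f F p g G)
  then show ?case by (auto simp: Wc_fun_comp Delta_comp)
qed (simp_all add: Delta_id Wc_fun_id Delta_face_Hom Wc_fun_face Delta_degen_Hom Wc_fun_degen)

text \<open>Generation of \<open>Delta\<close> by cofaces and codegeneracies, by induction on
  \<open>m + n\<close>. A map missing a value \<open>k\<close> factors through a coface, a map with
  \<open>f i = f (Suc i)\<close> through a codegeneracy, and a surjection without repetitions is an
  identity.\<close>

lemma Wc_rel_exists: "f \<in> Hom Delta m n \<Longrightarrow> \<exists>F :: (nat, nat, 'a cmap) efun. Wc_rel m n f F"
proof (induction "m + n" arbitrary: m n f rule: less_induct)
  case less
  note f = DeltaD[OF less.prems]
  consider k where "k \<le> n" "k \<notin> f ` {..m}" | "{..n} \<subseteq> f ` {..m}" "\<exists>i<m. f i = f (Suc i)"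
    | "{..n} \<subseteq> f ` {..m}" "\<forall>i<m. f i \<noteq> f (Suc i)"
    by (meson atMost_iff subsetI)
  then show ?case
  proof cases
    case 1
    have k: "f i \<noteq> k" if "i \<le> m" for i using 1(2) that by auto
    have "n \<noteq> 0" using 1(1) k[of 0] f(1)[of 0] by auto
    then obtain n' where n: "n = Suc n'" by (cases n) auto
    define f' where "f' = (\<lambda>i\<in>{..m}. if f i < k then f i else f i - 1)"
    have f': "f' \<in> Hom Delta m n'"
      using f(1,2) 1(1) k by (fastforce simp: Delta_def f'_def mono_on_def n)
    obtain F' :: "(nat, nat, 'a cmap) efun" where "Wc_rel m n' f' F'" using less.hyps[OF _ f'] n by auto
    then have "\<exists>F :: (nat, nat, 'a cmap) efun. Wc_rel m n (Comp Delta m n'  n (Delta_face k n') f') F"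
      using Wc_rel.face[of k n'] 1(1) n by (blast intro: Wc_rel.comp)
    moreover have "Comp Delta m n' n (Delta_face k n') f' = f"
    proof (rule extensionalityI[where A = "{..m}"])
      fix i assume "i \<in> {..m}"
      then show "Comp Delta m n' n (Delta_face k n') f' i = f i"
        using f(1)[of i] k[of i] 1(1) by (auto simp: Delta_def compose_def f'_def Delta_face_def n)
    qed (use f(3) in \<open>auto simp: Delta_def compose_def\<close>)
    ultimately show ?thesis by simp
  next
    case 2
    then obtain i where i: "i < m" "f i = f (Suc i)" by blast
    then obtain m' where m: "m = Suc m'" by (cases m) auto
    define f' where "f' = (\<lambda>j\<in>{..m'}. if j \<le> i then f j else f (Suc j))"
    have f': "f' \<in> Hom Delta m' n"
      using f(1,2) by (auto simp: Delta_def f'_def mono_on_def m)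
    obtain F' :: "(nat, nat, 'a cmap) efun" where "Wc_rel m' n f' F'" using less.hyps[OF _ f'] m by auto
    then have "\<exists>F :: (nat, nat, 'a cmap) efun. Wc_rel m n (Comp Delta m m' n f' (Delta_degen i m')) F"
      using Wc_rel.degen[of i m'] i(1) m by (auto intro: Wc_rel.comp)
    moreover have "Comp Delta m m' n f' (Delta_degen i m') = f"
    proof (rule extensionalityI[where A = "{..m}"])
      fix l assume l: "l \<in> {..m}"
      then consider "l \<le> i" | "l = Suc i" | "Suc i < l" by linarith
      then show "Comp Delta m m' n f' (Delta_degen i m') l = f l"
        using i l by cases (auto simp: Delta_def compose_def f'_def Delta_degen_def m)
    qed (use f(3) in \<open>auto simp: Delta_def compose_def\<close>)
    ultimately show ?thesis by simp
  next
    case 3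
    have step: "f i + d \<le> f (i + d)" if "i + d \<le> m" for i d
      using that
    proof (induction d)
      case (Suc d)
      have "f (i + d) < f (i + Suc d)"
        using 3(2) f(2)[of "i + d" "Suc (i + d)"] Suc.prems by (metis Suc_le_lessD add_Suc_right le_neq_implies_less le_add2 plus_1_eq_Suc)
      then show ?case using Suc by simp
    qed simp
    have "card {..n} \<le> card {..m}"
      using 3(1) by (metis card_image_le card_mono finite_atMost finite_imageI le_trans)
    then have nm: "n \<le> m" by simp
    \<comment> \<open>Growth from 0 to \<open>i\<close> gives \<open>i \<le> f i\<close>; growth
      from \<open>i\<close> to \<open>m\<close>, where \<open>f m \<le> n \<le> m\<close>, gives the
      converse.\<close>
    have fi: "f i = i" if "i \<le> m" for i
      using step[of 0 i] step[of i "m - i"] that nm f(1)[of m] by simp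
    then have "n = m" using f(1)[of m] nm by simp
    moreover have "f = Idn Delta m"
      using f(3) fi by (auto simp: Delta_def fun_eq_iff extensional_def)
    ultimately show ?thesis using Wc_rel.ident by blast
  qed
qed

lemma Wc_Fa: "f \<in> Hom Delta m n \<Longrightarrow> Fa Wc m n f = Wc_fun m f"
  unfolding Wc_def using Wc_rel_exists[of f m n] Wc_rel_eq by (auto intro!: the_equality)

lemma Wc_Fo: "Fo Wc n = Wc_ob n"
  by (simp add: Wc_def)

section \<open>Day convolution\<close>

lemma presheafD:
  assumes "presheaf B X"
  shows "\<And>b b' u x. b \<in> Ob B \<Longrightarrow> b' \<in> Ob B \<Longrightarrow> u \<in> Hom B b b' \<Longrightarrow> x \<in> cells X b' \<Longrightarrow>
      act X b b' u x \<in> cells X b"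
  using assms by (auto simp: presheaf_def)

lemma day_step_terms:
  assumes X: "presheaf box X" and Y: "presheaf box Y" and step: "(t, s) \<in> day_step X Y k"
  shows "t \<in> day_terms X Y k" and "s \<in> day_terms X Y k"
proof -
  from step obtain m m' n n' \<phi> u v x y where
    t: "t = Tens m n \<phi> (act X m m' u x) (act Y n n' v y)"
    and s: "s = Tens m' n' (Comp box k (m + n) (m' + n') (TA box m m' n n' u v) \<phi>) x y"
    and \<phi>: "box_map k (m + n) \<phi>" and uv: "box_map m m' u" "box_map n n' v"
    and x: "x \<in> cells X m'" and y: "y \<in> cells Y n'"
    unfolding day_step_def by auto
  show "t \<in> day_terms X Y k"
    using \<phi> presheafD[OF X _ _ _ x, of m u] presheafD[OF Y _ _ _ y, of n v] uv
    unfolding t day_terms_def by auto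
  have "box_map k (m' + n') (compose (cube k) (TA box m m' n n' u v) \<phi>)"
    by (rule box_map.comp[OF \<phi> box_map_TA[OF uv]])
  then show "s \<in> day_terms X Y k"
    using x y unfolding s day_terms_def by auto
qed

lemma day_class_eq: "(t, day_class X Y k t) \<in> day_eq X Y k"
  unfolding day_class_def by (rule someI[of _ t]) (simp add: day_eq_def)

text \<open>The representative chosen for a class is unknown. A function of terms that is constant
  along generating steps can nevertheless be evaluated on any term of the class.\<close>

lemma day_class_invariant:
  assumes "\<And>t s. (t, s) \<in> day_step X Y k \<Longrightarrow> P t = P s"
  shows "P (day_class X Y k t) = P t"
proof -
  have "P s = P t" if "(t, s) \<in> day_eq X Y k" for s
    using that unfolding day_eq_def
    by (induction rule: rtrancl_induct) (auto dest: assms)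
  then show ?thesis using day_class_eq by blast
qed

lemma day_class_terms:
  assumes "presheaf box X" "presheaf box Y" "t \<in> day_terms X Y k"
  shows "day_class X Y k t \<in> day_terms X Y k"
  \<comment> \<open>Being a term is itself invariant, since both ends of a step are terms.\<close>
  using day_class_invariant[of X Y k "\<lambda>t. t \<in> day_terms X Y k" t] day_step_terms[OF assms(1,2)] assms(3)
  by blast

lemma cells_day: "cells (day X Y) k = day_class X Y k ` day_terms X Y k"
  by (simp add: day_def)

lemma cells_day_subset:
  "presheaf box X \<Longrightarrow> presheaf box Y \<Longrightarrow> cells (day X Y) k \<subseteq> day_terms X Y k"
  by (auto simp: cells_day day_class_terms)

lemma cells_day_empty:
  "(\<And>k. cells X k = {}) \<Longrightarrow> cells (day X Y) k = {}" "(\<And>k. cells Y k = {}) \<Longrightarrow> cells (day X Y) k = {}"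
  by (auto simp: cells_day day_terms_def)

section \<open>Day convolution of representables\<close>

lemma act_yo [simp]: "act (yo n) j k \<psi> (Box \<phi>) = Box (compose (cube j) \<phi> \<psi>)"
  by (simp add: yo_def)

lemma compose_cube_assoc:
  "box_map m n f \<Longrightarrow>
    compose (cube m) (compose (cube n) h g) f = compose (cube m) h (compose (cube m) g f)"
  by (auto simp: compose_def box_map_length fun_eq_iff)

lemma presheaf_yo: "presheaf box (yo n)"
  unfolding presheaf_def
proof (intro conjI ballI)
  fix b x assume "x \<in> cells (yo n) b"
  then show "act (yo n) b b (Idn box b) x = x"
    by (auto simp del: restrict_apply)
qed (auto simp: compose_cube_assoc intro: box_map.comp)

lemma TA_box_comp:
  assumes f: "box_map m m' f" and g: "box_map n n' g"
  shows "TA box m m'' n n'' (compose (cube m) f' f) (compose (cube n) g' g) =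
    compose (cube (m + n)) (TA box m' m'' n' n'' f' g') (TA box m m' n n' f g)"
  using f g by (auto simp: TA_box compose_def box_map_length fun_eq_iff)

lemma TA_box_id: "TA box m m n n (Idn box m) (Idn box n) = Idn box (m + n)"
  by (auto simp: TA_box fun_eq_iff)

lemma cells_day_yo:
  assumes "e \<in> cells (day (yo p) (yo q)) k"
  obtains m n \<phi> x y where "e = Tens m n \<phi> (Box x) (Box y)"
    "box_map k (m + n) \<phi>" "box_map m p x" "box_map n q y"
  using assms cells_day_subset[OF presheaf_yo presheaf_yo, of p q k] by (fastforce simp: day_terms_def)

text \<open>The cube map underlying \<open>day_yo\<close>, defined on all terms and not only on
  chosen representatives, so that invariance under steps can be stated.\<close>

definition day_yo_arrow :: "nat \<Rightarrow> nat \<Rightarrow> nat \<Rightarrow> 'a elt \<Rightarrow> bool list \<Rightarrow> bool list" where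
  "day_yo_arrow p q k e = (case e of
    Tens m n \<phi> (Box x) (Box y) \<Rightarrow> compose (cube k) (TA box m p n q x y) \<phi>)"

lemma day_yo_eq:
  assumes e: "e \<in> cells (day (yo p) (yo q)) k"
  shows "day_yo p q k e = Box (day_yo_arrow p q k e)"
proof -
  from e obtain m n \<phi> x y where "e = Tens m n \<phi> (Box x) (Box y)" by (rule cells_day_yo)
  then show ?thesis using e by (simp add: day_yo_def day_yo_arrow_def)
qed

lemma box_map_day_yo_arrow: "e \<in> cells (day (yo p) (yo q)) k \<Longrightarrow> box_map k (p + q) (day_yo_arrow p q k e)"
  by (erule cells_day_yo) (simp add: day_yo_arrow_def box_map.comp[OF _ box_map_TA])

lemma day_yo_arrow_invariant:
  assumes "(t, s) \<in> day_step (yo p) (yo q) k"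
  shows "day_yo_arrow p q k t = day_yo_arrow p q k s"
proof -
  from assms obtain m m' n n' \<phi> u v x y where
    t: "t = Tens m n \<phi> (act (yo p) m m' u (Box x)) (act (yo q) n n' v (Box y))"
    and s: "s = Tens m' n' (compose (cube k) (TA box m m' n n' u v) \<phi>) (Box x) (Box y)"
    and \<phi>: "box_map k (m + n) \<phi>" and uv: "box_map m m' u" "box_map n n' v"
    unfolding day_step_def by auto
  show ?thesis
    by (simp add: t s day_yo_arrow_def TA_box_comp[OF uv] compose_cube_assoc[OF \<phi>])
qed

text \<open>The class of the term built from identities is the universal element. Since
  \<open>day_yo\<close> sends it to the identity, maps out of \<open>yo (p + q)\<close> can be
  compared after composition with \<open>day_yo p q\<close>.\<close>

lemma day_yo_universal:
  "\<exists>e \<in> cells (day (yo p) (yo q)) (p + q). day_yo_arrow p q (p + q) e = Idn box (p + q)"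
proof
  let ?t = "Tens p q (Idn box (p + q)) (Box (Idn box p)) (Box (Idn box q)) :: 'a elt"
  have "?t \<in> day_terms (yo p) (yo q) (p + q)"
    by (auto simp: day_terms_def intro: box_map.ident)
  then show "day_class (yo p) (yo q) (p + q) ?t \<in> cells (day (yo p) (yo q)) (p + q)"
    by (simp add: cells_day del: box_simps)
  have "day_yo_arrow p q (p + q) (day_class (yo p) (yo q) (p + q) ?t) = day_yo_arrow p q (p + q) ?t"
    by (rule day_class_invariant) (rule day_yo_arrow_invariant)
  also have "\<dots> = compose (cube (p + q)) (Idn box (p + q)) (Idn box (p + q))"
    by (simp add: day_yo_arrow_def TA_box_id del: box_simps)
  also have "\<dots> = Idn box (p + q)"
    by (auto simp: compose_def fun_eq_iff)
  finally show "day_yo_arrow p q (p + q) (day_class (yo p) (yo q) (p + q) ?t) = Idn box (p + q)" .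
qed

text \<open>A map into the cube of dimension 0 outputs no coordinates, so tensoring with it only
  discards inputs, which is what the unitor does.\<close>

lemma day_lunit_yo: "day_lunit (yo q) = day_yo 0 q"
proof (rule ext)
  fix k
  show "(day_lunit (yo q) :: 'a cmap) k = day_yo 0 q k"
  proof (rule extensionalityI[where A = "cells (day (yo 0) (yo q)) k"])
    fix e :: "'a elt" assume e: "e \<in> cells (day (yo 0) (yo q)) k"
    then obtain m n \<phi> x y where *: "e = Tens m n \<phi> (Box x) (Box y)"
      "box_map k (m + n) \<phi>" "box_map m 0 x" "box_map n q y"
      by (rule cells_day_yo)
    have "compose (cube k) y (compose (cube k) (TA box m 0 n n x (Idn box n)) \<phi>) =
      compose (cube k) (TA box m 0 n q x y) \<phi>"
      using box_map_length[OF *(2)] box_map_length[OF *(3)] by (auto simp: compose_def TA_box fun_eq_iff)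
    then show "day_lunit (yo q) k e = day_yo 0 q k e"
      using e * by (simp add: day_lunit_def day_yo_def del: box_simps(4))
  qed (simp_all add: day_lunit_def day_yo_def)
qed

lemma day_runit_yo: "day_runit (yo p) = day_yo p 0"
proof (rule ext)
  fix k
  show "(day_runit (yo p) :: 'a cmap) k = day_yo p 0 k"
  proof (rule extensionalityI[where A = "cells (day (yo p) (yo 0)) k"])
    fix e :: "'a elt" assume e: "e \<in> cells (day (yo p) (yo 0)) k"
    then obtain m n \<phi> x y where *: "e = Tens m n \<phi> (Box x) (Box y)"
      "box_map k (m + n) \<phi>" "box_map m p x" "box_map n 0 y"
      by (rule cells_day_yo)
    have "compose (cube k) x (compose (cube k) (TA box m m n 0 (Idn box m) y) \<phi>) =
      compose (cube k) (TA box m p n 0 x y) \<phi>"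
      using box_map_length[OF *(2)] box_map_length[OF *(4)] by (auto simp: compose_def TA_box fun_eq_iff)
    then show "day_runit (yo p) k e = day_yo p 0 k e"
      using e * by (simp add: day_runit_def day_yo_def del: box_simps(4))
  qed (simp_all add: day_runit_def day_yo_def)
qed

text \<open>What dim assigns to the necklace map that forgets the joint \<open>a\<close>.\<close>

definition split_cube :: "nat \<Rightarrow> nat \<Rightarrow> bool list \<Rightarrow> bool list" where
  "split_cube a b = Fa nec_dim (wedge (simplex a) (simplex b)) (simplex (a + b)) (\<lambda>l\<in>{..a + b}. l)"

lemma card_missing_wedge_simplex [simp]:
  "card (missing (wedge (simplex a) (simplex b))) = (a - 1) + (b - 1)"
  by (simp add: card_missing_wedge)

lemma box_map_split_cube: "box_map (a - 1 + (b - 1)) (a + b - 1) (split_cube a b)"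
  using box_map_nec_dim[OF wedge_Ob[OF simplex_Ob simplex_Ob] split_Hom[of a b]]
  by (simp add: split_cube_def)

lemma split_cube_unit: "split_cube 0 b = Idn box (b - 1)" "split_cube a 0 = Idn box (a - 1)"
proof -
  have "simplex 0 = ({0}, 0)" by (simp add: simplex_def)
  then have w: "wedge (simplex 0) (simplex b) = simplex b" "wedge (simplex a) (simplex 0) = simplex a"
    using wedge_unit[OF simplex_Ob] by simp_all
  have "(\<lambda>l\<in>{..b}. l) = nec_id (simplex b)" for b by (simp add: nec_id_def)
  then show "split_cube 0 b = Idn box (b - 1)" "split_cube a 0 = Idn box (a - 1)"
    using nec_dim_id[OF simplex_Ob] by (simp_all add: split_cube_def w del: restrict_apply)
qed

text \<open>The joint \<open>a\<close> lies in every vertex set of the wedge. In the simplex it is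
  the \<open>a\<close>-th bead, so its coordinate is constantly \<open>True\<close>, while the beads
  of the two pieces keep their values on either side of it.\<close>

lemma split_cube_pos:
  assumes "0 < a" "0 < b"
  shows "split_cube a b = box_face True a (a + b - 2)"
proof (rule box_map_eqI[OF box_map_split_cube])
  have "a - 1 + (b - 1) = a + b - 2" "Suc (a + b - 2) = a + b - 1" using assms by auto
  then show "box_map (a - 1 + (b - 1)) (a + b - 1) (box_face True a (a + b - 2))"
    using box_map.face[of a "a + b - 2" True] assms by simp
  fix xs :: "bool list" assume xs: "length xs = a - 1 + (b - 1)"
  let ?ys = "take (a - 1) xs" let ?zs = "drop (a - 1) xs"
  have len: "length ?ys = card (missing (simplex a))" "length ?zs = card (missing (simplex b))"
    using xs by auto
  let ?V = "nec_decode (simplex a) ?ys" let ?V' = "nec_decode (simplex b) ?zs"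
  have V: "?V \<subseteq> {..a}" "a \<in> ?V" "?V' \<subseteq> {..b}" "0 \<in> ?V'"
    using nec_decode_bounds[OF simplex_Ob, of a ?ys] nec_decode_bounds[OF simplex_Ob, of b ?zs] by auto
  have "nec_decode (wedge (simplex a) (simplex b)) xs = ?V \<union> (+) a ` ?V'"
    using nec_decode_wedge[OF simplex_Ob simplex_Ob len] by simp
  moreover have "(\<lambda>l\<in>{..a + b}. l) ` (?V \<union> (+) a ` ?V') = ?V \<union> (+) a ` ?V'"
    using V by (auto simp: image_iff subset_iff)
  ultimately have "split_cube a b xs = nec_encode (simplex (a + b)) (?V \<union> (+) a ` ?V')"
    using xs by (simp add: split_cube_def nec_dim_apply)
  also have "\<dots> = map (\<lambda>v. v \<in> ?V \<union> (+) a ` ?V') ([1..<a] @ [a] @ map ((+) a) [1..<b])"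
  proof -
    have "[1..<a + b] = [1..<a] @ [a..<a + b]"
      using assms upt_add_eq_append[of 1 a b] by simp
    moreover have "[a..<a + b] = a # map ((+) a) [1..<b]"
      using assms by (intro nth_equalityI) (auto simp: nth_Cons')
    ultimately show ?thesis by (simp add: nec_encode_def missing_simplex)
  qed
  also have "\<dots> = map (\<lambda>v. v \<in> ?V) [1..<a] @ True # map (\<lambda>v. v \<in> ?V') [1..<b]"
    using V by auto
  also have "\<dots> = ?ys @ True # ?zs"
    using nec_encode_decode[OF len(1)] nec_encode_decode[OF len(2)]
    by (simp add: nec_encode_def missing_simplex)
  finally show "split_cube a b xs = box_face True a (a + b - 2) xs"
    using xs assms by (simp add: box_face_def numeral_2_eq_2)
qed

lemma compose_day_yo:
  "(\<lambda>k. compose (cells (day (yo p) (yo q)) k) (Idn CSet (yo (p + q)) k) (day_yo p q k)) = day_yo p q"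
proof (rule ext)
  fix k
  show "compose (cells (day (yo p) (yo q)) k) (Idn CSet (yo (p + q)) k) (day_yo p q k) = day_yo p q k"
    by (rule extensionalityI[where A = "cells (day (yo p) (yo q)) k"])
      (auto simp: compose_eq CSet_simps day_yo_eq box_map_day_yo_arrow, simp_all add: day_yo_def)
qed

text \<open>One formula also covers composition with identities: if \<open>i = j\<close> or
  \<open>j = k\<close>, one factor is the cube of dimension 0, \<open>split_cube\<close> is an
  identity, and the prescribed unitor coincides with \<open>day_yo\<close>.\<close>

lemma Wc_cmp:
  assumes "i \<le> j" "j \<le> k"
  shows "ECmp (Wc_ob n) i j k =
    Comp CSet (day (yo (j - i - 1)) (yo (k - j - 1))) (yo (j - i - 1 + (k - j - 1))) (yo (k - i - 1))
      (yo_map (j - i - 1 + (k - j - 1)) (k - i - 1) (split_cube (j - i) (k - j)))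
      (day_yo (j - i - 1) (k - j - 1))"
proof -
  consider "i < j" "j < k" | "i = j" | "i < j" "j = k" using assms by linarith
  then show ?thesis
  proof cases
    case 1
    then have "j - i - 1 + (k - j - 1) = k - i - 2" "(j - i) + (k - j) = k - i" by auto
    then show ?thesis
      using 1 split_cube_pos[of "j - i" "k - j"] by (simp add: Wc_ob_def)
  next
    case 2
    then show ?thesis
      using assms
      by (simp add: compose_day_yo[of 0, simplified] Wc_ob_def Wc_hom_le CSet_simps(1,7) day_lunit_yo split_cube_unit yo_map_id del: box_simps)
  next
    case 3
    then show ?thesis
      using assms
      by (simp add: compose_day_yo[of _ 0, simplified] Wc_ob_def Wc_hom_le CSet_simps(1,8) day_runit_yo split_cube_unit yo_map_id del: box_simps)
  qed
qed

section \<open>The comparison of the two nerves\<close>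

locale cubical_nerve =
  fixes W :: "('o, 'a) moncat" and H :: "(nat, bool list \<Rightarrow> bool list, 'o, 'a) mfunctr"
  assumes W: "monoidal_category W" and H: "strong_monoidal_functor box W H"
    and initial: "is_initial W (initial_ob W)"
      "\<And>X. X \<in> Ob W \<Longrightarrow> is_initial W (TO W X (initial_ob W))"
      "\<And>X. X \<in> Ob W \<Longrightarrow> is_initial W (TO W (initial_ob W) X)"
begin

abbreviation "D \<equiv> monoidal_functor_comp W box Nec H nec_dim"

sublocale necklace_diagram W D
  by unfold_locales (rule W strong_monoidal_nec[OF W H] initial | assumption)+

lemmas D_simps = monoidal_functor_comp_nec_dim[OF W H]

abbreviation "R \<equiv> Fo (RH W H)"

lemma H_functor: "is_functor box W H"
  by (rule strong_monoidal_functorD(1)[OF H])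

lemma H_Ob [simp]: "Fo H n \<in> Ob W"
  using functorD(1)[OF H_functor] by simp

lemma H_Hom: "box_map m n u \<Longrightarrow> Fa H m n u \<in> Hom W (Fo H m) (Fo H n)"
  using functorD(2)[OF H_functor, of m n u] by simp

lemma H_id: "Fa H n n (Idn box n) = Idn W (Fo H n)"
  by (rule functorD(3)[OF H_functor]) simp

lemma H_comp: "box_map m n u \<Longrightarrow> box_map n k v \<Longrightarrow>
    Fa H m k (compose (cube m) v u) = Comp W (Fo H m) (Fo H n) (Fo H k) (Fa H n k v) (Fa H m n u)"
  using functorD(4)[OF H_functor, of m n k u v] by simp

definition "mu m n = Mu H m n" for m n :: nat
definition "mui m n = inv_arrow W (TO W (Fo H m) (Fo H n)) (Fo H (m + n)) (Mu H m n)" for m n :: nat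

lemma mu: "inverse_arrows W (TO W (Fo H m) (Fo H n)) (Fo H (m + n)) (mu m n) (mui m n)"
  unfolding mu_def mui_def
  using strong_monoidal_functorD(3)[OF H, of m n] by (intro cat_inv_arrow W_rules) simp_all

lemma mu_Hom: "mu m n \<in> Hom W (TO W (Fo H m) (Fo H n)) (Fo H (m + n))"
  and mui_Hom: "mui m n \<in> Hom W (Fo H (m + n)) (TO W (Fo H m) (Fo H n))"
  using mu by (auto simp: inverse_arrows_def)

lemmas in_W = W_rules H_Ob H_Hom mu_Hom mui_Hom cat_comp

text \<open>Naturality of \<open>mu\<close> conjugated by inverses: \<open>mui\<close> after
  \<open>mu\<close> is inserted on the left, and \<open>mu\<close> after \<open>mui\<close> cancels
  on the right.\<close>

lemma mui_natural:
  assumes u: "box_map m m' u" and v: "box_map n n' v"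
  shows "Comp W (Fo H (m + n)) (TO W (Fo H m) (Fo H n)) (TO W (Fo H m') (Fo H n'))
      (TA W (Fo H m) (Fo H m') (Fo H n) (Fo H n') (Fa H m m' u) (Fa H n n' v)) (mui m n) =
    Comp W (Fo H (m + n)) (Fo H (m' + n')) (TO W (Fo H m') (Fo H n'))
      (mui m' n') (Fa H (m + n) (m' + n') (TA box m m' n n' u v))"
    (is "Comp W ?a ?b ?c ?t _ = Comp W ?a ?d ?c _ ?h")
proof -
  have t: "?t \<in> Hom W ?b ?c" and h: "?h \<in> Hom W ?a ?d"
    using u v by (simp_all add: in_W box_map_TA)
  have nat: "Comp W ?b ?c ?d (mu m' n') ?t = Comp W ?b ?a ?d ?h (mu m n)"
    using strong_monoidal_functorD(4)[OF H, of m m' n n' u v] u v by (simp add: mu_def)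
  have "Comp W ?a ?b ?c ?t (mui m n) =
    Comp W ?a ?b ?c (Comp W ?b ?c ?c (Comp W ?c ?d ?c (mui m' n') (mu m' n')) ?t) (mui m n)"
    using t mu[of m' n'] by (simp add: in_W inverse_arrows_def cat_id_comp)
  also have "\<dots> = Comp W ?a ?d ?c (mui m' n') (Comp W ?a ?b ?d (Comp W ?b ?c ?d (mu m' n') ?t) (mui m n))"
    using t by (simp add: in_W cat_assoc)
  also have "\<dots> = Comp W ?a ?d ?c (mui m' n') (Comp W ?a ?b ?d (Comp W ?b ?a ?d ?h (mu m n)) (mui m n))"
    by (simp only: nat)
  also have "\<dots> = Comp W ?a ?d ?c (mui m' n') (Comp W ?a ?a ?d ?h (Comp W ?a ?b ?a (mu m n) (mui m n)))"
    using h by (simp add: in_W cat_assoc)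
  also have "\<dots> = Comp W ?a ?d ?c (mui m' n') ?h"
    using h mu[of m n] by (simp add: in_W inverse_arrows_def cat_comp_id)
  finally show ?thesis .
qed

section \<open>The Yoneda lemma for maps from representables to \<open>R A\<close>\<close>

lemma cells_R [simp]: "cells (R A) n = Atom ` Hom W (Fo H n) A"
  by (simp add: RH_def)

lemma act_R [simp]: "act (R A) m n u (Atom a) = Atom (Comp W (Fo H m) (Fo H n) A a (Fa H m n u))"
  by (simp add: RH_def)

lemma R_map [simp]: "a \<in> Hom W (Fo H n) A \<Longrightarrow> Fa (RH W H) A B f n (Atom a) = Atom (Comp W (Fo H n) A B f a)"
  by (simp add: RH_def Let_def)

lemma presheaf_R: "A \<in> Ob W \<Longrightarrow> presheaf box (R A)"
  unfolding presheaf_def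
  by (auto simp: H_comp in_W cat_assoc cat_comp_id H_id simp del: box_simps(4))

definition yoneda :: "nat \<Rightarrow> 'o \<Rightarrow> 'a \<Rightarrow> 'a cmap" where
  "yoneda n A a = (\<lambda>k. \<lambda>t\<in>cells (yo n) k. case t of
    Box u \<Rightarrow> Atom (Comp W (Fo H k) (Fo H n) A a (Fa H k n u)))"

lemma yoneda_Box [simp]:
  "box_map k n u \<Longrightarrow> yoneda n A a k (Box u) = Atom (Comp W (Fo H k) (Fo H n) A a (Fa H k n u))"
  by (auto simp: yoneda_def)

lemma yoneda_extensional [simp]: "yoneda n A a k \<in> extensional (Box ` {\<phi>. box_map k n \<phi>})"
  by (simp add: yoneda_def)

lemma yoneda_Hom:
  assumes A: "A \<in> Ob W" and a: "a \<in> Hom W (Fo H n) A"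
  shows "yoneda n A a \<in> psh_hom box (yo n) (R A)"
  using a A by (auto simp: psh_hom_def PiE_iff box_map.comp H_comp in_W cat_assoc)

lemma yoneda_ex:
  assumes A: "A \<in> Ob W" and s: "s \<in> psh_hom box (yo n) (R A)"
  shows "\<exists>a \<in> Hom W (Fo H n) A. s = yoneda n A a"
proof -
  have s_in: "s k \<in> Box ` {\<phi>. box_map k n \<phi>} \<rightarrow>\<^sub>E Atom ` Hom W (Fo H k) A" for k
    using s unfolding psh_hom_def by auto
  have "s n (Box (Idn box n)) \<in> Atom ` Hom W (Fo H n) A"
    using s_in[of n] box_map.ident[of n] by auto
  then obtain a where a: "a \<in> Hom W (Fo H n) A" "s n (Box (Idn box n)) = Atom a" by auto
  have "s = yoneda n A a"
  proof (rule psh_hom_eqI[OF s yoneda_Hom[OF A a(1)]])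
    fix k and t :: "'a elt" assume "t \<in> cells (yo n) k"
    then obtain u where u: "t = Box u" "box_map k n u" by auto
    have "\<forall>b\<in>Ob box. \<forall>b'\<in>Ob box. \<forall>v\<in>Hom box b b'. \<forall>x\<in>cells (yo n) b'.
        s b (act (yo n) b b' v x) = act (R A) b b' v (s b' x)"
      using s unfolding psh_hom_def mem_Collect_eq by (rule conjunct2)
    \<comment> \<open>Naturality along \<open>u\<close> at the identity, from which every element of
      the representable arises.\<close>
    from this[rule_format, of k n u "Box (Idn box n)"]
    have "s k (act (yo n) k n u (Box (Idn box n))) = act (R A) k n u (s n (Box (Idn box n)))"
      using u(2) box_map.ident[of n] by simp
    then show "s k t = yoneda n A a k t"
      using u a(2) by (simp del: restrict_apply)
  qed
  then show ?thesis using a(1) by blast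
qed

lemma yoneda_inj:
  assumes A: "A \<in> Ob W" and a: "a \<in> Hom W (Fo H n) A" and b: "b \<in> Hom W (Fo H n) A"
    and eq: "yoneda n A a = yoneda n A b"
  shows "a = b"
proof -
  have "yoneda n A a n (Box (Idn box n)) = yoneda n A b n (Box (Idn box n))" by (simp only: eq)
  then show ?thesis
    using A a b box_map.ident[of n] H_id[of n] by (simp add: cat_comp_id in_W)
qed

lemma yoneda_yo_map:
  assumes A: "A \<in> Ob W" and a: "a \<in> Hom W (Fo H n) A" and u: "box_map m n u"
  shows "Comp CSet (yo m) (yo n) (R A) (yoneda n A a) (yo_map m n u) =
    yoneda m A (Comp W (Fo H m) (Fo H n) A a (Fa H m n u))"
proof (rule ext)
  fix k
  show "Comp CSet (yo m) (yo n) (R A) (yoneda n A a) (yo_map m n u) k =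
    yoneda m A (Comp W (Fo H m) (Fo H n) A a (Fa H m n u)) k"
    by (rule extensionalityI[where A = "cells (yo m) k"])
      (use assms in \<open>auto simp: CSet_simps compose_eq H_comp in_W cat_assoc box_map.comp\<close>)
qed

lemma R_map_yoneda:
  assumes A: "A \<in> Ob W" and B: "B \<in> Ob W" and a: "a \<in> Hom W (Fo H n) A" and f: "f \<in> Hom W A B"
  shows "Comp CSet (yo n) (R A) (R B) (Fa (RH W H) A B f) (yoneda n A a) =
    yoneda n B (Comp W (Fo H n) A B f a)"
proof (rule ext)
  fix k
  show "Comp CSet (yo n) (R A) (R B) (Fa (RH W H) A B f) (yoneda n A a) k =
    yoneda n B (Comp W (Fo H n) A B f a) k"
    by (rule extensionalityI[where A = "cells (yo n) k"])
      (use assms in \<open>auto simp: CSet_simps compose_eq in_W cat_assoc\<close>)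
qed

section \<open>The lax monoidal structure of \<open>R\<close> on terms and on representables\<close>

definition R_mu_arrow :: "'o \<Rightarrow> 'o \<Rightarrow> nat \<Rightarrow> 'a elt \<Rightarrow> 'a" where
  "R_mu_arrow A B k e = (case e of Tens m n \<phi> (Atom a) (Atom b) \<Rightarrow>
    Comp W (Fo H k) (TO W (Fo H m) (Fo H n)) (TO W A B) (TA W (Fo H m) A (Fo H n) B a b)
      (Comp W (Fo H k) (Fo H (m + n)) (TO W (Fo H m) (Fo H n)) (mui m n) (Fa H k (m + n) \<phi>)))"

text \<open>Moving \<open>u\<close> and \<open>v\<close> from the components of a term to its cube
  map is moving them past \<open>mui\<close>, which naturality permits.\<close>

lemma R_mu_arrow_invariant:
  assumes A: "A \<in> Ob W" and B: "B \<in> Ob W" and step: "(t, s) \<in> day_step (R A) (R B) k"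
  shows "R_mu_arrow A B k t = R_mu_arrow A B k s"
proof -
  from step obtain m m' n n' \<phi> u v a b where
    t: "t = Tens m n \<phi> (act (R A) m m' u (Atom a)) (act (R B) n n' v (Atom b))"
    and s: "s = Tens m' n' (compose (cube k) (TA box m m' n n' u v) \<phi>) (Atom a) (Atom b)"
    and \<phi>: "box_map k (m + n) \<phi>" and uv: "box_map m m' u" "box_map n n' v"
    and a: "a \<in> Hom W (Fo H m') A" and b: "b \<in> Hom W (Fo H n') B"
    unfolding day_step_def by auto
  let ?P = "TO W (Fo H m) (Fo H n)" and ?P' = "TO W (Fo H m') (Fo H n')"
  let ?ab = "TA W (Fo H m') A (Fo H n') B a b"
  let ?uv = "TA W (Fo H m) (Fo H m') (Fo H n) (Fo H n') (Fa H m m' u) (Fa H n n' v)"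
  have in1: "?ab \<in> Hom W ?P' (TO W A B)" "?uv \<in> Hom W ?P ?P'"
    using A B a b uv by (simp_all add: in_W)
  have "R_mu_arrow A B k t = Comp W (Fo H k) ?P (TO W A B) (Comp W ?P ?P' (TO W A B) ?ab ?uv)
      (Comp W (Fo H k) (Fo H (m + n)) ?P (mui m n) (Fa H k (m + n) \<phi>))"
    using A B a b uv by (simp add: t R_mu_arrow_def monoidal_TA_comp[OF W] in_W)
  also have "\<dots> = Comp W (Fo H k) ?P' (TO W A B) ?ab (Comp W (Fo H k) (Fo H (m + n)) ?P'
      (Comp W (Fo H (m + n)) ?P ?P' ?uv (mui m n)) (Fa H k (m + n) \<phi>))"
    using A B in1 \<phi> by (simp add: in_W cat_assoc)
  also have "\<dots> = Comp W (Fo H k) ?P' (TO W A B) ?ab (Comp W (Fo H k) (Fo H (m' + n')) ?P'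
      (mui m' n') (Fa H k (m' + n') (compose (cube k) (TA box m m' n n' u v) \<phi>)))"
    using A B in1 \<phi> uv by (simp add: in_W cat_assoc mui_natural H_comp box_map_TA)
  also have "\<dots> = R_mu_arrow A B k s"
    by (simp add: s R_mu_arrow_def)
  finally show ?thesis .
qed

lemma R_mu_eq:
  assumes A: "A \<in> Ob W" and B: "B \<in> Ob W" and t: "t \<in> day_terms (R A) (R B) k"
  shows "Mu (RH W H) A B k (day_class (R A) (R B) k t) = Atom (R_mu_arrow A B k t)"
proof -
  let ?e = "day_class (R A) (R B) k t"
  have e: "?e \<in> cells (day (R A) (R B)) k" using t by (simp add: cells_day)
  have "?e \<in> day_terms (R A) (R B) k"
    by (rule day_class_terms[OF presheaf_R[OF A] presheaf_R[OF B] t])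
  then obtain m n \<phi> a b where "?e = Tens m n \<phi> (Atom a) (Atom b)"
    by (auto simp: day_terms_def)
  then have "Mu (RH W H) A B k ?e = Atom (R_mu_arrow A B k ?e)"
    using e by (simp add: RH_def Let_def R_mu_arrow_def mui_def)
  also have "R_mu_arrow A B k ?e = R_mu_arrow A B k t"
    by (rule day_class_invariant[where P = "R_mu_arrow A B k"]) (rule R_mu_arrow_invariant[OF A B])
  finally show ?thesis .
qed

lemma R_mu_arrow_Hom:
  assumes "A \<in> Ob W" "B \<in> Ob W" "t \<in> day_terms (R A) (R B) k"
  shows "R_mu_arrow A B k t \<in> Hom W (Fo H k) (TO W A B)"
  using assms by (auto simp: day_terms_def R_mu_arrow_def in_W)

text \<open>Under Yoneda, composing the maps classified by \<open>a\<close> and \<open>b\<close> in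
  the base-changed category gives the map classified by
  \<open>c \<circ> (a \<otimes> b) \<circ> mui\<close>. On a term the components \<open>x\<close>
  and \<open>y\<close> are pulled out of the tensor product by bifunctoriality and moved past
  \<open>mui\<close>, where they form the cube map of \<open>day_yo_arrow\<close>.\<close>

lemma R_cmp_yoneda:
  assumes A: "A \<in> Ob W" and B: "B \<in> Ob W" and C: "C \<in> Ob W"
    and a: "a \<in> Hom W (Fo H p) A" and b: "b \<in> Hom W (Fo H q) B" and c: "c \<in> Hom W (TO W A B) C"
  shows "Comp CSet (day (yo p) (yo q)) (day (R A) (R B)) (R C)
      (Comp CSet (day (R A) (R B)) (R (TO W A B)) (R C) (Fa (RH W H) (TO W A B) C c) (Mu (RH W H) A B))
      (day_map (yo p) (R A) (yo q) (R B) (yoneda p A a) (yoneda q B b)) =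
    Comp CSet (day (yo p) (yo q)) (yo (p + q)) (R C)
      (yoneda (p + q) C (Comp W (Fo H (p + q)) (TO W A B) C c
        (Comp W (Fo H (p + q)) (TO W (Fo H p) (Fo H q)) (TO W A B)
          (TA W (Fo H p) A (Fo H q) B a b) (mui p q))))
      (day_yo p q)" (is "?l = ?r")
proof (rule ext)
  fix k
  show "?l k = ?r k"
  proof (rule extensionalityI[where A = "cells (day (yo p) (yo q)) k"])
    fix e :: "'a elt" assume e: "e \<in> cells (day (yo p) (yo q)) k"
    then obtain m n \<phi> x y where e': "e = Tens m n \<phi> (Box x) (Box y)"
      and \<phi>: "box_map k (m + n) \<phi>" and xy: "box_map m p x" "box_map n q y"
      by (rule cells_day_yo)
    let ?ax = "Comp W (Fo H m) (Fo H p) A a (Fa H m p x)" and ?by = "Comp W (Fo H n) (Fo H q) B b (Fa H n q y)"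
    let ?t = "Tens m n \<phi> (Atom ?ax) (Atom ?by)"
    let ?P = "TO W (Fo H m) (Fo H n)" and ?P' = "TO W (Fo H p) (Fo H q)"
    let ?ab = "TA W (Fo H p) A (Fo H q) B a b"
    let ?xy = "TA W (Fo H m) (Fo H p) (Fo H n) (Fo H q) (Fa H m p x) (Fa H n q y)"
    have t: "?t \<in> day_terms (R A) (R B) k"
      using \<phi> A B a b xy by (simp add: day_terms_def in_W)
    have day: "day_map (yo p) (R A) (yo q) (R B) (yoneda p A a) (yoneda q B b) k e = day_class (R A) (R B) k ?t"
      using e xy by (simp add: day_map_def e')
    have in1: "?ab \<in> Hom W ?P' (TO W A B)" "?xy \<in> Hom W ?P ?P'"
      using A B a b xy by (simp_all add: in_W)
    have "R_mu_arrow A B k ?t = Comp W (Fo H k) ?P (TO W A B) (Comp W ?P ?P' (TO W A B) ?ab ?xy)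
        (Comp W (Fo H k) (Fo H (m + n)) ?P (mui m n) (Fa H k (m + n) \<phi>))"
      using A B a b xy by (simp add: R_mu_arrow_def monoidal_TA_comp[OF W] in_W)
    also have "\<dots> = Comp W (Fo H k) ?P' (TO W A B) ?ab (Comp W (Fo H k) (Fo H (m + n)) ?P'
        (Comp W (Fo H (m + n)) ?P ?P' ?xy (mui m n)) (Fa H k (m + n) \<phi>))"
      using A B in1 \<phi> by (simp add: in_W cat_assoc)
    also have "\<dots> = Comp W (Fo H k) ?P' (TO W A B) ?ab (Comp W (Fo H k) (Fo H (p + q)) ?P'
        (mui p q) (Fa H k (p + q) (day_yo_arrow p q k e)))"
      using A B in1 \<phi> xy by (simp add: in_W cat_assoc mui_natural H_comp box_map_TA e' day_yo_arrow_def)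
    finally have mu: "R_mu_arrow A B k ?t = \<dots>" .
    have "?l k e = Atom (Comp W (Fo H k) (TO W A B) C c (R_mu_arrow A B k ?t))"
      using e t by (simp add: CSet_simps(1) compose_eq day R_mu_eq[OF A B t] R_mu_arrow_Hom[OF A B t] cells_day)
    also have "\<dots> = ?r k e"
      using e A B C c in1 box_map_day_yo_arrow[OF e]
      by (simp add: CSet_simps(1) compose_eq day_yo_eq mu in_W cat_assoc)
    finally show "?l k e = ?r k e" .
  qed (simp_all add: CSet_simps(1))
qed

text \<open>Evaluation at the universal element returns the classifying arrow.\<close>

lemma yoneda_day_yo_inj:
  assumes A: "A \<in> Ob W" and a: "a \<in> Hom W (Fo H (p + q)) A" and b: "b \<in> Hom W (Fo H (p + q)) A"
    and eq: "Comp CSet (day (yo p) (yo q)) (yo (p + q)) (R A) (yoneda (p + q) A a) (day_yo p q) =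
      Comp CSet (day (yo p) (yo q)) (yo (p + q)) (R A) (yoneda (p + q) A b) (day_yo p q)"
  shows "a = b"
proof -
  obtain e :: "'a elt" where e: "e \<in> cells (day (yo p) (yo q)) (p + q)"
    and id: "day_yo_arrow p q (p + q) e = Idn box (p + q)"
    using day_yo_universal by blast
  have "Comp CSet (day (yo p) (yo q)) (yo (p + q)) (R A) (yoneda (p + q) A c) (day_yo p q) (p + q) e = Atom c"
    if c: "c \<in> Hom W (Fo H (p + q)) A" for c
    using e id c A box_map.ident[of "p + q"] H_id[of "p + q"]
    by (simp add: CSet_simps(1) compose_eq day_yo_eq cat_comp_id in_W)
  then show ?thesis using a b fun_cong[OF fun_cong[OF eq], of "p + q" e] by simp
qed

text \<open>Associativity of this composite is computed pointwise, from the fact that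
  \<open>day_yo\<close> takes values in \<open>yo (p + q)\<close>.\<close>

lemma Comp_day_yo_assoc:
  "Comp CSet (day (yo p) (yo q)) (yo r) Z t
      (Comp CSet (day (yo p) (yo q)) (yo (p + q)) (yo r) s (day_yo p q)) =
    Comp CSet (day (yo p) (yo q)) (yo (p + q)) Z
      (Comp CSet (yo (p + q)) (yo r) Z t s) (day_yo p q)"
proof (rule ext)
  fix k
  show "Comp CSet (day (yo p) (yo q)) (yo r) Z t
      (Comp CSet (day (yo p) (yo q)) (yo (p + q)) (yo r) s (day_yo p q)) k =
    Comp CSet (day (yo p) (yo q)) (yo (p + q)) Z
      (Comp CSet (yo (p + q)) (yo r) Z t s) (day_yo p q) k"
    by (rule extensionalityI[where A = "cells (day (yo p) (yo q)) k"])
      (simp_all add: CSet_simps(1) compose_eq day_yo_eq box_map_day_yo_arrow)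
qed

text \<open>For \<open>j < i\<close> the arrow \<open>EFa g i j\<close> starts at an initial object
  and carries no information; its counterpart is the only map out of the empty cubical set.\<close>

definition yoneda_efun :: "nat \<Rightarrow> ('x, 'o, 'a) ecat \<Rightarrow> (nat, 'x, 'a) efun \<Rightarrow> (nat, 'x, 'a cmap) efun" where
  "yoneda_efun n C g =
    \<lparr>EFo = EFo g,
     EFa = (\<lambda>i\<in>{..n}. \<lambda>j\<in>{..n}.
       if i \<le> j then yoneda (j - i - 1) (EHom C (EFo g i) (EFo g j)) (EFa g i j) else empty_map)\<rparr>"

abbreviation "RC \<equiv> Fo (change_of_base W CSet (RH W H))"

lemma RC_simps:
  "EOb (RC C) = EOb C" "EHom (RC C) x y = R (EHom C x y)"
  "ECmp (RC C) x y z = Comp CSet (day (R (EHom C x y)) (R (EHom C y z)))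
    (R (TO W (EHom C x y) (EHom C y z))) (R (EHom C x z))
    (Fa (RH W H) (TO W (EHom C x y) (EHom C y z)) (EHom C x z) (ECmp C x y z))
    (Mu (RH W H) (EHom C x y) (EHom C y z))"
  "EId (RC C) x = Comp CSet (yo 0) (R (Unit W)) (R (EHom C x x))
    (Fa (RH W H) (Unit W) (EHom C x x) (EId C x)) (Eps (RH W H))"
  by (simp_all add: change_of_base_def CSet_simps(4,6))

lemma Wc_simps: "EOb (Wc_ob n) = {..n}" "EHom (Wc_ob n) = Wc_hom" "EId (Wc_ob n) i = Idn CSet (yo 0)"
  by (simp_all add: Wc_ob_def)

lemma h_le: "i \<le> j \<Longrightarrow> h i j = Fo H (j - i - 1)"
  by (simp add: h_def D_simps)

lemma split_arrow_eq: "split_arrow a b = Comp W (TO W (Fo H (a - 1)) (Fo H (b - 1))) (Fo H (a - 1 + (b - 1)))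
    (Fo H (a + b - 1)) (Fa H (a - 1 + (b - 1)) (a + b - 1) (split_cube a b)) (mu (a - 1) (b - 1))"
  by (simp add: split_arrow_def D_simps split_cube_def mu_def)

definition "eps' = inv_arrow W (Unit W) (Fo H 0) (Eps H)"

lemma eps: "inverse_arrows W (Unit W) (Fo H 0) (Eps H) eps'"
  unfolding eps'_def
  using strong_monoidal_functorD(2)[OF H] by (intro cat_inv_arrow W_rules) simp_all

lemma eps'_Hom: "eps' \<in> Hom W (Fo H 0) (Unit W)"
  using eps by (auto simp: inverse_arrows_def)

lemma R_eps: "Eps (RH W H) = yoneda 0 (Unit W) eps'"
  by (simp add: RH_def Let_def yoneda_def eps'_def)

text \<open>\<open>RH\<close> is built from the inverses of \<open>Mu H\<close> and
  \<open>Eps H\<close>, \<open>Phi\<close> from these maps themselves. Both the unit and the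
  composition axioms are translated by moving an isomorphism across the equation.\<close>

lemma iso_cancel:
  assumes e: "inverse_arrows W X Y e e'" and X: "X \<in> Ob W" and Y: "Y \<in> Ob W" and Z: "Z \<in> Ob W"
    and f: "f \<in> Hom W Y Z" and g: "g \<in> Hom W X Z"
  shows "f = Comp W Y X Z g e' \<longleftrightarrow> Comp W X Y Z f e = g"
proof
  note e' = e[unfolded inverse_arrows_def]
  assume "f = Comp W Y X Z g e'"
  then show "Comp W X Y Z f e = g"
    using e' X Y Z g by (simp add: in_W cat_assoc cat_comp_id)
next
  note e' = e[unfolded inverse_arrows_def]
  assume "Comp W X Y Z f e = g"
  then have "Comp W Y X Z g e' = Comp W Y Y Z f (Comp W Y X Y e e')"
    using e' X Y Z f by (auto simp: in_W cat_assoc)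
  then show "f = Comp W Y X Z g e'"
    using e' X Y Z f by (simp add: in_W cat_comp_id)
qed

text \<open>An equivalence for data \<open>g\<close> that are merely typed: one direction shows that
  \<open>yoneda_efun\<close> takes values in enriched functors, the other that a preimage found by
  Yoneda is an enriched functor.\<close>

lemma yoneda_efun_enriched_iff:
  assumes C: "enriched_typed W C"
    and ob: "\<And>i. i \<le> n \<Longrightarrow> EFo g i \<in> EOb C"
    and hom: "\<And>i j. i \<le> n \<Longrightarrow> j \<le> n \<Longrightarrow> EFa g i j \<in> Hom W (h i j) (EHom C (EFo g i) (EFo g j))"
    and ext: "EFo g \<in> extensional {..n}" "EFa g \<in> extensional {..n}"
      "\<And>i. i \<le> n \<Longrightarrow> EFa g i \<in> extensional {..n}"
  shows "enriched_functor CSet (Wc_ob n) (RC C) (yoneda_efun n C g) \<longleftrightarrow>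
    enriched_functor W (Fo (Phi W D) n) C g"
proof -
  let ?o = "EFo g" and ?a = "EFa g" and ?C = "\<lambda>i j. EHom C (EFo g i) (EFo g j)"
  have C_Ob: "?C i j \<in> Ob W" if "i \<le> n" "j \<le> n" for i j
    using enriched_typedD(1)[OF C] ob that by blast
  have C_cmp: "ECmp C (?o i) (?o j) (?o k) \<in> Hom W (TO W (?C i j) (?C j k)) (?C i k)"
    if "i \<le> n" "j \<le> n" "k \<le> n" for i j k
    using enriched_typedD(2)[OF C] ob that by blast
  have C_id: "EId C (?o i) \<in> Hom W (Unit W) (?C i i)" if "i \<le> n" for i
    using enriched_typedD(3)[OF C] ob that by blast
  have a: "?a i j \<in> Hom W (Fo H (j - i - 1)) (?C i j)" if "i \<le> j" "j \<le> n" for i j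
    using hom[of i j] that by (simp add: h_le)
  have Y_a: "EFa (yoneda_efun n C g) i j = yoneda (j - i - 1) (?C i j) (?a i j)" if "i \<le> j" "j \<le> n" for i j
    using that by (simp add: yoneda_efun_def)
  have Y_hom: "EFa (yoneda_efun n C g) i j \<in> psh_hom box (Wc_hom i j) (R (?C i j))" if "i \<le> n" "j \<le> n" for i j
  proof (cases "i \<le> j")
    case True
    then show ?thesis using that yoneda_Hom[OF C_Ob a[OF True]] by (simp add: Y_a Wc_hom_le)
  next
    case False
    then show ?thesis using that by (simp add: yoneda_efun_def Wc_hom_gr empty_map_def psh_hom_def restrict_def)
  qed
  have unit: "Comp CSet (yo 0) (Wc_hom i i) (R (?C i i)) (EFa (yoneda_efun n C g) i i) (Idn CSet (yo 0)) =
      EId (RC C) (?o i) \<longleftrightarrow>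
    Comp W (Unit W) (h i i) (?C i i) (?a i i) (Eps D) = EId C (?o i)" if i: "i \<le> n" for i
  proof -
    have aii: "?a i i \<in> Hom W (Fo H 0) (?C i i)" using a[of i i] i by simp
    have "Comp CSet (yo 0) (Wc_hom i i) (R (?C i i)) (EFa (yoneda_efun n C g) i i) (Idn CSet (yo 0)) =
        yoneda 0 (?C i i) (?a i i)"
      using yoneda_yo_map[OF C_Ob[OF i i] aii, of 0 "Idn box 0"] box_map.ident[of 0, folded box_simps(4)] i aii C_Ob[OF i i]
      by (simp add: Y_a Wc_hom_le cat_comp_id in_W yo_map_id H_id del: box_simps(4))
    moreover have "EId (RC C) (?o i) = yoneda 0 (?C i i) (Comp W (Fo H 0) (Unit W) (?C i i) (EId C (?o i)) eps')"
      using R_map_yoneda[OF _ C_Ob[OF i i] eps'_Hom C_id[OF i]] by (simp add: RC_simps R_eps in_W)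
    moreover have "Comp W (Fo H 0) (Unit W) (?C i i) (EId C (?o i)) eps' \<in> Hom W (Fo H 0) (?C i i)"
      using i C_Ob C_id eps'_Hom by (simp add: in_W)
    ultimately have "Comp CSet (yo 0) (Wc_hom i i) (R (?C i i)) (EFa (yoneda_efun n C g) i i) (Idn CSet (yo 0)) =
        EId (RC C) (?o i) \<longleftrightarrow> ?a i i = Comp W (Fo H 0) (Unit W) (?C i i) (EId C (?o i)) eps'"
      using yoneda_inj[OF C_Ob[OF i i] aii] by auto
    also have "\<dots> \<longleftrightarrow> Comp W (Unit W) (Fo H 0) (?C i i) (?a i i) (Eps H) = EId C (?o i)"
      using i by (intro iso_cancel[OF eps]) (simp_all add: in_W C_Ob aii C_id)
    finally show ?thesis by (simp add: h_le D_simps)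
  qed
  have cmp: "Comp CSet (day (Wc_hom i j) (Wc_hom j k)) (Wc_hom i k) (R (?C i k))
        (EFa (yoneda_efun n C g) i k) (ECmp (Wc_ob n) i j k) =
      Comp CSet (day (Wc_hom i j) (Wc_hom j k)) (day (R (?C i j)) (R (?C j k))) (R (?C i k))
        (ECmp (RC C) (?o i) (?o j) (?o k))
        (day_map (Wc_hom i j) (R (?C i j)) (Wc_hom j k) (R (?C j k))
          (EFa (yoneda_efun n C g) i j) (EFa (yoneda_efun n C g) j k)) \<longleftrightarrow>
      Comp W (TO W (h i j) (h j k)) (h i k) (?C i k) (?a i k) (ECmp (Fo (Phi W D) n) i j k) =
      Comp W (TO W (h i j) (h j k)) (TO W (?C i j) (?C j k)) (?C i k)
        (ECmp C (?o i) (?o j) (?o k))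
        (TA W (h i j) (?C i j) (h j k) (?C j k) (?a i j) (?a j k))" (is "?L = ?L' \<longleftrightarrow> ?M = ?M'")
    if ijk: "i \<le> n" "j \<le> n" "k \<le> n" for i j k
  proof (cases "i \<le> j \<and> j \<le> k")
    \<comment> \<open>The first equation is between maps out of an empty cubical set, the second
      between arrows out of an initial object, so both hold.\<close>
    case False
    have "cells (day (Wc_hom i j) (Wc_hom j k) :: 'a cset) l = {}" for l
    proof (cases "i \<le> j")
      case True
      then show ?thesis using False by (intro cells_day_empty(2)) (simp add: Wc_hom_gr)
    next
      case False
      then show ?thesis by (intro cells_day_empty(1)) (simp add: Wc_hom_gr)
    qed
    then have LL: "?L = ?L'" by (simp only: Comp_from_empty)
    have "?M \<in> Hom W (TO W (h i j) (h j k)) (?C i k)"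
      using enriched_typedD(2)[OF Phi_typed, unfolded Phi_Ob, of i n j k] ijk hom[OF ijk(1,3)]
      by (intro cat_comp W_rules h_Ob C_Ob) auto
    moreover have "?M' \<in> Hom W (TO W (h i j) (h j k)) (?C i k)"
      using ijk by (intro cat_comp W_rules h_Ob C_Ob C_cmp hom)
    ultimately have "?M = ?M'"
      by (rule is_initial_eq[OF initial_TO_h[OF False] C_Ob[OF ijk(1,3)]])
    then show ?thesis by (rule iffI) (rule LL)
  next
    case True
    let ?p = "j - i - 1" and ?q = "k - j - 1" and ?r = "k - i - 1"
    let ?w = "split_cube (j - i) (k - j)"
    let ?c = "ECmp C (?o i) (?o j) (?o k)"
    let ?H = "TO W (Fo H ?p) (Fo H ?q)" let ?CC = "TO W (?C i j) (?C j k)"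
    let ?ab = "TA W (Fo H ?p) (?C i j) (Fo H ?q) (?C j k) (?a i j) (?a j k)"
    have le: "i \<le> j" "j \<le> k" "i \<le> k" using True by auto
    have sum: "(j - i) + (k - j) - 1 = ?r" using True by auto
    have w: "box_map (?p + ?q) ?r ?w"
      using box_map_split_cube[of "j - i" "k - j"] by (simp only: sum)
    note in_C = C_Ob[OF ijk(1,2)] C_Ob[OF ijk(2,3)] C_Ob[OF ijk(1,3)] C_cmp[OF ijk]
      a[OF le(1) ijk(2)] a[OF le(2) ijk(3)] a[OF le(3) ijk(3)]
    have ab: "?ab \<in> Hom W ?H ?CC" by (intro W_rules H_Ob in_C)
    let ?f = "Comp W (Fo H (?p + ?q)) (Fo H ?r) (?C i k) (?a i k) (Fa H (?p + ?q) ?r ?w)"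
    let ?g = "Comp W ?H ?CC (?C i k) ?c ?ab"
    have f: "?f \<in> Hom W (Fo H (?p + ?q)) (?C i k)" by (intro in_W in_C w)
    have g: "?g \<in> Hom W ?H (?C i k)" by (intro in_W in_C ab)
    have "?L = Comp CSet (day (yo ?p) (yo ?q)) (yo (?p + ?q)) (R (?C i k))
       (Comp CSet (yo (?p + ?q)) (yo ?r) (R (?C i k)) (yoneda ?r (?C i k) (?a i k)) (yo_map (?p + ?q) ?r ?w))
       (day_yo ?p ?q)"
      unfolding Wc_cmp[OF le(1,2)] Wc_hom_le[OF le(1)] Wc_hom_le[OF le(2)] Wc_hom_le[OF le(3)]
        Y_a[OF le(3) ijk(3)]
      by (rule Comp_day_yo_assoc)
    also have "\<dots> = Comp CSet (day (yo ?p) (yo ?q)) (yo (?p + ?q)) (R (?C i k))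
       (yoneda (?p + ?q) (?C i k) ?f) (day_yo ?p ?q)"
      by (simp only: yoneda_yo_map[OF in_C(3) in_C(7) w])
    finally have L: "?L = \<dots>" .
    let ?g' = "Comp W (Fo H (?p + ?q)) ?CC (?C i k) ?c (Comp W (Fo H (?p + ?q)) ?H ?CC ?ab (mui ?p ?q))"
    have g': "?g' \<in> Hom W (Fo H (?p + ?q)) (?C i k)" by (intro in_W in_C ab)
    have L': "?L' = Comp CSet (day (yo ?p) (yo ?q)) (yo (?p + ?q)) (R (?C i k))
       (yoneda (?p + ?q) (?C i k) ?g') (day_yo ?p ?q)"
      unfolding Wc_hom_le[OF le(1)] Wc_hom_le[OF le(2)] RC_simps
        Y_a[OF le(1) ijk(2)] Y_a[OF le(2) ijk(3)]
      by (rule R_cmp_yoneda) (rule in_C)+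
    \<comment> \<open>Both sides are now classified by arrows out of \<open>Fo H (?p + ?q)\<close>
      and may be compared at the universal element.\<close>
    have "?L = ?L' \<longleftrightarrow> ?f = ?g'"
      unfolding L L' by (rule iffI[OF yoneda_day_yo_inj[OF in_C(3) f g']]) (assumption, simp only:)
    also have "?g' = Comp W (Fo H (?p + ?q)) ?H (?C i k) ?g (mui ?p ?q)"
      by (rule cat_assoc[symmetric]) (intro in_W in_C ab)+
    \<comment> \<open>Moving \<open>mui\<close> to the other side as \<open>mu\<close> produces the
      composition of \<open>Phi W D\<close>, which is \<open>mu\<close> followed by the image of
      \<open>split_cube\<close>.\<close>
    also have "?f = \<dots> \<longleftrightarrow> Comp W ?H (Fo H (?p + ?q)) (?C i k) ?f (mu ?p ?q) = ?g"
      by (rule iso_cancel[OF mu _ _ _ f g]) (intro in_W in_C)+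
    also have "Comp W ?H (Fo H (?p + ?q)) (?C i k) ?f (mu ?p ?q) = ?M"
      unfolding h_le[OF le(1)] h_le[OF le(2)] h_le[OF le(3)] Phi_cmp(1)[OF le(1,2)] split_arrow_eq sum
      by (rule cat_assoc) (intro in_W in_C w)+
    also have "?g = ?M'"
      unfolding h_le[OF le(1)] h_le[OF le(2)] by (rule refl)
    finally show ?thesis .
  qed
  have Y_o: "EFo (yoneda_efun n C g) = ?o" by (simp add: yoneda_efun_def)
  have Y_ext: "EFa (yoneda_efun n C g) \<in> extensional {..n}" "\<And>i. i \<le> n \<Longrightarrow> EFa (yoneda_efun n C g) i \<in> extensional {..n}"
    by (simp_all add: yoneda_efun_def)
  have Y_PiE: "EFa (yoneda_efun n C g) \<in> (\<Pi>\<^sub>E i\<in>{..n}. \<Pi>\<^sub>E j\<in>{..n}. psh_hom box (Wc_hom i j) (R (?C i j)))"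
    using Y_hom Y_ext by (simp add: PiE_iff)
  have a_PiE: "?a \<in> (\<Pi>\<^sub>E i\<in>{..n}. \<Pi>\<^sub>E j\<in>{..n}. Hom W (h i j) (?C i j))"
    using hom ext by (simp add: PiE_iff)
  show ?thesis
    \<comment> \<open>The two definitions are matched conjunct by conjunct: objects agree, the
      typing of homs holds on both sides, and units and compositions are translated by
      \<open>unit\<close> and \<open>cmp\<close>.\<close>
    unfolding enriched_functor_def Wc_simps Phi_Ob Y_o RC_simps(1,2) CSet_simps(3-6)
    apply (rule conj_cong[OF refl], rule conj_cong)
     apply (simp only: Y_PiE a_PiE)
    apply (rule conj_cong; intro ball_cong refl)
     apply (rule unit, simp)
    apply (rule cmp; simp)
    done
qed

text \<open>Arrows with \<open>i \<le> j\<close> are determined and supplied by the Yoneda lemma,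
  the remaining ones by initiality.\<close>

lemma yoneda_efun_bij:
  assumes C: "enriched_typed W C"
  shows "bij_betw (yoneda_efun n C) {g. enriched_functor W (Fo (Phi W D) n) C g}
    {G. enriched_functor CSet (Wc_ob n) (RC C) G}"
proof -
  have typed: "i \<le> n \<Longrightarrow> EFo g i \<in> EOb C" "i \<le> n \<Longrightarrow> j \<le> n \<Longrightarrow>
      EFa g i j \<in> Hom W (h i j) (EHom C (EFo g i) (EFo g j))"
    "EFo g \<in> extensional {..n}" "EFa g \<in> extensional {..n}" "i \<le> n \<Longrightarrow> EFa g i \<in> extensional {..n}"
    if "enriched_functor W (Fo (Phi W D) n) C g" for g i j
    using enriched_functorD(1,2,5-7)[OF that] by (simp_all add: Phi_Ob)
  have "inj_on (yoneda_efun n C) {g. enriched_functor W (Fo (Phi W D) n) C g}"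
  proof (rule inj_onI, unfold mem_Collect_eq)
    fix g g' assume g: "enriched_functor W (Fo (Phi W D) n) C g"
      and g': "enriched_functor W (Fo (Phi W D) n) C g'" and eq: "yoneda_efun n C g = yoneda_efun n C g'"
    have o: "EFo g = EFo g'" using arg_cong[OF eq, of EFo] by (simp add: yoneda_efun_def)
    show "g = g'"
    proof (rule efun_eqI[where A = "{..n}"])
      fix i j assume i: "i \<in> {..n}" and j: "j \<in> {..n}"
      have Cij: "EHom C (EFo g' i) (EFo g' j) \<in> Ob W"
        using enriched_typedD(1)[OF C] typed(1)[OF g'] i j by simp
      have in_h: "EFa g i j \<in> Hom W (h i j) (EHom C (EFo g' i) (EFo g' j))"
        "EFa g' i j \<in> Hom W (h i j) (EHom C (EFo g' i) (EFo g' j))"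
        using typed(2)[OF g, of i j] typed(2)[OF g', of i j] i j o by simp_all
      show "EFa g i j = EFa g' i j"
      proof (cases "i \<le> j")
        case True
        have "EFa (yoneda_efun n C g) i j = EFa (yoneda_efun n C g') i j" by (simp only: eq)
        then show ?thesis
          using True i j in_h by (intro yoneda_inj[OF Cij]) (simp_all add: yoneda_efun_def o h_le)
      next
        case False
        then show ?thesis using in_h by (intro is_initial_eq[OF initial_h Cij]) simp_all
      qed
    qed (use typed[OF g] typed[OF g'] o in simp_all)
  qed
  moreover have "yoneda_efun n C g \<in> {G. enriched_functor CSet (Wc_ob n) (RC C) G}"
    if "enriched_functor W (Fo (Phi W D) n) C g" for g
    using yoneda_efun_enriched_iff[OF C typed[OF that]] that by simp
  moreover have "\<exists>g. enriched_functor W (Fo (Phi W D) n) C g \<and> G = yoneda_efun n C g"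
    if G: "enriched_functor CSet (Wc_ob n) (RC C) G" for G
  proof -
    note G' = enriched_functorD(1,2,5-7)[OF G, unfolded Wc_simps RC_simps(1,2) CSet_simps(3)]
    let ?C = "\<lambda>i j. EHom C (EFo G i) (EFo G j)"
    have C_Ob: "?C i j \<in> Ob W" if "i \<le> n" "j \<le> n" for i j
      using enriched_typedD(1)[OF C] G'(1) that by simp
    \<comment> \<open>For \<open>j < i\<close> only an arrow of the right type is asked for, and the
      one out of the initial object serves.\<close>
    have "\<exists>a \<in> Hom W (h i j) (?C i j). i \<le> j \<longrightarrow> EFa G i j = yoneda (j - i - 1) (?C i j) a"
      if ij: "i \<le> n" "j \<le> n" for i j
    proof (cases "i \<le> j")
      case True
      then show ?thesis
        using yoneda_ex[OF C_Ob[OF ij], of "EFa G i j" "j - i - 1"] G'(2)[of i j] ij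
        by (simp add: Wc_hom_le h_le)
    next
      case False
      then show ?thesis using is_initial_the_arrow(1)[OF initial_h C_Ob[OF ij], of j i] by (intro bexI) auto
    qed
    then obtain a where a: "\<And>i j. i \<le> n \<Longrightarrow> j \<le> n \<Longrightarrow> a i j \<in> Hom W (h i j) (?C i j)"
      "\<And>i j. i \<le> n \<Longrightarrow> j \<le> n \<Longrightarrow> i \<le> j \<Longrightarrow> EFa G i j = yoneda (j - i - 1) (?C i j) (a i j)"
      by metis
    define g where "g = \<lparr>EFo = EFo G, EFa = (\<lambda>i\<in>{..n}. \<lambda>j\<in>{..n}. a i j)\<rparr>"
    have "yoneda_efun n C g = G"
    proof (rule efun_eqI[where A = "{..n}"])
      fix i j assume ij: "i \<in> {..n}" "j \<in> {..n}"
      show "EFa (yoneda_efun n C g) i j = EFa G i j"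
      proof (cases "i \<le> j")
        case True
        then show ?thesis using ij a(2) by (simp add: yoneda_efun_def g_def)
      next
        case False
        have "EFa G i j \<in> psh_hom box empty_cset (R (?C i j))"
          using G'(2)[OF ij] False by (simp add: Wc_hom_gr)
        then have "EFa G i j = empty_map"
          by (auto simp: psh_hom_def empty_map_def PiE_iff extensional_def fun_eq_iff)
        then show ?thesis using False ij by (simp add: yoneda_efun_def)
      qed
    qed (use G' in \<open>simp_all add: yoneda_efun_def g_def\<close>)
    moreover have "enriched_functor CSet (Wc_ob n) (RC C) (yoneda_efun n C g) \<longleftrightarrow>
        enriched_functor W (Fo (Phi W D) n) C g"
      using G' a(1) by (intro yoneda_efun_enriched_iff[OF C]) (simp_all add: g_def)
    ultimately show ?thesis using G by auto
  qed
  ultimately show ?thesis unfolding bij_betw_def by blast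
qed

text \<open>On representables \<open>Wc\<close> acts through \<open>segment_cube\<close>, and
  \<open>Phi W D\<close> acts by the image of this same cube map under \<open>H\<close>; naturality
  of Yoneda in the representing cube identifies the two.\<close>

lemma yoneda_efun_act:
  assumes C: "enriched_typed W C" and f: "f \<in> Hom Delta m n"
    and g: "enriched_functor W (Fo (Phi W D) n) C g"
  shows "efun_comp CSet (Wc_ob m) (Wc_ob n) (RC C) (yoneda_efun n C g) (Fa Wc m n f) =
    yoneda_efun m C (efun_comp W (Fo (Phi W D) m) (Fo (Phi W D) n) C g (Fa (Phi W D) m n f))"
proof (rule efun_eqI[where A = "{..m}"])
  fix i j assume i: "i \<in> {..m}" and j: "j \<in> {..m}"
  have fn: "f i \<le> n" "f j \<le> n" using DeltaD(1)[OF f] i j by auto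
  show "EFa (efun_comp CSet (Wc_ob m) (Wc_ob n) (RC C) (yoneda_efun n C g) (Fa Wc m n f)) i j =
    EFa (yoneda_efun m C (efun_comp W (Fo (Phi W D) m) (Fo (Phi W D) n) C g (Fa (Phi W D) m n f))) i j"
  proof (cases "i \<le> j")
    case True
    then have le: "f i \<le> f j" using DeltaD(2)[OF f] j by simp
    have Cij: "EHom C (EFo g (f i)) (EFo g (f j)) \<in> Ob W"
      using enriched_typedD(1)[OF C] enriched_functorD(1)[OF g] fn by (simp add: Phi_Ob)
    have a: "EFa g (f i) (f j) \<in> Hom W (Fo H (f j - f i - 1)) (EHom C (EFo g (f i)) (EFo g (f j)))"
      using enriched_functorD(2)[OF g, of "f i" "f j"] fn le by (simp add: Phi_Ob h_le)
    have s: "box_map (j - i - 1) (f j - f i - 1) (segment_cube f i j)"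
      using box_map_segment_cube[OF f True] j by simp
    show ?thesis
      using True le i j fn yoneda_yo_map[OF Cij a s]
      by (simp add: efun_comp_def yoneda_efun_def Wc_simps RC_simps(2) Wc_Fa[OF f] Wc_fun_def Wc_hom_le Phi_Ob Phi_Fa h_le
        D_simps segment_cube_def)
  next
    case False
    then show ?thesis
      using i j by (simp add: efun_comp_def yoneda_efun_def Wc_simps Wc_hom_gr Comp_from_empty)
  qed
qed (auto simp: efun_comp_def yoneda_efun_def Wc_simps Phi_Ob Phi_Fa Wc_Fa[OF f] Wc_fun_def DeltaD(1)[OF f])

text \<open>Naturality of Yoneda in the object \<open>A\<close> of \<open>W\<close>, applied to the
  hom arrows of \<open>F\<close>.\<close>

lemma yoneda_efun_map:
  assumes C: "enriched_typed W C" and C': "enriched_typed W C'" and F: "enriched_functor W C C' F"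
    and g: "enriched_functor W (Fo (Phi W D) n) C g"
  shows "efun_comp CSet (Wc_ob n) (RC C) (RC C') (Fa (change_of_base W CSet (RH W H)) C C' F) (yoneda_efun n C g) =
    yoneda_efun n C' (efun_comp W (Fo (Phi W D) n) C C' F g)"
proof (rule efun_eqI[where A = "{..n}"])
  fix i j assume i: "i \<in> {..n}" and j: "j \<in> {..n}"
  have o: "EFo g i \<in> EOb C" "EFo g j \<in> EOb C" using enriched_functorD(1)[OF g] i j by (simp_all add: Phi_Ob)
  show "EFa (efun_comp CSet (Wc_ob n) (RC C) (RC C') (Fa (change_of_base W CSet (RH W H)) C C' F) (yoneda_efun n C g)) i j =
    EFa (yoneda_efun n C' (efun_comp W (Fo (Phi W D) n) C C' F g)) i j"
  proof (cases "i \<le> j")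
    case True
    have Cij: "EHom C (EFo g i) (EFo g j) \<in> Ob W"
      "EHom C' (EFo F (EFo g i)) (EFo F (EFo g j)) \<in> Ob W"
      using enriched_typedD(1)[OF C] enriched_typedD(1)[OF C'] enriched_functorD(1)[OF F] o by simp_all
    have a: "EFa g i j \<in> Hom W (Fo H (j - i - 1)) (EHom C (EFo g i) (EFo g j))"
      using enriched_functorD(2)[OF g, of i j] i j True by (simp add: Phi_Ob h_le)
    show ?thesis
      using True i j o R_map_yoneda[OF Cij a enriched_functorD(2)[OF F o]]
      by (simp add: efun_comp_def yoneda_efun_def Wc_simps RC_simps(2) Wc_hom_le Phi_Ob h_le)
        (simp add: change_of_base_def)
  next
    case False
    then show ?thesis
      using i j by (simp add: efun_comp_def yoneda_efun_def Wc_simps Wc_hom_gr Comp_from_empty)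
  qed
qed (auto simp: efun_comp_def yoneda_efun_def Wc_simps Phi_Ob change_of_base_def)

lemma N_H_simps:
  "cells (Fo (N_H W H) C) n = {G. enriched_functor CSet (Wc_ob n) (RC C) G}"
  "act (Fo (N_H W H) C) m n f G = efun_comp CSet (Wc_ob m) (Wc_ob n) (RC C) G (Fa Wc m n f)"
  "Fa (N_H W H) C C' F n = (\<lambda>G\<in>{G. enriched_functor CSet (Wc_ob n) (RC C) G}.
    efun_comp CSet (Wc_ob n) (RC C) (RC C') (Fa (change_of_base W CSet (RH W H)) C C' F) G)"
  by (simp_all add: N_H_def N_cub_def nerve_def functor_comp_def Wc_Fo)

lemma nerve_simps:
  "cells (Fo (nerve V \<DD>) C) n = {G. enriched_functor V (Fo \<DD> n) C G}"
  "act (Fo (nerve V \<DD>) C) m n f G = efun_comp V (Fo \<DD> m) (Fo \<DD> n) C G (Fa \<DD> m n f)"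
  "Fa (nerve V \<DD>) C C' F n = (\<lambda>G\<in>{G. enriched_functor V (Fo \<DD> n) C G}. efun_comp V (Fo \<DD> n) C C' F G)"
  by (simp_all add: nerve_def)

lemma category_Delta: "category Delta"
  by (auto simp: category_def Delta_id Delta_comp)
    (auto simp: Delta_def compose_def fun_eq_iff PiE_iff extensional_def)

lemma category_ECat: "category (ECat W)"
proof -
  note typed = enriched_category_typed and cat = monoidal_category_cat[OF W]
  have "enriched_functor W C C (efun_id W C)" if "enriched_category W C" for C :: "('x, 'o, 'a) ecat"
    by (rule enriched_functorI)
      (use enriched_typedD[OF typed[OF that]] in \<open>auto simp: efun_id_def in_W cat_rules monoidal_TA_id[OF W]\<close>)
  then show ?thesis
    unfolding category_def
    by (auto simp: ECat_def efun_comp_id[OF cat typed typed] efun_id_comp[OF cat typed typed]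
      enriched_functor_efun_comp[OF W typed typed typed] efun_comp_assoc[OF cat typed typed typed typed])
qed

lemma N_H_iso: "psh_functor_iso (ECat W) Delta (N_H W H) (nerve W (Phi W D))"
proof (rule psh_functor_iso_transport[OF category_ECat category_Delta nerve_Phi_functor,
    where \<psi> = "\<lambda>C n. yoneda_efun n C"])
  fix C n assume "C \<in> Ob (ECat W)"
  then have C: "enriched_typed W C" by (simp add: ECat_def enriched_category_typed)
  show "bij_betw (yoneda_efun n C) (cells (Fo (nerve W (Phi W D)) C) n) (cells (Fo (N_H W H) C) n)"
    unfolding N_H_simps nerve_simps by (rule yoneda_efun_bij[OF C])
next
  fix C m n f x assume "C \<in> Ob (ECat W)"
  then have C: "enriched_typed W C" by (simp add: ECat_def enriched_category_typed)
  assume "f \<in> Hom Delta m n" "x \<in> cells (Fo (nerve W (Phi W D)) C) n"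
  then show "act (Fo (N_H W H) C) m n f (yoneda_efun n C x) = yoneda_efun m C (act (Fo (nerve W (Phi W D)) C) m n f x)"
    unfolding N_H_simps nerve_simps by (intro yoneda_efun_act[OF C]) simp_all
next
  fix C C' F n x assume "C \<in> Ob (ECat W)" "C' \<in> Ob (ECat W)" and F: "F \<in> Hom (ECat W) C C'"
  then have C: "enriched_typed W C" "enriched_typed W C'" by (simp_all add: ECat_def enriched_category_typed)
  assume x: "x \<in> cells (Fo (nerve W (Phi W D)) C) n"
  then have "yoneda_efun n C x \<in> {G. enriched_functor CSet (Wc_ob n) (RC C) G}"
    using yoneda_efun_bij[OF C(1), of n] by (auto simp: bij_betw_def nerve_simps)
  then show "Fa (N_H W H) C C' F n (yoneda_efun n C x) = yoneda_efun n C' (Fa (nerve W (Phi W D)) C C' F n x)"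
    using x F yoneda_efun_map[OF C, of F n x] by (simp add: N_H_simps nerve_simps ECat_def)
qed (simp_all add: N_H_simps Delta_def)

end

theorem corollary3p11:
  fixes W :: "('o, 'a) moncat"
    and H :: "(nat, bool list \<Rightarrow> bool list, 'o, 'a) mfunctr"
  assumes "monoidal_category W"
    and "cocomplete TYPE('u) W"
    and "tensor_preserves_colimits TYPE('u) W"
    and "strong_monoidal_functor box W H"
  shows "necklicial_with W
    (N_H W H :: (('u, 'o, 'a) ecat, ('u, 'u, 'a) efun,
       (nat, nat \<Rightarrow> nat, (nat, 'u, 'a cmap) efun) psh,
       nat \<Rightarrow> (nat, 'u, 'a cmap) efun \<Rightarrow> (nat, 'u, 'a cmap) efun) functr)
    (monoidal_functor_comp W box Nec H nec_dim)"
proof -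
  interpret cubical_nerve W H
    using assms(1,4) cocomplete_initial[OF assms(2,3)] by unfold_locales
  show ?thesis
    unfolding necklicial_with_def using strong_monoidal_nec[OF assms(1,4)] N_H_iso by blast
qed

end
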